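(* Let $n\ge 1$ and let $G$ be a rank $n$ GBS group. Then $G$ is residually finite if and only if at least one of the following holds: (a) $G\cong \mathbb{Z}^n\ast_{\varphi}$ is an ascending HNN extension, i.e. there is a monomorphism $\varphi\colon\mathbb{Z}^n\to\mathbb{Z}^n$ such that $G\cong\langle \mathbb{Z}^n, t\mid tat^{-1}=\varphi(a),\ a\in\mathbb{Z}^n\rangle$; (b) $G$ is virtually $\mathbb{Z}^n$-by-free.
   Context: A rank $n$ generalized Baumslag–Solitar group (rank $n$ GBS group) is a group that is isomorphic to the fundamental group of a finite connected graph of groups in which every vertex group and every edge group is isomorphic to $\mathbb{Z}^n$. A group $G$ is residually finite if the intersection of all its finite-index normal subgroups is trivial. A group is $\mathbb{Z}^n$-by-free if it has a normal subgroup isomorphic to $\mathbb{Z}^n$ with free quotient; it is virtually $\mathbb{Z}^n$-by-free if it has a finite-index subgroup that is $\mathbb{Z}^n$-by-free. (The trivial group and $\mathbb{Z}$ count as free groups.) *)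

theory Defs
  imports "HOL-Algebra.Product_Groups"
begin

section \<open>Groups given by generators and relations\<close>

text \<open>The letter \<open>(x, True)\<close> stands for the generator \<open>x\<close> and \<open>(x, False)\<close> for its inverse.\<close>

type_synonym 'x word = "('x \<times> bool) list"

definition words :: "'x set \<Rightarrow> 'x word set"
  where "words X = lists (X \<times> UNIV)"

text \<open>A relation \<open>l = r\<close> is represented by the pair \<open>(l, r)\<close>.\<close>

inductive_set pres_rel :: "'x set \<Rightarrow> ('x word \<times> 'x word) set \<Rightarrow> ('x word \<times> 'x word) set"
  for X :: "'x set" and R :: "('x word \<times> 'x word) set"
  where
    refl: "u \<in> words X \<Longrightarrow> (u, u) \<in> pres_rel X R"
  | sym: "(u, v) \<in> pres_rel X R \<Longrightarrow> (v, u) \<in> pres_rel X R"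
  | trans: "(u, v) \<in> pres_rel X R \<Longrightarrow> (v, w) \<in> pres_rel X R \<Longrightarrow> (u, w) \<in> pres_rel X R"
  | cancel: "u \<in> words X \<Longrightarrow> v \<in> words X \<Longrightarrow> x \<in> X \<Longrightarrow>
      (u @ [(x, b), (x, \<not> b)] @ v, u @ v) \<in> pres_rel X R"
  | relation: "(l, r) \<in> R \<Longrightarrow> l \<in> words X \<Longrightarrow> r \<in> words X \<Longrightarrow> u \<in> words X \<Longrightarrow> v \<in> words X \<Longrightarrow>
      (u @ l @ v, u @ r @ v) \<in> pres_rel X R"

definition presented_group :: "'x set \<Rightarrow> ('x word \<times> 'x word) set \<Rightarrow> 'x word set monoid"
  where "presented_group X R =
    \<lparr>carrier = words X // pres_rel X R,
     monoid.mult = (\<lambda>A B. \<Union>a\<in>A. \<Union>b\<in>B. pres_rel X R `` {a @ b}),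
     one = pres_rel X R `` {[]}\<rparr>"

definition free_group :: "'x set \<Rightarrow> 'x word set monoid"
  where "free_group X = presented_group X {}"

text \<open>A basis of \<open>F\<close> is a subset of \<open>carrier F\<close>, so letting \<open>X\<close> range over sets of
  the element type of \<open>F\<close> loses no free group.  The basis may be empty, finite or infinite.\<close>

definition is_free :: "('a, 'b) monoid_scheme \<Rightarrow> bool"
  where "is_free F \<longleftrightarrow> (\<exists>X :: 'a set. F \<cong> free_group X)"


section \<open>Graphs in the sense of Serre\<close>

record ('v, 'e) sgraph =
  verts :: "'v set"
  edges :: "'e set"
  src :: "'e \<Rightarrow> 'v"
  tgt :: "'e \<Rightarrow> 'v"
  opp :: "'e \<Rightarrow> 'e"

text \<open>Each geometric edge occurs in \<open>edges\<close> with both orientations, exchanged by \<open>opp\<close>.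
  Loops and multiple edges are allowed.\<close>

definition serre_graph :: "('v, 'e, 'm) sgraph_scheme \<Rightarrow> bool"
  where "serre_graph \<Gamma> \<longleftrightarrow>
    (\<forall>e \<in> edges \<Gamma>. src \<Gamma> e \<in> verts \<Gamma> \<and> tgt \<Gamma> e \<in> verts \<Gamma> \<and>
      opp \<Gamma> e \<in> edges \<Gamma> \<and> opp \<Gamma> e \<noteq> e \<and> opp \<Gamma> (opp \<Gamma> e) = e \<and>
      src \<Gamma> (opp \<Gamma> e) = tgt \<Gamma> e)"

fun walk :: "('v, 'e, 'm) sgraph_scheme \<Rightarrow> 'v \<Rightarrow> 'e list \<Rightarrow> 'v \<Rightarrow> bool"
  where
    "walk \<Gamma> u [] v \<longleftrightarrow> u \<in> verts \<Gamma> \<and> u = v"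
  | "walk \<Gamma> u (e # p) v \<longleftrightarrow> e \<in> edges \<Gamma> \<and> src \<Gamma> e = u \<and> walk \<Gamma> (tgt \<Gamma> e) p v"

definition connected_graph :: "('v, 'e, 'm) sgraph_scheme \<Rightarrow> bool"
  where "connected_graph \<Gamma> \<longleftrightarrow>
    verts \<Gamma> \<noteq> {} \<and> (\<forall>u \<in> verts \<Gamma>. \<forall>v \<in> verts \<Gamma>. \<exists>p. walk \<Gamma> u p v)"

text \<open>Circuits of length 1 (loops) and 2 (pairs of parallel edges) are included; the last
  conjunct only excludes going back and forth along one geometric edge.\<close>

definition circuit :: "('v, 'e, 'm) sgraph_scheme \<Rightarrow> 'e list \<Rightarrow> bool"
  where "circuit \<Gamma> p \<longleftrightarrow>
    p \<noteq> [] \<and> (\<exists>v. walk \<Gamma> v p v) \<and> distinct (map (src \<Gamma>) p) \<and>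
    (\<forall>i. Suc i < length p \<longrightarrow> p ! Suc i \<noteq> opp \<Gamma> (p ! i))"

definition tree :: "('v, 'e, 'm) sgraph_scheme \<Rightarrow> bool"
  where "tree \<Gamma> \<longleftrightarrow> serre_graph \<Gamma> \<and> connected_graph \<Gamma> \<and> (\<nexists>p. circuit \<Gamma> p)"

definition maximal_tree :: "('v, 'e, 'm) sgraph_scheme \<Rightarrow> 'e set \<Rightarrow> bool"
  where "maximal_tree \<Gamma> T \<longleftrightarrow> T \<subseteq> edges \<Gamma> \<and> tree (\<Gamma>\<lparr>edges := T\<rparr>)"


section \<open>Graphs of groups and their fundamental groups\<close>

record ('v, 'e, 'g, 'h) gog = "('v, 'e) sgraph" +
  vgrp :: "'v \<Rightarrow> 'g monoid"
  egrp :: "'e \<Rightarrow> 'h monoid"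
  emb :: "'e \<Rightarrow> 'h \<Rightarrow> 'g"

definition graph_of_groups :: "('v, 'e, 'g, 'h) gog \<Rightarrow> bool"
  where "graph_of_groups \<G> \<longleftrightarrow>
    serre_graph \<G> \<and> connected_graph \<G> \<and>
    (\<forall>v \<in> verts \<G>. group (vgrp \<G> v)) \<and>
    (\<forall>e \<in> edges \<G>. group (egrp \<G> e) \<and> egrp \<G> (opp \<G> e) = egrp \<G> e \<and>
      emb \<G> e \<in> mon (egrp \<G> e) (vgrp \<G> (tgt \<G> e)))"

datatype ('v, 'e, 'g) gog_gen = VElt 'v 'g | Edge 'e

definition gog_gens :: "('v, 'e, 'g, 'h) gog \<Rightarrow> ('v, 'e, 'g) gog_gen set"
  where "gog_gens \<G> = {VElt v g | v g. v \<in> verts \<G> \<and> g \<in> carrier (vgrp \<G> v)} \<union> Edge ` edges \<G>"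

text \<open>The relations are, in this order: the multiplication tables of the vertex groups,
  \<open>opp e = e\<^sup>-\<^sup>1\<close>, the edge relations \<open>e \<alpha>\<^sub>e(a) e\<^sup>-\<^sup>1 = \<alpha>\<^bsub>opp e\<^esub>(a)\<close>, and \<open>e = 1\<close> for \<open>e\<close> in the
  maximal tree \<open>T\<close>.\<close>

definition gog_rels ::
    "('v, 'e, 'g, 'h) gog \<Rightarrow> 'e set \<Rightarrow> (('v, 'e, 'g) gog_gen word \<times> ('v, 'e, 'g) gog_gen word) set"
  where "gog_rels \<G> T =
    {([(VElt v g, True), (VElt v h, True)], [(VElt v (g \<otimes>\<^bsub>vgrp \<G> v\<^esub> h), True)]) | v g h.
       v \<in> verts \<G> \<and> g \<in> carrier (vgrp \<G> v) \<and> h \<in> carrier (vgrp \<G> v)} \<union>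
    {([(Edge (opp \<G> e), True)], [(Edge e, False)]) | e. e \<in> edges \<G>} \<union>
    {([(Edge e, True), (VElt (tgt \<G> e) (emb \<G> e a), True), (Edge e, False)],
      [(VElt (src \<G> e) (emb \<G> (opp \<G> e) a), True)]) | e a.
       e \<in> edges \<G> \<and> a \<in> carrier (egrp \<G> e)} \<union>
    {([(Edge e, True)], []) | e. e \<in> T}"

definition fundamental_group ::
    "('v, 'e, 'g, 'h) gog \<Rightarrow> 'e set \<Rightarrow> ('v, 'e, 'g) gog_gen word set monoid"
  where "fundamental_group \<G> T = presented_group (gog_gens \<G>) (gog_rels \<G> T)"


section \<open>Generalized Baumslag--Solitar groups\<close>

definition Z_pow :: "nat \<Rightarrow> (nat \<Rightarrow> int) monoid"
  where "Z_pow n = product_group {..<n} (\<lambda>_. integer_group)"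

text \<open>Vertices and edges are taken in \<^typ>\<open>nat\<close>, and vertex and edge groups on carriers of
  type \<^typ>\<open>nat \<Rightarrow> int\<close>; up to isomorphism this covers every finite graph of groups
  whose vertex and edge groups are copies of \<open>\<int>\<^sup>n\<close>.  The isomorphism type of the fundamental group does not depend on the
  maximal tree.\<close>

definition gbs_group :: "nat \<Rightarrow> ('a, 'b) monoid_scheme \<Rightarrow> bool"
  where "gbs_group n G \<longleftrightarrow> group G \<and>
    (\<exists>(\<G> :: (nat, nat, nat \<Rightarrow> int, nat \<Rightarrow> int) gog) T.
      graph_of_groups \<G> \<and> finite (verts \<G>) \<and> finite (edges \<G>) \<and>
      (\<forall>v \<in> verts \<G>. vgrp \<G> v \<cong> Z_pow n) \<and>
      (\<forall>e \<in> edges \<G>. egrp \<G> e \<cong> Z_pow n) \<and>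
      maximal_tree \<G> T \<and> G \<cong> fundamental_group \<G> T)"

datatype 'g hnn_gen = Base 'g | Stable

definition ascending_hnn :: "('g, 'm) monoid_scheme \<Rightarrow> ('g \<Rightarrow> 'g) \<Rightarrow> 'g hnn_gen word set monoid"
  where "ascending_hnn A \<phi> = presented_group (insert Stable (Base ` carrier A))
    ({([(Base a, True), (Base b, True)], [(Base (a \<otimes>\<^bsub>A\<^esub> b), True)]) | a b.
        a \<in> carrier A \<and> b \<in> carrier A} \<union>
     {([(Stable, True), (Base a, True), (Stable, False)], [(Base (\<phi> a), True)]) | a.
        a \<in> carrier A})"


section \<open>Residual finiteness and virtually \<open>\<int>\<^sup>n\<close>-by-free groups\<close>

definition residually_finite :: "('a, 'b) monoid_scheme \<Rightarrow> bool"
  where "residually_finite G \<longleftrightarrow> \<Inter> {N. N \<lhd> G \<and> finite (rcosets\<^bsub>G\<^esub> N)} = {\<one>\<^bsub>G\<^esub>}"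

definition Z_pow_by_free :: "nat \<Rightarrow> ('a, 'b) monoid_scheme \<Rightarrow> bool"
  where "Z_pow_by_free n G \<longleftrightarrow>
    (\<exists>N. N \<lhd> G \<and> G\<lparr>carrier := N\<rparr> \<cong> Z_pow n \<and> is_free (G Mod N))"

definition virtually_Z_pow_by_free :: "nat \<Rightarrow> ('a, 'b) monoid_scheme \<Rightarrow> bool"
  where "virtually_Z_pow_by_free n G \<longleftrightarrow>
    (\<exists>H. subgroup H G \<and> finite (rcosets\<^bsub>G\<^esub> H) \<and> Z_pow_by_free n (G\<lparr>carrier := H\<rparr>))"

end

theory Submission
  imports Defs "HOL-Library.Countable_Set"
begin

text \<open>Subgroups of finite index separate elements in \<open>\<int>\<^sup>n *\<^sub>\<phi>\<close> by affine actions on \<open>(\<int>/m)\<^sup>n\<close>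
  with \<open>m\<close> prime to the index of \<open>\<phi>\<close>, and in a \<open>\<int>\<^sup>n\<close>-by-free group because it is a split extension of
  a residually finite group.

  Conversely, let \<open>G\<close> be residually finite and act on its Bass--Serre tree; the stabilizers
  \<open>G\<^sub>x \<cong> \<int>\<^sup>n\<close> are pairwise commensurable.  Contracting edges one may assume that \<open>G\<^sub>v \<le> G\<^sub>u\<close> for adjacent
  \<open>v\<close>, \<open>u\<close> only if \<open>v\<close> and \<open>u\<close> lie in one orbit.  If \<open>G\<^sub>u \<inter> G\<^sub>w\<close> is not closed in \<open>G\<^sub>u\<close> in the profinite
  topology, some \<open>x \<in> G\<^sub>u\<close> outside \<open>G\<^sub>w\<close> commutes with \<open>G\<^sub>w\<close>, so \<open>G\<^sub>w\<close> fixes the path from \<open>w\<close> to \<open>x w\<close>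
  and is contained in the stabilizer of the neighbour of \<open>w\<close> towards \<open>u\<close>.  If all edge stabilizers are
  closed in the vertex stabilizers, a finite-index normal subgroup \<open>M\<close> of \<open>G\<close> meets all \<open>G\<^sub>x\<close> in
  the same subgroup \<open>N\<close>, and \<open>M/N\<close> is free as it acts freely on the tree.  Otherwise a strictly
  ascending edge occurs, and applying the same argument to paths of length two and three through this
  edge shows that it represents the only orbit of edges, so \<open>G\<close> is an ascending HNN extension.\<close>

section \<open>Presented groups\<close>

text \<open>Residual finiteness reaches the tree through a commutator. Suppose every finite-index
  normal subgroup M contains some y in G_u with y w = x w. Then c = y^-1 x lies in the abelian group
  G_w, so for b in G_w the commutator [x,b] equals [y,b] and lies in M; as M is arbitrary, [x,b] =
  1. That b then fixes the path from w to x w is of use only if x w does not lie behind w as seen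
  from u. Commensurability ensures this: the orbit of w under G_u is finite, while pushing w away
  from u again and again would make it infinite.

  Presentations are exploited by letting their letters act on sets: finite sets separate elements, a
  glued set shows that vertex groups embed, and an affine action yields a function on the coset
  graph that changes across an edge exactly at the names of that edge. This takes the place of
  normal forms for graphs of groups. The description of trees by bridges suits both ends of the
  argument: a two-valued function certifies a bridge, and such certificates survive
  contraction.\<close>

abbreviation wclass :: "'x set \<Rightarrow> ('x word \<times> 'x word) set \<Rightarrow> 'x word \<Rightarrow> 'x word set"
  where "wclass X R w \<equiv> pres_rel X R `` {w}"

definition inv_word :: "'x word \<Rightarrow> 'x word"
  where "inv_word w = rev (map (\<lambda>(x, b). (x, \<not> b)) w)"

lemma words_append [simp]: "u @ v \<in> words X \<longleftrightarrow> u \<in> words X \<and> v \<in> words X"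
  by (simp add: words_def)

lemma words_Nil [simp]: "[] \<in> words X"
  by (simp add: words_def)

lemma words_Cons [simp]: "(x, b) # w \<in> words X \<longleftrightarrow> x \<in> X \<and> w \<in> words X"
  by (auto simp: words_def)

lemma words_inv_word: "w \<in> words X \<Longrightarrow> inv_word w \<in> words X"
  unfolding inv_word_def words_def by auto

lemma pres_rel_words: "(u, v) \<in> pres_rel X R \<Longrightarrow> u \<in> words X \<and> v \<in> words X"
  by (induction rule: pres_rel.induct) auto

lemma equiv_pres_rel: "equiv (words X) (pres_rel X R)"
proof (rule equivI)
  show "pres_rel X R \<subseteq> words X \<times> words X"
    using pres_rel_words by fast
  show "refl_on (words X) (pres_rel X R)"
    by (simp add: pres_rel.refl refl_on_def)
  show "sym (pres_rel X R)"
    by (meson pres_rel.sym symI)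
  show "trans (pres_rel X R)"
    by (meson pres_rel.trans transI)
qed

text \<open>The constructors put a context around one elementary step only; for a whole derivation
  it is absorbed into the context of each step.\<close>

lemma pres_rel_context:
  assumes "(u, v) \<in> pres_rel X R" "a \<in> words X" "b \<in> words X"
  shows "(a @ u @ b, a @ v @ b) \<in> pres_rel X R"
  using assms
proof (induction rule: pres_rel.induct)
  case (cancel u v x c)
  then show ?case
    using pres_rel.cancel[of "a @ u" X "v @ b" x c R] by simp
next
  case (relation l r u v)
  then show ?case
    using pres_rel.relation[of l r R X "a @ u" "v @ b"] by simp
qed (auto intro: pres_rel.refl pres_rel.sym pres_rel.trans)

lemma pres_rel_append:
  assumes "(u, u') \<in> pres_rel X R" "(v, v') \<in> pres_rel X R"
  shows "(u @ v, u' @ v') \<in> pres_rel X R"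
proof -
  have w: "u' \<in> words X" "v \<in> words X"
    using assms pres_rel_words by auto
  have "([] @ u @ v, [] @ u' @ v) \<in> pres_rel X R"
    using w by (intro pres_rel_context assms) auto
  moreover have "(u' @ v @ [], u' @ v' @ []) \<in> pres_rel X R"
    using w by (intro pres_rel_context assms) auto
  ultimately show ?thesis
    using pres_rel.trans by fastforce
qed

lemma wclass_eq_iff: "u \<in> words X \<Longrightarrow> v \<in> words X \<Longrightarrow> wclass X R u = wclass X R v \<longleftrightarrow> (u, v) \<in> pres_rel X R"
  using eq_equiv_class_iff[OF equiv_pres_rel] by blast

lemma carrier_presented_group: "carrier (presented_group X R) = wclass X R ` words X"
  by (auto simp: presented_group_def quotient_def)

lemma wclass_closed: "w \<in> words X \<Longrightarrow> wclass X R w \<in> carrier (presented_group X R)"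
  by (simp add: carrier_presented_group)

lemma one_presented_group: "\<one>\<^bsub>presented_group X R\<^esub> = wclass X R []"
  by (simp add: presented_group_def)

lemma wclass_append:
  assumes "u \<in> words X" "v \<in> words X"
  shows "wclass X R u \<otimes>\<^bsub>presented_group X R\<^esub> wclass X R v = wclass X R (u @ v)"
proof -
  have "wclass X R (a @ b) = wclass X R (u @ v)" if "(u, a) \<in> pres_rel X R" "(v, b) \<in> pres_rel X R" for a b
    using that pres_rel_append[OF that] pres_rel_words[OF that(1)] pres_rel_words[OF that(2)]
    by (metis wclass_eq_iff words_append)
  moreover have "(u, u) \<in> pres_rel X R" "(v, v) \<in> pres_rel X R"
    using assms by (auto intro: pres_rel.refl)
  ultimately have "(\<Union>a\<in>wclass X R u. \<Union>b\<in>wclass X R v. wclass X R (a @ b)) = wclass X R (u @ v)"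
    by fast
  then show ?thesis
    by (simp add: presented_group_def)
qed

lemma pres_rel_inv_word:
  assumes "w \<in> words X"
  shows "(inv_word w @ w, []) \<in> pres_rel X R"
  using assms
proof (induction w)
  case Nil
  then show ?case
    by (simp add: inv_word_def pres_rel.refl)
next
  case (Cons y w)
  obtain x b where y: "y = (x, b)"
    by force
  have w: "w \<in> words X" "x \<in> X"
    using Cons.prems y by auto
  have "inv_word (y # w) @ y # w = inv_word w @ [(x, \<not> b), (x, \<not> \<not> b)] @ w"
    by (simp add: inv_word_def y)
  also have "(\<dots>, inv_word w @ w) \<in> pres_rel X R"
    by (rule pres_rel.cancel) (use w words_inv_word in auto)
  finally show ?case
    using Cons.IH[OF w(1)] pres_rel.trans by fast
qed

lemma group_presented_group: "group (presented_group X R)"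
proof (rule groupI)
  fix x y z
  assume "x \<in> carrier (presented_group X R)" "y \<in> carrier (presented_group X R)"
    "z \<in> carrier (presented_group X R)"
  then obtain u v w where "x = wclass X R u" "y = wclass X R v" "z = wclass X R w"
    "u \<in> words X" "v \<in> words X" "w \<in> words X"
    by (auto simp: carrier_presented_group)
  then show "x \<otimes>\<^bsub>presented_group X R\<^esub> y \<in> carrier (presented_group X R)"
    "x \<otimes>\<^bsub>presented_group X R\<^esub> y \<otimes>\<^bsub>presented_group X R\<^esub> z =
      x \<otimes>\<^bsub>presented_group X R\<^esub> (y \<otimes>\<^bsub>presented_group X R\<^esub> z)"
    by (simp_all add: wclass_append wclass_closed)
next
  show "\<one>\<^bsub>presented_group X R\<^esub> \<in> carrier (presented_group X R)"
    by (simp add: one_presented_group wclass_closed)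
next
  fix x
  assume "x \<in> carrier (presented_group X R)"
  then obtain w where w: "x = wclass X R w" "w \<in> words X"
    by (auto simp: carrier_presented_group)
  then show "\<one>\<^bsub>presented_group X R\<^esub> \<otimes>\<^bsub>presented_group X R\<^esub> x = x"
    by (simp add: one_presented_group wclass_append)
  have "wclass X R (inv_word w) \<otimes>\<^bsub>presented_group X R\<^esub> x = \<one>\<^bsub>presented_group X R\<^esub>"
    using w pres_rel_inv_word[OF w(2)]
    by (simp add: wclass_append words_inv_word one_presented_group wclass_eq_iff)
  then show "\<exists>y\<in>carrier (presented_group X R). y \<otimes>\<^bsub>presented_group X R\<^esub> x = \<one>\<^bsub>presented_group X R\<^esub>"
    using w by (blast intro: wclass_closed words_inv_word)
qed

lemma inv_wclass:
  assumes "x \<in> X"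
  shows "inv\<^bsub>presented_group X R\<^esub> wclass X R [(x, b)] = wclass X R [(x, \<not> b)]"
proof (rule group.inv_equality[OF group_presented_group])
  show "wclass X R [(x, \<not> b)] \<otimes>\<^bsub>presented_group X R\<^esub> wclass X R [(x, b)] = \<one>\<^bsub>presented_group X R\<^esub>"
    using assms pres_rel.cancel[of "[]" X "[]" x "\<not> b" R]
    by (simp add: wclass_append one_presented_group wclass_eq_iff)
qed (use assms in \<open>simp_all add: wclass_closed\<close>)

lemma wclass_relation:
  assumes "(l, r) \<in> R" "l \<in> words X" "r \<in> words X"
  shows "wclass X R l = wclass X R r"
  using pres_rel.relation[OF assms, of "[]" "[]"] assms by (simp add: wclass_eq_iff)

text \<open>Letters are added on the left, matching \<open>run\<close>, where the leftmost letter
  acts last.\<close>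

lemma presented_group_induct [consumes 1, case_names one gen]:
  assumes "g \<in> carrier (presented_group X R)"
    and one: "P \<one>\<^bsub>presented_group X R\<^esub>"
    and gen: "\<And>x b g. x \<in> X \<Longrightarrow> g \<in> carrier (presented_group X R) \<Longrightarrow> P g \<Longrightarrow>
      P (wclass X R [(x, b)] \<otimes>\<^bsub>presented_group X R\<^esub> g)"
  shows "P g"
proof -
  obtain w where w: "g = wclass X R w" "w \<in> words X"
    using assms(1) by (auto simp: carrier_presented_group)
  have "w \<in> words X \<Longrightarrow> P (wclass X R w)" for w
  proof (induction w)
    case Nil
    then show ?case
      using one by (simp add: one_presented_group)
  next
    case (Cons y w)
    obtain x b where y: "y = (x, b)"
      by force
    then have "P (wclass X R [(x, b)] \<otimes>\<^bsub>presented_group X R\<^esub> wclass X R w)"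
      using Cons by (intro gen) (auto simp: wclass_closed)
    then show ?case
      using Cons.prems by (simp add: y wclass_append)
  qed
  then show ?thesis
    using w by simp
qed

section \<open>Actions of presented groups and homomorphisms out of them\<close>

locale group_act = group G for G (structure) +
  fixes \<Omega> :: "'s set" and act :: "'a \<Rightarrow> 's \<Rightarrow> 's"
  assumes act_closed [simp, intro]: "g \<in> carrier G \<Longrightarrow> s \<in> \<Omega> \<Longrightarrow> act g s \<in> \<Omega>"
    and act_one [simp]: "s \<in> \<Omega> \<Longrightarrow> act \<one> s = s"
    and act_mult: "g \<in> carrier G \<Longrightarrow> h \<in> carrier G \<Longrightarrow> s \<in> \<Omega> \<Longrightarrow> act (g \<otimes> h) s = act g (act h s)"
begin

lemma act_inv_act [simp]: "g \<in> carrier G \<Longrightarrow> s \<in> \<Omega> \<Longrightarrow> act (inv g) (act g s) = s"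
  by (metis act_mult act_one inv_closed l_inv)

lemma act_act_inv [simp]: "g \<in> carrier G \<Longrightarrow> s \<in> \<Omega> \<Longrightarrow> act g (act (inv g) s) = s"
  by (metis act_mult act_one inv_closed r_inv)

lemma act_eq_iff: "g \<in> carrier G \<Longrightarrow> s \<in> \<Omega> \<Longrightarrow> s' \<in> \<Omega> \<Longrightarrow> act g s = act g s' \<longleftrightarrow> s = s'"
  by (metis act_inv_act)

lemma act_inv_eq_iff: "g \<in> carrier G \<Longrightarrow> s \<in> \<Omega> \<Longrightarrow> s' \<in> \<Omega> \<Longrightarrow> act (inv g) s = s' \<longleftrightarrow> s = act g s'"
  by (metis act_act_inv act_inv_act)

end

text \<open>\<open>F x False\<close> has its own formula instead of being an inverse function.
  Letters act from right to left, so concatenation becomes composition.\<close>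

definition run :: "('x \<Rightarrow> bool \<Rightarrow> 's \<Rightarrow> 's) \<Rightarrow> 'x word \<Rightarrow> 's \<Rightarrow> 's"
  where "run F w = foldr (\<lambda>(x, b). F x b) w"

lemma run_Nil [simp]: "run F [] s = s"
  by (simp add: run_def)

lemma run_Cons [simp]: "run F ((x, b) # w) s = F x b (run F w s)"
  by (simp add: run_def)

lemma run_append [simp]: "run F (u @ v) s = run F u (run F v s)"
  by (simp add: run_def)

text \<open>The choice of a representative is harmless at points of the invariant set on which
  related words act alike.\<close>

definition pres_lift :: "('x \<Rightarrow> bool \<Rightarrow> 's \<Rightarrow> 's) \<Rightarrow> 'x word set \<Rightarrow> 's \<Rightarrow> 's"
  where "pres_lift F C = run F (SOME w. w \<in> C)"

text \<open>Von Dyck's theorem for actions. As \<open>b\<close> takes both truth values,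
  \<open>gen_inverse\<close> makes the two maps of a generator inverse to each other on both
  sides.\<close>

locale presented_act =
  fixes X :: "'x set" and R :: "('x word \<times> 'x word) set" and \<Omega> :: "'s set"
    and F :: "'x \<Rightarrow> bool \<Rightarrow> 's \<Rightarrow> 's"
  assumes gen_closed: "x \<in> X \<Longrightarrow> s \<in> \<Omega> \<Longrightarrow> F x b s \<in> \<Omega>"
    and gen_inverse: "x \<in> X \<Longrightarrow> s \<in> \<Omega> \<Longrightarrow> F x b (F x (\<not> b) s) = s"
    and relator: "(l, r) \<in> R \<Longrightarrow> l \<in> words X \<Longrightarrow> r \<in> words X \<Longrightarrow> s \<in> \<Omega> \<Longrightarrow> run F l s = run F r s"
begin

lemma run_closed: "w \<in> words X \<Longrightarrow> s \<in> \<Omega> \<Longrightarrow> run F w s \<in> \<Omega>"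
proof (induction w)
  case (Cons y w)
  then show ?case
    by (cases y) (simp add: gen_closed)
qed simp

lemma run_cong: "(u, v) \<in> pres_rel X R \<Longrightarrow> s \<in> \<Omega> \<Longrightarrow> run F u s = run F v s"
  by (induction arbitrary: s rule: pres_rel.induct) (auto simp: run_closed gen_inverse relator)

lemma pres_lift_wclass: 
  assumes "w \<in> words X" "s \<in> \<Omega>"
  shows "pres_lift F (wclass X R w) s = run F w s"
proof -
  have "w \<in> wclass X R w"
    using assms by (simp add: pres_rel.refl)
  then have "(SOME u. u \<in> wclass X R w) \<in> wclass X R w"
    by (metis someI)
  then show ?thesis
    using run_cong assms by (fastforce simp: pres_lift_def)
qed

lemma pres_lift_gen: "x \<in> X \<Longrightarrow> s \<in> \<Omega> \<Longrightarrow> pres_lift F (wclass X R [(x, b)]) s = F x b s"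
  by (simp add: pres_lift_wclass)

sublocale group_act "presented_group X R" \<Omega> "pres_lift F"
proof -
  interpret P: group "presented_group X R"
    by (rule group_presented_group)
  show "group_act (presented_group X R) \<Omega> (pres_lift F)"
  proof unfold_locales
    fix g s assume "g \<in> carrier (presented_group X R)" "s \<in> \<Omega>"
    then show "pres_lift F g s \<in> \<Omega>"
      by (auto simp: carrier_presented_group pres_lift_wclass run_closed)
  next
    fix s assume "s \<in> \<Omega>"
    then show "pres_lift F \<one>\<^bsub>presented_group X R\<^esub> s = s"
      by (simp add: one_presented_group pres_lift_wclass)
  next
    fix g h s
    assume "g \<in> carrier (presented_group X R)" "h \<in> carrier (presented_group X R)" "s \<in> \<Omega>"
    then show "pres_lift F (g \<otimes>\<^bsub>presented_group X R\<^esub> h) s = pres_lift F g (pres_lift F h s)"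
      by (auto simp: carrier_presented_group wclass_append pres_lift_wclass run_closed)
  qed
qed

end

text \<open>This is the left regular action, and \<open>word_eval\<close> follows the orbit of the
  identity; von Dyck's theorem for homomorphisms thereby reduces to the one for actions.\<close>

definition gen_mult :: "('k, 'm) monoid_scheme \<Rightarrow> ('x \<Rightarrow> 'k) \<Rightarrow> 'x \<Rightarrow> bool \<Rightarrow> 'k \<Rightarrow> 'k"
  where "gen_mult K f x b s = (if b then f x else inv\<^bsub>K\<^esub> f x) \<otimes>\<^bsub>K\<^esub> s"

definition word_eval :: "('k, 'm) monoid_scheme \<Rightarrow> ('x \<Rightarrow> 'k) \<Rightarrow> 'x word \<Rightarrow> 'k"
  where "word_eval K f w = run (gen_mult K f) w \<one>\<^bsub>K\<^esub>"

context group
begin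

lemma word_eval_Nil [simp]: "word_eval G f [] = \<one>"
  by (simp add: word_eval_def)

lemma word_eval_Cons [simp]: "word_eval G f ((x, b) # w) = (if b then f x else inv f x) \<otimes> word_eval G f w"
  by (simp add: word_eval_def gen_mult_def)

lemma word_eval_closed: "f \<in> X \<rightarrow> carrier G \<Longrightarrow> w \<in> words X \<Longrightarrow> word_eval G f w \<in> carrier G"
  by (induction w) (auto simp: Pi_iff)

lemma word_eval_append:
  assumes "f \<in> X \<rightarrow> carrier G" "u \<in> words X" "v \<in> words X"
  shows "word_eval G f (u @ v) = word_eval G f u \<otimes> word_eval G f v"
  using assms(2)
proof (induction u)
  case (Cons y u)
  obtain x b where y: "y = (x, b)"
    by force
  then have "f x \<in> carrier G" "word_eval G f u \<in> carrier G" "word_eval G f v \<in> carrier G"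
    using Cons.prems assms word_eval_closed by auto
  then show ?case
    using Cons y by (simp add: m_assoc)
next
  case Nil
  then show ?case
    using word_eval_closed[OF assms(1,3)] by simp
qed

lemma run_gen_mult:
  assumes "f \<in> X \<rightarrow> carrier G" "w \<in> words X" "s \<in> carrier G"
  shows "run (gen_mult G f) w s = word_eval G f w \<otimes> s"
  using assms(2)
proof (induction w)
  case (Cons y w)
  obtain x b where y: "y = (x, b)"
    by force
  then have "f x \<in> carrier G" "word_eval G f w \<in> carrier G"
    using Cons.prems assms word_eval_closed by auto
  then show ?case
    using Cons y assms(3) by (simp add: gen_mult_def m_assoc)
qed (use assms in simp)

lemma presented_group_hom:
  assumes f: "f \<in> X \<rightarrow> carrier G"
    and rel: "\<And>l r. (l, r) \<in> R \<Longrightarrow> l \<in> words X \<Longrightarrow> r \<in> words X \<Longrightarrow> word_eval G f l = word_eval G f r"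
  obtains h where "h \<in> hom (presented_group X R) G"
    and "\<And>w. w \<in> words X \<Longrightarrow> h (wclass X R w) = word_eval G f w"
proof -
  interpret A: presented_act X R "carrier G" "gen_mult G f"
  proof
    fix l r s assume "(l, r) \<in> R" "l \<in> words X" "r \<in> words X" "s \<in> carrier G"
    then show "run (gen_mult G f) l s = run (gen_mult G f) r s"
      using rel f by (simp add: run_gen_mult)
  qed (use f in \<open>auto simp: gen_mult_def Pi_iff m_assoc[symmetric]\<close>)
  define h where "h C = pres_lift (gen_mult G f) C \<one>" for C
  have h: "h (wclass X R w) = word_eval G f w" if "w \<in> words X" for w
    using that f by (simp add: h_def A.pres_lift_wclass word_eval_def)
  moreover have "h \<in> hom (presented_group X R) G"
    using f by (auto simp: hom_def carrier_presented_group h wclass_append word_eval_closed word_eval_append)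
  ultimately show ?thesis
    using that by blast
qed

end

section \<open>Subgroups of finite index and residual finiteness\<close>

lemma finite_image_factor:
  assumes "finite (f ` A)" and "\<And>x y. x \<in> A \<Longrightarrow> y \<in> A \<Longrightarrow> f x = f y \<Longrightarrow> g x = g y"
  shows "finite (g ` A)"
proof (rule finite_subset)
  show "g ` A \<subseteq> (\<lambda>c. g (SOME x. x \<in> A \<and> f x = c)) ` f ` A"
  proof
    fix y assume "y \<in> g ` A"
    then obtain x where x: "x \<in> A" "y = g x"
      by blast
    let ?z = "SOME z. z \<in> A \<and> f z = f x"
    have "?z \<in> A \<and> f ?z = f x"
      by (rule someI[of _ x]) (use x in simp)
    then have "g ?z = g x"
      using assms(2) x by blast
    then have "y = (\<lambda>c. g (SOME x. x \<in> A \<and> f x = c)) (f x)"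
      using x by simp
    then show "y \<in> (\<lambda>c. g (SOME x. x \<in> A \<and> f x = c)) ` f ` A"
      using x by blast
  qed
qed (use assms(1) in simp)

context group
begin

lemma rcosets_eq_image: "rcosets H = (\<lambda>g. H #> g) ` carrier G"
  by (auto simp: RCOSETS_def)

lemma r_coset_eq_iff:
  assumes "subgroup H G" "g \<in> carrier G" "h \<in> carrier G"
  shows "H #> g = H #> h \<longleftrightarrow> g \<otimes> inv h \<in> H"
  by (metis assms is_group repr_independence rcos_self subgroup.rcos_module)

text \<open>It suffices that \<open>f\<close> has finitely many values and separates cosets. It may
  vary within a coset, so residues of coordinates can serve as \<open>f\<close>.\<close>

lemma finite_rcosetsI:
  assumes "subgroup H G" "finite (f ` carrier G)"
    and "\<And>g h. g \<in> carrier G \<Longrightarrow> h \<in> carrier G \<Longrightarrow> f g = f h \<Longrightarrow> g \<otimes> inv h \<in> H"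
  shows "finite (rcosets H)"
  unfolding rcosets_eq_image
  by (rule finite_image_factor[OF assms(2)]) (use assms in \<open>simp add: r_coset_eq_iff\<close>)

lemma normal_carrier: "carrier G \<lhd> G"
  by (simp add: normal_inv_iff subgroup_self)

lemma finite_rcosets_carrier: "finite (rcosets (carrier G))"
  by (rule finite_rcosetsI[where f = "\<lambda>_. ()"]) (auto simp: subgroup_self)

lemma finite_rcosets_Int:
  assumes "subgroup H G" "subgroup K G" "finite (rcosets H)" "finite (rcosets K)"
  shows "finite (rcosets (H \<inter> K))"
proof (rule finite_rcosetsI[where f = "\<lambda>g. (H #> g, K #> g)"])
  show "finite ((\<lambda>g. (H #> g, K #> g)) ` carrier G)"
    by (rule finite_subset[OF _ finite_cartesian_product[OF assms(3,4)]]) (auto simp: rcosets_eq_image)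
qed (use assms in \<open>auto simp: r_coset_eq_iff subgroups_Inter_pair\<close>)

text \<open>The finitely many witnesses are intersected; closure of \<open>Q\<close> under shrinking
  keeps every condition.\<close>

lemma finite_index_normal_family:
  assumes "finite I"
    and "\<And>i. i \<in> I \<Longrightarrow> \<exists>M. M \<lhd> G \<and> finite (rcosets M) \<and> Q i M"
    and "\<And>i M M'. i \<in> I \<Longrightarrow> Q i M \<Longrightarrow> M' \<subseteq> M \<Longrightarrow> Q i M'"
  shows "\<exists>M. M \<lhd> G \<and> finite (rcosets M) \<and> (\<forall>i\<in>I. Q i M)"
  using assms
proof (induction I rule: finite_induct)
  case empty
  then show ?case
    using normal_carrier finite_rcosets_carrier by blast
next
  case (insert i I)
  obtain M where M: "M \<lhd> G" "finite (rcosets M)" "\<forall>i\<in>I. Q i M"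
    using insert by (metis insertI2)
  obtain M' where M': "M' \<lhd> G" "finite (rcosets M')" "Q i M'"
    using insert.prems(1) by blast
  have "M \<inter> M' \<lhd> G" "finite (rcosets (M \<inter> M'))"
    using M M' by (auto intro: normal_subgroup_intersect finite_rcosets_Int normal_imp_subgroup)
  moreover have "\<forall>j\<in>insert i I. Q j (M \<inter> M')"
    using insert.prems(2)[OF _ M'(3), of "M \<inter> M'"] insert.prems(2)[of _ M "M \<inter> M'"] M(3) by auto
  ultimately show ?case
    by blast
qed

lemma finite_rcosets_trans:
  assumes H: "subgroup H G" "finite (rcosets H)"
    and L: "subgroup L (G\<lparr>carrier := H\<rparr>)" "finite (rcosets\<^bsub>G\<lparr>carrier := H\<rparr>\<^esub> L)"
  shows "subgroup L G" "finite (rcosets L)"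
proof -
  show sub: "subgroup L G"
    using H(1) L(1) incl_subgroup by blast
  define r where "r C = (SOME x. x \<in> carrier G \<and> C = H #> x)" for C
  have r: "r (H #> g) \<in> carrier G \<and> H #> g = H #> r (H #> g)" if "g \<in> carrier G" for g
    unfolding r_def by (rule someI[of _ g]) (use that in simp)
  have rH: "g \<otimes> inv (r (H #> g)) \<in> H" if "g \<in> carrier G" for g
    using r[OF that] r_coset_eq_iff[OF H(1) that] by blast
  \<comment> \<open>A coset of \<open>L\<close> inside \<open>H g\<close> is recorded after shifting
    it into \<open>H\<close> by the chosen representative of \<open>H g\<close>.\<close>
  let ?f = "\<lambda>g. (H #> g, L #> (g \<otimes> inv (r (H #> g))))"
  show "finite (rcosets L)"
  proof (rule finite_rcosetsI[where f = ?f])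
    show "finite (?f ` carrier G)"
      by (rule finite_subset[OF _ finite_cartesian_product[OF H(2) L(2)]])
        (use rH in \<open>auto simp: RCOSETS_def\<close>)
  next
    fix g h
    assume gh: "g \<in> carrier G" "h \<in> carrier G" and eq: "?f g = ?f h"
    define s where "s = r (H #> g)"
    have s: "s \<in> carrier G" "s = r (H #> h)"
      using r gh eq by (auto simp: s_def)
    have "L #> (g \<otimes> inv s) = L #> (h \<otimes> inv s)"
      using eq s(2) unfolding s_def by simp
    then have "(g \<otimes> inv s) \<otimes> inv (h \<otimes> inv s) \<in> L"
      using r_coset_eq_iff[OF sub] gh s(1) by simp
    then show "g \<otimes> inv h \<in> L"
      using gh s(1) by (simp add: inv_mult_group m_assoc[symmetric]) (simp add: m_assoc)
  qed (rule sub)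
qed

end

context group_act
begin

definition fixer :: "'s \<Rightarrow> 'a set"
  where "fixer s = {g \<in> carrier G. act g s = s}"

lemma subgroup_fixer: "s \<in> \<Omega> \<Longrightarrow> subgroup (fixer s) G"
  by (rule subgroupI) (auto simp: fixer_def act_mult act_inv_eq_iff intro: exI[of _ \<one>])

lemma fixer_conj:
  assumes "s \<in> \<Omega>" "g \<in> carrier G"
  shows "h \<in> fixer (act g s) \<longleftrightarrow> h \<in> carrier G \<and> inv g \<otimes> h \<otimes> g \<in> fixer s"
  using assms by (auto simp: fixer_def act_mult act_inv_eq_iff)

lemma normal_act_kernel: "{g \<in> carrier G. \<forall>s\<in>\<Omega>. act g s = s} \<lhd> G"
  unfolding normal_inv_iff
proof (intro conjI ballI)
  show "subgroup {g \<in> carrier G. \<forall>s\<in>\<Omega>. act g s = s} G"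
    by (rule subgroupI) (auto simp: act_mult act_inv_eq_iff intro: exI[of _ \<one>])
qed (auto simp: act_mult)

lemma finite_rcosets_act_kernel:
  assumes "finite \<Omega>"
  shows "finite (rcosets {g \<in> carrier G. \<forall>s\<in>\<Omega>. act g s = s})"
proof (rule finite_rcosetsI[where f = "\<lambda>g. restrict (act g) \<Omega>"])
  show "finite ((\<lambda>g. restrict (act g) \<Omega>) ` carrier G)"
    by (rule finite_subset[of _ "\<Omega> \<rightarrow>\<^sub>E \<Omega>"]) (use assms in \<open>auto simp: finite_PiE\<close>)
next
  fix g h
  assume gh: "g \<in> carrier G" "h \<in> carrier G" and eq: "restrict (act g) \<Omega> = restrict (act h) \<Omega>"
  have "act g (act (inv h) s) = s" if "s \<in> \<Omega>" for s
    using fun_cong[OF eq, of "act (inv h) s"] that gh by simp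
  then show "g \<otimes> inv h \<in> {g \<in> carrier G. \<forall>s\<in>\<Omega>. act g s = s}"
    using gh by (simp add: act_mult)
qed (use normal_act_kernel normal_imp_subgroup in blast)

text \<open>The kernel of the action is the witness; this turns permutations of finite sets into
  finite-index subgroups that avoid a given element.\<close>

lemma finite_act_moves:
  assumes "finite \<Omega>" "s \<in> \<Omega>" "act g s \<noteq> s"
  shows "\<exists>M. M \<lhd> G \<and> finite (rcosets M) \<and> g \<notin> M"
  using normal_act_kernel finite_rcosets_act_kernel[OF assms(1)] assms(2,3) by blast

end

context group
begin

lemma finite_index_core:
  assumes L: "subgroup L G" "finite (rcosets L)"
  shows "\<exists>M. M \<lhd> G \<and> finite (rcosets M) \<and> M \<subseteq> L"
proof -
  have sub: "L \<subseteq> carrier G"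
    using L(1) subgroup.subset by blast
  \<comment> \<open>Inverting \<open>g\<close> turns right translation of right cosets into a left
    action. The stabilizer of the coset \<open>L\<close> is \<open>L\<close>, so the kernel lies in
    \<open>L\<close>.\<close>
  interpret A: group_act G "rcosets L" "\<lambda>g C. C #> inv g"
  proof
    fix g h C
    assume "g \<in> carrier G" "h \<in> carrier G" "C \<in> rcosets L"
    then show "C #> inv (g \<otimes> h) = C #> inv h #> inv g"
      using sub by (auto simp: rcosets_eq_image coset_mult_assoc m_assoc inv_mult_group)
  qed (use sub in \<open>auto simp: rcosets_eq_image coset_mult_assoc\<close>)
  have LL: "L \<in> rcosets L"
    using L(1) subgroup.subgroup_in_rcosets by blast
  have "g \<in> L" if g: "g \<in> carrier G" and fixes_C: "\<forall>C\<in>rcosets L. C #> inv g = C" for g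
  proof -
    have "L #> inv g = L"
      using fixes_C LL by blast
    then have "inv g \<in> L"
      using coset_join1 L(1) g by blast
    then show ?thesis
      using L(1) g by (metis inv_inv subgroup.m_inv_closed)
  qed
  then show ?thesis
    using A.normal_act_kernel A.finite_rcosets_act_kernel[OF L(2)] by blast
qed

lemma residually_finiteI:
  assumes "\<And>g. g \<in> carrier G \<Longrightarrow> g \<noteq> \<one> \<Longrightarrow> \<exists>L. subgroup L G \<and> finite (rcosets L) \<and> g \<notin> L"
  shows "residually_finite G"
  unfolding residually_finite_def
proof (intro equalityI subsetI)
  fix g assume g: "g \<in> \<Inter> {N. N \<lhd> G \<and> finite (rcosets N)}"
  then have carr: "g \<in> carrier G"
    using normal_carrier finite_rcosets_carrier by blast
  have "g = \<one>"
  proof (rule ccontr)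
    assume "g \<noteq> \<one>"
    then obtain M where "M \<lhd> G" "finite (rcosets M)" "g \<notin> M"
      using assms[OF carr] finite_index_core by blast
    then show False
      using g by blast
  qed
  then show "g \<in> {\<one>}"
    by simp
next
  fix g assume "g \<in> {\<one>}"
  then show "g \<in> \<Inter> {N. N \<lhd> G \<and> finite (rcosets N)}"
    by (auto intro: subgroup.one_closed normal_imp_subgroup)
qed

lemma residually_finiteD:
  assumes "residually_finite G" "g \<noteq> \<one>"
  shows "\<exists>M. M \<lhd> G \<and> finite (rcosets M) \<and> g \<notin> M"
proof -
  have "g \<notin> \<Inter> {N. N \<lhd> G \<and> finite (rcosets N)}"
    using assms by (simp add: residually_finite_def)
  then show ?thesis
    by blast
qed

end

context group_hom
begin

lemma subgroup_vimage:
  assumes "subgroup L H"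
  shows "subgroup {g \<in> carrier G. h g \<in> L} G"
proof -
  interpret L: subgroup L H
    by fact
  show ?thesis
    by (rule G.subgroupI) (auto intro!: exI[of _ \<one>])
qed

lemma finite_rcosets_vimage:
  assumes "subgroup L H" "finite (rcosets\<^bsub>H\<^esub> L)"
  shows "finite (rcosets {g \<in> carrier G. h g \<in> L})"
proof (rule G.finite_rcosetsI[where f = "\<lambda>g. L #>\<^bsub>H\<^esub> h g"])
  show "finite ((\<lambda>g. L #>\<^bsub>H\<^esub> h g) ` carrier G)"
    by (rule finite_subset[OF _ assms(2)]) (auto simp: H.rcosets_eq_image)
qed (use assms in \<open>auto simp: subgroup_vimage H.r_coset_eq_iff\<close>)

lemma residually_finite_if_inj:
  assumes "inj_on h (carrier G)" "residually_finite H"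
  shows "residually_finite G"
proof (rule G.residually_finiteI)
  fix g assume g: "g \<in> carrier G" "g \<noteq> \<one>"
  then have "h g \<noteq> \<one>\<^bsub>H\<^esub>"
    using assms(1) inj_on_one_iff by blast
  then obtain M where "M \<lhd> H" "finite (rcosets\<^bsub>H\<^esub> M)" "h g \<notin> M"
    using H.residually_finiteD assms(2) by blast
  then show "\<exists>L. subgroup L G \<and> finite (rcosets L) \<and> g \<notin> L"
    using subgroup_vimage finite_rcosets_vimage normal_imp_subgroup by blast
qed

end

lemma residually_finite_iso:
  assumes "group G" "group H" "G \<cong> H" "residually_finite H"
  shows "residually_finite G"
proof -
  obtain h where "h \<in> iso G H"
    using assms(3) by (auto simp: is_iso_def)
  then have "group_hom G H h" "inj_on h (carrier G)"
    using assms(1,2) by (auto simp: iso_def bij_betw_def group_hom_def group_hom_axioms_def)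
  then show ?thesis
    using group_hom.residually_finite_if_inj assms(4) by blast
qed

section \<open>The groups \<open>\<int>\<^sup>n\<close>\<close>

lemma carrier_Z_pow: "carrier (Z_pow n) = extensional {..<n}"
  by (auto simp: Z_pow_def PiE_def)

lemma Z_pow_mult_nth [simp]: "i < n \<Longrightarrow> (x \<otimes>\<^bsub>Z_pow n\<^esub> y) i = x i + y i"
  by (simp add: Z_pow_def)

lemma Z_pow_one_nth [simp]: "i < n \<Longrightarrow> \<one>\<^bsub>Z_pow n\<^esub> i = 0"
  by (simp add: Z_pow_def)

lemma Z_pow_eqI:
  assumes "x \<in> carrier (Z_pow n)" "y \<in> carrier (Z_pow n)" "\<And>i. i < n \<Longrightarrow> x i = y i"
  shows "x = y"
  using assms by (auto simp: carrier_Z_pow intro: extensionalityI)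

lemma comm_group_Z_pow: "comm_group (Z_pow n)"
proof (rule group.group_comm_groupI)
  show grp: "group (Z_pow n)"
    by (simp add: Z_pow_def)
  show "x \<otimes>\<^bsub>Z_pow n\<^esub> y = y \<otimes>\<^bsub>Z_pow n\<^esub> x" if "x \<in> carrier (Z_pow n)" "y \<in> carrier (Z_pow n)" for x y
    by (rule Z_pow_eqI[of _ n]) (use that group.is_monoid[OF grp] in \<open>auto simp: monoid.m_closed\<close>)
qed

global_interpretation Z_pow: comm_group "Z_pow n" for n
  by (rule comm_group_Z_pow)

lemma Z_pow_nth_hom: "i < n \<Longrightarrow> (\<lambda>x. x i) \<in> hom (Z_pow n) integer_group"
  by (auto simp: hom_def)

lemma Z_pow_int_pow_nth [simp]:
  "i < n \<Longrightarrow> x \<in> carrier (Z_pow n) \<Longrightarrow> (x [^]\<^bsub>Z_pow n\<^esub> (k :: int)) i = k * x i"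
  using hom_int_pow[OF Z_pow_nth_hom] by fastforce

lemma Z_pow_inv_nth [simp]: "i < n \<Longrightarrow> x \<in> carrier (Z_pow n) \<Longrightarrow> (inv\<^bsub>Z_pow n\<^esub> x) i = - x i"
  using Z_pow_int_pow_nth[of i n x "-1"] Z_pow.int_pow_neg[of x n 1] by (simp add: Z_pow.int_pow_1)

definition Z_unit :: "nat \<Rightarrow> nat \<Rightarrow> nat \<Rightarrow> int"
  where "Z_unit n l = (\<lambda>i\<in>{..<n}. if i = l then 1 else 0)"

lemma Z_unit_closed [simp]: "Z_unit n l \<in> carrier (Z_pow n)"
  by (simp add: Z_unit_def carrier_Z_pow)

lemma Z_unit_nth [simp]: "i < n \<Longrightarrow> Z_unit n l i = (if i = l then 1 else 0)"
  by (simp add: Z_unit_def)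

lemma Z_pow_induct [consumes 1, case_names one step]:
  assumes x: "x \<in> carrier (Z_pow n)"
    and one: "P \<one>\<^bsub>Z_pow n\<^esub>"
    and step: "\<And>y l. y \<in> carrier (Z_pow n) \<Longrightarrow> l < n \<Longrightarrow> P y \<Longrightarrow>
      P (y \<otimes>\<^bsub>Z_pow n\<^esub> Z_unit n l [^]\<^bsub>Z_pow n\<^esub> x l)"
  shows "P x"
proof -
  \<comment> \<open>\<open>tr m\<close> keeps the first \<open>m\<close> coordinates of
    \<open>x\<close>; the next coordinate is added by a power of one unit vector.\<close>
  define tr where "tr m = (\<lambda>i\<in>{..<n}. if i < m then x i else 0)" for m
  have tr: "tr m \<in> carrier (Z_pow n)" for m
    by (simp add: tr_def carrier_Z_pow)
  have "m \<le> n \<Longrightarrow> P (tr m)" for m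
  proof (induction m)
    case 0
    have "tr 0 = \<one>\<^bsub>Z_pow n\<^esub>"
      by (rule Z_pow_eqI[of _ n]) (use tr[of 0] in \<open>auto simp: tr_def\<close>)
    then show ?case
      using one by simp
  next
    case (Suc m)
    have "tr (Suc m) = tr m \<otimes>\<^bsub>Z_pow n\<^esub> Z_unit n m [^]\<^bsub>Z_pow n\<^esub> x m"
    proof (rule Z_pow_eqI[of _ n])
      fix i assume "i < n"
      then show "tr (Suc m) i = (tr m \<otimes>\<^bsub>Z_pow n\<^esub> Z_unit n m [^]\<^bsub>Z_pow n\<^esub> x m) i"
        by (auto simp: tr_def less_Suc_eq)
    qed (use tr in simp_all)
    then show ?case
      using step[of "tr m" m] Suc tr by simp
  qed
  moreover have "tr n = x"
    by (rule Z_pow_eqI[of _ n]) (use tr x in \<open>auto simp: tr_def\<close>)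
  ultimately show ?thesis
    by blast
qed

section \<open>Monomorphisms of Z^n have images of finite index\<close>

lemma Z_pow_hom_linear:
  assumes \<phi>: "\<phi> \<in> hom (Z_pow n) (Z_pow m)" and x: "x \<in> carrier (Z_pow n)" and j: "j < m"
  shows "\<phi> x j = (\<Sum>l<n. x l * \<phi> (Z_unit n l) j)"
proof -
  interpret \<phi>: group_hom "Z_pow n" "Z_pow m" \<phi>
    using \<phi> by (simp add: group_hom_def group_hom_axioms_def)
  have "\<phi> y j = (\<Sum>l<n. y l * \<phi> (Z_unit n l) j)" if "y = x" for y
    using x unfolding that
  proof (induction rule: Z_pow_induct)
    case one
    then show ?case
      using j by simp
  next
    case (step y l)
    have "\<phi> (y \<otimes>\<^bsub>Z_pow n\<^esub> Z_unit n l [^]\<^bsub>Z_pow n\<^esub> x l) j = \<phi> y j + x l * \<phi> (Z_unit n l) j"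
      using step j by (simp add: \<phi>.hom_int_pow)
    also have "\<dots> = (\<Sum>k<n. y k * \<phi> (Z_unit n k) j + (if k = l then x l * \<phi> (Z_unit n l) j else 0))"
      using step by (simp add: sum.distrib)
    also have "\<dots> = (\<Sum>k<n. (y \<otimes>\<^bsub>Z_pow n\<^esub> Z_unit n l [^]\<^bsub>Z_pow n\<^esub> x l) k * \<phi> (Z_unit n k) j)"
      by (rule sum.cong) (auto simp: algebra_simps)
    finally show ?case .
  qed
  then show ?thesis
    by simp
qed

text \<open>Counting replaces determinants. If no nonzero multiple of the unit vector e_l lay in the
  image, the L^(n+1) elements \<phi>(c) + s e_l with s and all entries of c in [0,L) would be
  distinct; but they lie in a box with (2ML+1)^n points.\<close>

lemma Z_pow_mon_bounded_image:
  assumes \<phi>: "\<phi> \<in> mon (Z_pow n) (Z_pow n)" and l: "l < n"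
  shows "\<exists>k::int. k \<noteq> 0 \<and> Z_unit n l [^]\<^bsub>Z_pow n\<^esub> k \<in> \<phi> ` carrier (Z_pow n)"
proof (rule ccontr)
  assume contr: "\<not> ?thesis"
  have hom: "\<phi> \<in> hom (Z_pow n) (Z_pow n)" and inj: "inj_on \<phi> (carrier (Z_pow n))"
    using \<phi> by (auto simp: mon_def)
  interpret \<phi>: group_hom "Z_pow n" "Z_pow n" \<phi>
    using hom by (simp add: group_hom_def group_hom_axioms_def)
  \<comment> \<open>The sum of all absolute values of matrix entries bounds every row; the extra 1
    leaves room for the summand s e_l.\<close>
  define M where "M = (\<Sum>j<n. \<Sum>k<n. \<bar>\<phi> (Z_unit n k) j\<bar>) + 1"
  \<comment> \<open>With this choice (2ML+1)^n \<le> ((2M+1)L)^n = (L-1)L^n, which is less than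
    L^(n+1).\<close>
  define L where "L = nat ((2 * M + 1) ^ n + 1)"
  have M: "M \<ge> 1"
    by (simp add: M_def sum_nonneg)
  have L: "int L = (2 * M + 1) ^ n + 1"
    using M by (simp add: L_def)
  define B where "B = {..<n} \<rightarrow>\<^sub>E {0..<int L}"
  have B: "B \<subseteq> carrier (Z_pow n)"
    by (auto simp: B_def carrier_Z_pow PiE_def)
  define f :: "(nat \<Rightarrow> int) \<times> int \<Rightarrow> nat \<Rightarrow> int" where "f = (\<lambda>(c, s). \<phi> c \<otimes>\<^bsub>Z_pow n\<^esub> Z_unit n l [^]\<^bsub>Z_pow n\<^esub> s)"
  have inj_f: "inj_on f (B \<times> {0..<int L})"
  proof (rule inj_onI, clarify)
    fix c s c' s'
    assume c: "c \<in> B" "c' \<in> B" and eq: "f (c, s) = f (c', s')"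
    have cc: "c \<in> carrier (Z_pow n)" "c' \<in> carrier (Z_pow n)"
      using B c by auto
    have "\<phi> (c' \<otimes>\<^bsub>Z_pow n\<^esub> inv\<^bsub>Z_pow n\<^esub> c) = Z_unit n l [^]\<^bsub>Z_pow n\<^esub> (s - s')"
    proof (rule Z_pow_eqI[of _ n])
      fix i assume i: "i < n"
      have "f (c, s) i = f (c', s') i"
        by (simp add: eq)
      then show "\<phi> (c' \<otimes>\<^bsub>Z_pow n\<^esub> inv\<^bsub>Z_pow n\<^esub> c) i = (Z_unit n l [^]\<^bsub>Z_pow n\<^esub> (s - s')) i"
        using i cc by (simp add: f_def algebra_simps)
    qed (use cc in auto)
    then have "s = s'"
      using contr cc by (metis Z_pow.inv_closed Z_pow.m_closed eq_iff_diff_eq_0 imageI)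
    then have "\<phi> c = \<phi> c'"
      using eq cc by (simp add: f_def)
    then show "c = c' \<and> s = s'"
      using inj cc \<open>s = s'\<close> by (auto dest: inj_onD)
  qed
  have img: "f ` (B \<times> {0..<int L}) \<subseteq> {..<n} \<rightarrow>\<^sub>E {- (M * int L)..M * int L}"
  proof clarify
    fix c s assume c: "c \<in> B" and s: "s \<in> {0..<int L}"
    have cc: "c \<in> carrier (Z_pow n)"
      using B c by auto
    have bd: "\<bar>f (c, s) j\<bar> \<le> M * int L" if j: "j < n" for j
    proof -
      have "\<bar>\<phi> c j\<bar> \<le> (\<Sum>k<n. \<bar>c k * \<phi> (Z_unit n k) j\<bar>)"
        using Z_pow_hom_linear[OF hom cc j] by simp
      also have "\<dots> \<le> (\<Sum>k<n. int L * \<bar>\<phi> (Z_unit n k) j\<bar>)"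
      proof (rule sum_mono)
        fix k assume "k \<in> {..<n}"
        then have "c k \<in> {0..<int L}"
          using c unfolding B_def by (rule PiE_mem[rotated])
        then have "\<bar>c k\<bar> \<le> int L"
          by simp
        then show "\<bar>c k * \<phi> (Z_unit n k) j\<bar> \<le> int L * \<bar>\<phi> (Z_unit n k) j\<bar>"
          unfolding abs_mult by (rule mult_right_mono) simp
      qed
      also have "\<dots> = int L * (\<Sum>k<n. \<bar>\<phi> (Z_unit n k) j\<bar>)"
        by (rule sum_distrib_left[symmetric])
      also have "\<dots> \<le> int L * (M - 1)"
      proof (rule mult_left_mono)
        show "(\<Sum>k<n. \<bar>\<phi> (Z_unit n k) j\<bar>) \<le> M - 1"
          using j member_le_sum[of j "{..<n}" "\<lambda>j. \<Sum>k<n. \<bar>\<phi> (Z_unit n k) j\<bar>"]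
          by (simp add: M_def sum_nonneg)
      qed simp
      finally have "\<bar>\<phi> c j\<bar> \<le> int L * (M - 1)" .
      moreover have "\<bar>(Z_unit n l [^]\<^bsub>Z_pow n\<^esub> s) j\<bar> \<le> int L"
        using s j by auto
      ultimately show ?thesis
        using j by (simp add: f_def algebra_simps)
    qed
    show "f (c, s) \<in> {..<n} \<rightarrow>\<^sub>E {- (M * int L)..M * int L}"
    proof (intro PiE_I)
      fix j assume "j \<in> {..<n}"
      then have "\<bar>f (c, s) j\<bar> \<le> M * int L"
        using bd by simp
      then show "f (c, s) j \<in> {- (M * int L)..M * int L}"
        unfolding abs_le_iff by simp
    next
      fix j assume "j \<notin> {..<n}"
      then show "f (c, s) j = undefined"
        using cc by (simp add: f_def Z_pow_def)
    qed
  qed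
  have "card (B \<times> {0..<int L}) \<le> card ({..<n} \<rightarrow>\<^sub>E {- (M * int L)..M * int L})"
    using card_inj_on_le[OF inj_f img] by (simp add: finite_PiE)
  then have "L ^ n * L \<le> nat (2 * (M * int L) + 1) ^ n"
    by (simp add: B_def card_cartesian_product card_PiE algebra_simps)
  then have "int (L ^ n * L) \<le> int (nat (2 * (M * int L) + 1) ^ n)"
    by (simp only: of_nat_le_iff)
  then have "int L ^ n * int L \<le> (2 * (M * int L) + 1) ^ n"
    using M by simp
  also have "\<dots> \<le> ((2 * M + 1) * int L) ^ n"
  proof (rule power_mono)
    show "2 * (M * int L) + 1 \<le> (2 * M + 1) * int L"
      using L M by (simp add: algebra_simps)
  qed (use M in simp)
  also have "\<dots> = int L ^ n * (int L - 1)"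
    by (simp add: power_mult_distrib L)
  finally have "int L \<le> int L - 1"
    using L M by (simp add: mult_le_cancel_left)
  then show False
    by simp
qed

text \<open>The product of the exponents found for the single unit vectors serves all of them.
  Finite index is expressed by divisibility so that it can be combined with reduction modulo an
  integer.\<close>

lemma Z_pow_mon_image_multiples:
  assumes \<phi>: "\<phi> \<in> mon (Z_pow n) (Z_pow n)"
  shows "\<exists>d::int. d > 0 \<and> (\<forall>x\<in>carrier (Z_pow n). (\<forall>i<n. d dvd x i) \<longrightarrow> x \<in> \<phi> ` carrier (Z_pow n))"
proof -
  let ?C = "\<phi> ` carrier (Z_pow n)"
  interpret \<phi>: group_hom "Z_pow n" "Z_pow n" \<phi>
    using \<phi> by (simp add: mon_def group_hom_def group_hom_axioms_def)
  have sub: "subgroup ?C (Z_pow n)"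
    by (rule \<phi>.img_is_subgroup)
  obtain k :: "nat \<Rightarrow> int"
    where k: "\<And>l. l < n \<Longrightarrow> k l \<noteq> 0 \<and> Z_unit n l [^]\<^bsub>Z_pow n\<^esub> k l \<in> ?C"
    using Z_pow_mon_bounded_image[OF \<phi>] by metis
  define d where "d = \<bar>\<Prod>l<n. k l\<bar>"
  have "x \<in> ?C" if x: "x \<in> carrier (Z_pow n)" and dvd: "\<forall>i<n. d dvd x i" for x
  proof -
    have unit: "Z_unit n l [^]\<^bsub>Z_pow n\<^esub> x l \<in> ?C" if l: "l < n" for l
    proof -
      have "k l dvd d"
        using l by (simp add: d_def dvd_prodI)
      then obtain q where "x l = k l * q"
        using dvd l by (meson dvd_def dvd_trans)
      then have "Z_unit n l [^]\<^bsub>Z_pow n\<^esub> x l = (Z_unit n l [^]\<^bsub>Z_pow n\<^esub> k l) [^]\<^bsub>Z_pow n\<^esub> q"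
        by (simp add: Z_pow.int_pow_pow)
      moreover have "(Z_unit n l [^]\<^bsub>Z_pow n\<^esub> k l) [^]\<^bsub>Z_pow n\<^esub> q \<in> ?C"
        using k[OF l] by (auto simp flip: \<phi>.hom_int_pow)
      ultimately show ?thesis
        by simp
    qed
    show ?thesis
      using x
    proof (induction rule: Z_pow_induct)
      case one
      then show ?case
        using sub subgroup.one_closed by blast
    next
      case (step y l)
      then show ?case
        by (intro subgroup.m_closed[OF sub] unit)
    qed
  qed
  moreover have "d > 0"
    using k by (simp add: d_def)
  ultimately show ?thesis
    by blast
qed

lemma finite_image_Z_pow:
  assumes "d > 0"
    and "\<And>x y. x \<in> carrier (Z_pow n) \<Longrightarrow> y \<in> carrier (Z_pow n) \<Longrightarrow> (\<And>i. i < n \<Longrightarrow> d dvd x i - y i) \<Longrightarrow> f x = f y"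
  shows "finite (f ` carrier (Z_pow n))"
proof (rule finite_image_factor)
  show "finite ((\<lambda>x. \<lambda>i\<in>{..<n}. x i mod d) ` carrier (Z_pow n))"
    by (rule finite_subset[of _ "{..<n} \<rightarrow>\<^sub>E {0..<d}"]) (use assms(1) in \<open>auto simp: finite_PiE split: if_splits\<close>)
next
  fix x y
  assume xy: "x \<in> carrier (Z_pow n)" "y \<in> carrier (Z_pow n)"
    and eq: "(\<lambda>i\<in>{..<n}. x i mod d) = (\<lambda>i\<in>{..<n}. y i mod d)"
  show "f x = f y"
  proof (rule assms(2)[OF xy])
    fix i assume "i < n"
    then show "d dvd x i - y i"
      using fun_cong[OF eq, of i] by (simp add: mod_eq_dvd_iff)
  qed
qed

section \<open>Subgroups of finite index in Z^n\<close>

lemma (in comm_group) iso_Z_pow_Suc: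
  assumes \<pi>: "\<pi> \<in> hom G integer_group" and nz: "\<exists>x\<in>carrier G. \<pi> x \<noteq> 0"
    and ker: "G\<lparr>carrier := {x \<in> carrier G. \<pi> x = 0}\<rparr> \<cong> Z_pow k"
  shows "G \<cong> Z_pow (Suc k)"
proof -
  interpret \<pi>: group_hom G integer_group \<pi>
    using \<pi> by (simp add: group_hom_def group_hom_axioms_def)
  have \<pi>_mult: "\<pi> (x \<otimes> y) = \<pi> x + \<pi> y" if "x \<in> carrier G" "y \<in> carrier G" for x y
    using \<pi> that by (auto simp: hom_def)
  have \<pi>_pow: "\<pi> (x [^] (j::int)) = j * \<pi> x" if "x \<in> carrier G" for x j
    using that by (simp add: \<pi>.hom_int_pow)
  obtain b0 where b0: "b0 \<in> carrier G" "\<pi> b0 > 0"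
  proof -
    obtain x where x: "x \<in> carrier G" "\<pi> x \<noteq> 0"
      using nz by blast
    then have "\<pi> (inv x) = - \<pi> x"
      by simp
    then show ?thesis
      using x that[of x] that[of "inv x"] by force
  qed
  \<comment> \<open>The least positive value of \<pi> generates its image, so \<open>b\<close> spans
    a complement of the kernel and supplies the additional coordinate.\<close>
  obtain b where b: "b \<in> carrier G" "\<pi> b > 0"
    and b_min: "\<And>x. x \<in> carrier G \<Longrightarrow> \<pi> x > 0 \<Longrightarrow> \<pi> b \<le> \<pi> x"
  proof -
    obtain b where "b \<in> carrier G \<and> \<pi> b > 0"
      and "\<forall>x. x \<in> carrier G \<and> \<pi> x > 0 \<longrightarrow> nat (\<pi> b) \<le> nat (\<pi> x)"
      using ex_has_least_nat[of "\<lambda>x. x \<in> carrier G \<and> \<pi> x > 0" b0 "\<lambda>x. nat (\<pi> x)"] b0 by blast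
    then show ?thesis
      using that[of b] by force
  qed
  have b_dvd: "\<pi> b dvd \<pi> x" if x: "x \<in> carrier G" for x
  proof -
    let ?y = "x \<otimes> b [^] (- (\<pi> x div \<pi> b))"
    have "\<pi> ?y = \<pi> x mod \<pi> b"
      using x b by (simp add: \<pi>_mult \<pi>_pow minus_div_mult_eq_mod[symmetric])
    moreover have "?y \<in> carrier G"
      using x b by simp
    ultimately have "\<pi> x mod \<pi> b \<le> 0"
      using b_min[of ?y] b(2) by (metis not_le pos_mod_bound)
    then show ?thesis
      using b(2) by (metis dvd_eq_mod_eq_0 order_antisym pos_mod_sign)
  qed
  let ?K = "{x \<in> carrier G. \<pi> x = 0}"
  have subK: "subgroup ?K G"
    using \<pi>.subgroup_kernel by (simp add: kernel_def)
  interpret K: group "G\<lparr>carrier := ?K\<rparr>"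
    using subK by (simp add: subgroup_imp_group)
  obtain \<psi> where \<psi>: "\<psi> \<in> iso (Z_pow k) (G\<lparr>carrier := ?K\<rparr>)"
    using K.iso_sym[OF ker] by (auto simp: is_iso_def)
  have \<psi>_closed: "\<psi> z \<in> carrier G" "\<pi> (\<psi> z) = 0" if "z \<in> carrier (Z_pow k)" for z
    using \<psi> that by (auto simp: iso_def hom_def)
  have \<psi>_mult: "\<psi> (z \<otimes>\<^bsub>Z_pow k\<^esub> z') = \<psi> z \<otimes> \<psi> z'" if "z \<in> carrier (Z_pow k)" "z' \<in> carrier (Z_pow k)" for z z'
    using \<psi> that by (auto simp: iso_def hom_def)
  have \<psi>_inj: "inj_on \<psi> (carrier (Z_pow k))" and \<psi>_img: "\<psi> ` carrier (Z_pow k) = ?K"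
    using \<psi> by (auto simp: iso_def bij_betw_def)
  have \<psi>_one: "\<psi> \<one>\<^bsub>Z_pow k\<^esub> = \<one>"
    using hom_one[of \<psi> "Z_pow k" "G\<lparr>carrier := ?K\<rparr>"] \<psi> K.is_group by (simp add: iso_def)
  define f where "f x = \<psi> (restrict x {..<k}) \<otimes> b [^] x k" for x
  have res: "restrict x {..<k} \<in> carrier (Z_pow k)" for x :: "nat \<Rightarrow> int"
    by (simp add: carrier_Z_pow)
  have f_closed: "f x \<in> carrier G" for x
    using \<psi>_closed(1)[OF res] b by (simp add: f_def)
  have hom: "f \<in> hom (Z_pow (Suc k)) G"
  proof (rule homI)
    fix x y
    assume xy: "x \<in> carrier (Z_pow (Suc k))" "y \<in> carrier (Z_pow (Suc k))"
    have "restrict (x \<otimes>\<^bsub>Z_pow (Suc k)\<^esub> y) {..<k} = restrict x {..<k} \<otimes>\<^bsub>Z_pow k\<^esub> restrict y {..<k}"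
      by (rule Z_pow_eqI[of _ k]) (use res in auto)
    then have "f (x \<otimes>\<^bsub>Z_pow (Suc k)\<^esub> y) = (\<psi> (restrict x {..<k}) \<otimes> \<psi> (restrict y {..<k})) \<otimes> (b [^] x k \<otimes> b [^] y k)"
      using b res by (simp add: f_def \<psi>_mult int_pow_mult)
    also have "\<dots> = f x \<otimes> f y"
      using b \<psi>_closed(1)[OF res] by (simp add: f_def m_ac)
    finally show "f (x \<otimes>\<^bsub>Z_pow (Suc k)\<^esub> y) = f x \<otimes> f y" .
  qed (rule f_closed)
  interpret f: group_hom "Z_pow (Suc k)" G f
    using hom by (simp add: group_hom_def group_hom_axioms_def)
  have "f \<in> iso (Z_pow (Suc k)) G"
    unfolding f.iso_iff
  proof (intro conjI subsetI ballI impI)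
    fix g assume g: "g \<in> carrier G"
    define c where "c = \<pi> g div \<pi> b"
    have "\<pi> g = c * \<pi> b"
      using b_dvd[OF g] by (simp add: c_def)
    then have "g \<otimes> b [^] (- c) \<in> ?K"
      using g b by (simp add: \<pi>_mult \<pi>_pow)
    then obtain z where z: "z \<in> carrier (Z_pow k)" "\<psi> z = g \<otimes> b [^] (- c)"
      using \<psi>_img by (metis (no_types, lifting) imageE)
    define x where "x = (\<lambda>i\<in>{..<Suc k}. if i = k then c else z i)"
    have "restrict x {..<k} = z"
      by (rule Z_pow_eqI[of _ k]) (use z in \<open>auto simp: x_def carrier_Z_pow\<close>)
    then have "f x = g \<otimes> b [^] (- c) \<otimes> b [^] c"
      using z by (simp add: f_def x_def)
    also have "\<dots> = g"
      using g b by (simp add: m_assoc int_pow_mult[symmetric])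
    finally show "g \<in> f ` carrier (Z_pow (Suc k))"
      by (auto simp: x_def carrier_Z_pow intro!: image_eqI[of _ _ x])
  next
    fix x assume x: "x \<in> carrier (Z_pow (Suc k))" and fx: "f x = \<one>"
    have "\<pi> (f x) = x k * \<pi> b"
      using b \<psi>_closed[OF res] by (simp add: f_def \<pi>_mult \<pi>_pow)
    then have xk: "x k = 0"
      using fx b(2) by simp
    then have "\<psi> (restrict x {..<k}) = \<psi> \<one>\<^bsub>Z_pow k\<^esub>"
      using fx \<psi>_closed(1)[OF res] by (simp add: f_def \<psi>_one)
    then have "restrict x {..<k} = \<one>\<^bsub>Z_pow k\<^esub>"
      using \<psi>_inj res by (auto dest: inj_onD)
    then have "restrict x {..<k} i = \<one>\<^bsub>Z_pow k\<^esub> i" for i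
      by simp
    then have "x i = 0" if "i < k" for i
      using that by (metis Z_pow_one_nth lessThan_iff restrict_apply')
    then show "x = \<one>\<^bsub>Z_pow (Suc k)\<^esub>"
      using xk x by (intro Z_pow_eqI[of _ "Suc k"]) (auto simp: less_Suc_eq)
  qed
  then have "Z_pow (Suc k) \<cong> G"
    by (rule is_isoI)
  then show ?thesis
    by (rule Z_pow.iso_sym)
qed

lemma (in group) finite_rcosets_pow:
  assumes "subgroup L G" "finite (rcosets L)" "x \<in> carrier G"
  shows "\<exists>m::nat. m > 0 \<and> x [^] m \<in> L"
proof -
  have "\<not> inj_on (\<lambda>m::nat. L #> x [^] m) UNIV"
  proof
    assume "inj_on (\<lambda>m::nat. L #> x [^] m) UNIV"
    moreover have "range (\<lambda>m::nat. L #> x [^] m) \<subseteq> rcosets L"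
      using assms(3) by (auto simp: rcosets_eq_image)
    ultimately show False
      using assms(2) by (meson finite_subset infinite_UNIV_nat inj_on_finite)
  qed
  then obtain i j :: nat where ij: "i < j" "L #> x [^] i = L #> x [^] j"
    by (auto simp: inj_on_def) (metis linorder_neqE_nat)
  have "x [^] j = x [^] (j - i) \<otimes> x [^] i"
    using ij(1) assms(3) by (simp add: nat_pow_mult)
  then have "x [^] j \<otimes> inv (x [^] i) = x [^] (j - i)"
    using assms(3) by (simp add: m_assoc)
  moreover have "x [^] j \<otimes> inv (x [^] i) \<in> L"
    using ij(2) assms by (metis nat_pow_closed r_coset_eq_iff)
  ultimately show ?thesis
    using ij(1) by (intro exI[of _ "j - i"]) simp
qed

lemma comm_group_Z_pow_subgroup:
  assumes "subgroup H (Z_pow n)"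
  shows "comm_group ((Z_pow n)\<lparr>carrier := H\<rparr>)"
proof (rule group.group_comm_groupI)
  show "group ((Z_pow n)\<lparr>carrier := H\<rparr>)"
    using assms by (rule Z_pow.subgroup_imp_group)
qed (use subgroup.subset[OF assms] in \<open>auto intro: Z_pow.m_comm\<close>)

text \<open>\<open>B\<close> is filtered by the number of leading coordinates that may be nonzero.
  Each stage is the kernel of a coordinate on the next one, and that coordinate is not zero there
  because finite index puts a positive multiple of every unit vector into \<open>B\<close>; so the
  rank grows by one each time.\<close>

lemma finite_index_Z_pow_iso:
  assumes B: "subgroup B (Z_pow n)" "finite (rcosets\<^bsub>Z_pow n\<^esub> B)"
  shows "(Z_pow n)\<lparr>carrier := B\<rparr> \<cong> Z_pow n"
proof -
  define V where "V k = {x \<in> B. \<forall>j. k \<le> j \<and> j < n \<longrightarrow> x j = 0}" for k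
  have sub_carr: "B \<subseteq> carrier (Z_pow n)"
    using B(1) subgroup.subset by blast
  have sub: "subgroup (V k) (Z_pow n)" for k
    by (rule Z_pow.subgroupI)
      (use B(1) sub_carr subgroup.one_closed[OF B(1)] in
        \<open>auto simp: V_def subgroup.m_closed subgroup.m_inv_closed subset_iff intro!: exI[of _ "\<one>\<^bsub>Z_pow n\<^esub>"]\<close>)
  have "k \<le> n \<Longrightarrow> (Z_pow n)\<lparr>carrier := V k\<rparr> \<cong> Z_pow k" for k
  proof (induction k)
    case 0
    have "V 0 = {\<one>\<^bsub>Z_pow n\<^esub>}"
      using sub_carr subgroup.one_closed[OF B(1)]
      by (auto simp: V_def subset_iff intro!: Z_pow_eqI[of _ n])
    moreover have "carrier (Z_pow 0) = {\<one>\<^bsub>Z_pow 0\<^esub>}"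
      by (auto intro: Z_pow_eqI)
    ultimately have "(\<lambda>_. \<one>\<^bsub>Z_pow 0\<^esub>) \<in> iso ((Z_pow n)\<lparr>carrier := V 0\<rparr>) (Z_pow 0)"
      by (auto simp: iso_def hom_def bij_betw_def)
    then show ?case
      by (rule is_isoI)
  next
    case (Suc k)
    let ?G = "(Z_pow n)\<lparr>carrier := V (Suc k)\<rparr>"
    have k: "k < n"
      using Suc.prems by simp
    interpret G: comm_group ?G
      using sub by (rule comm_group_Z_pow_subgroup)
    show ?case
    proof (rule G.iso_Z_pow_Suc)
      show "(\<lambda>x. x k) \<in> hom ?G integer_group"
        using k by (auto simp: hom_def)
      obtain m :: nat where m: "m > 0" "Z_unit n k [^]\<^bsub>Z_pow n\<^esub> m \<in> B"
        using Z_pow.finite_rcosets_pow[OF B Z_unit_closed] by blast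
      let ?x = "Z_unit n k [^]\<^bsub>Z_pow n\<^esub> int m"
      have "?x \<in> V (Suc k)" "?x k \<noteq> 0"
        using m k by (auto simp: V_def int_pow_int) (simp_all flip: int_pow_int)
      then show "\<exists>x\<in>carrier ?G. x k \<noteq> 0"
        by auto
      have "{x \<in> V (Suc k). x k = 0} = V k"
        using k by (auto simp: V_def) (metis le_antisym not_less_eq_eq)
      then show "?G\<lparr>carrier := {x \<in> carrier ?G. x k = 0}\<rparr> \<cong> Z_pow k"
        using Suc k by simp
    qed
  qed
  moreover have "V n = B"
    by (auto simp: V_def)
  ultimately show ?thesis
    by fastforce
qed

lemma (in group) finite_index_iso_Z_pow:
  assumes G: "G \<cong> Z_pow n" and B: "subgroup B G" "finite (rcosets B)"
  shows "G\<lparr>carrier := B\<rparr> \<cong> Z_pow n"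
proof -
  obtain \<phi> where \<phi>: "\<phi> \<in> iso G (Z_pow n)"
    using G by (auto simp: is_iso_def)
  interpret \<phi>: group_hom G "Z_pow n" \<phi>
    using \<phi> by (simp add: iso_def group_hom_def group_hom_axioms_def)
  have sub: "subgroup (\<phi> ` B) (Z_pow n)"
    using B(1) by (rule \<phi>.subgroup_img_is_subgroup)
  have surj: "\<phi> ` carrier G = carrier (Z_pow n)"
    using \<phi> by (auto simp: iso_def bij_betw_def)
  have "\<phi> ` B #>\<^bsub>Z_pow n\<^esub> \<phi> g = \<phi> ` (B #> g)" if "g \<in> carrier G" for g
    using that subgroup.subset[OF B(1)] by (force simp: r_coset_def)
  then have "rcosets\<^bsub>Z_pow n\<^esub> (\<phi> ` B) \<subseteq> (`) \<phi> ` (rcosets B)"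
    by (auto simp: Z_pow.rcosets_eq_image rcosets_eq_image surj[symmetric])
  then have "finite (rcosets\<^bsub>Z_pow n\<^esub> (\<phi> ` B))"
    using B(2) finite_subset by blast
  then have "(Z_pow n)\<lparr>carrier := \<phi> ` B\<rparr> \<cong> Z_pow n"
    by (rule finite_index_Z_pow_iso[OF sub])
  moreover have "G\<lparr>carrier := B\<rparr> \<cong> (Z_pow n)\<lparr>carrier := \<phi> ` B\<rparr>"
    using iso_restrict[OF \<phi> is_group Z_pow.is_group B(1)] by (rule is_isoI)
  ultimately show ?thesis
    using iso_trans by blast
qed

section \<open>Ascending HNN extensions\<close>

definition hnn_gens :: "('g, 'm) monoid_scheme \<Rightarrow> 'g hnn_gen set"
  where "hnn_gens A = insert Stable (Base ` carrier A)"

definition hnn_rels :: "('g, 'm) monoid_scheme \<Rightarrow> ('g \<Rightarrow> 'g) \<Rightarrow> ('g hnn_gen word \<times> 'g hnn_gen word) set"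
  where "hnn_rels A \<phi> =
    {([(Base a, True), (Base b, True)], [(Base (a \<otimes>\<^bsub>A\<^esub> b), True)]) | a b.
        a \<in> carrier A \<and> b \<in> carrier A} \<union>
     {([(Stable, True), (Base a, True), (Stable, False)], [(Base (\<phi> a), True)]) | a.
        a \<in> carrier A}"

lemma Stable_hnn_gens [simp]: "Stable \<in> hnn_gens A"
  by (simp add: hnn_gens_def)

lemma Base_hnn_gens [simp]: "Base a \<in> hnn_gens A \<longleftrightarrow> a \<in> carrier A"
  by (auto simp: hnn_gens_def)

lemma ascending_hnn_eq: "ascending_hnn A \<phi> = presented_group (hnn_gens A) (hnn_rels A \<phi>)"
  by (simp add: ascending_hnn_def hnn_gens_def hnn_rels_def)

locale hnn = A: group A for A (structure) +
  fixes \<phi> :: "'g \<Rightarrow> 'g"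
  assumes hom: "\<phi> \<in> hom A A"
begin

abbreviation "P \<equiv> ascending_hnn A \<phi>"

definition base :: "'g \<Rightarrow> 'g hnn_gen word set"
  where "base a = wclass (hnn_gens A) (hnn_rels A \<phi>) [(Base a, True)]"

definition st :: "'g hnn_gen word set"
  where "st = wclass (hnn_gens A) (hnn_rels A \<phi>) [(Stable, True)]"

sublocale P: group P
  unfolding ascending_hnn_eq by (rule group_presented_group)

sublocale \<phi>: group_hom A A \<phi>
  by unfold_locales (rule hom)

lemma st_closed [simp]: "st \<in> carrier P"
  by (simp add: st_def ascending_hnn_eq wclass_closed)

lemma base_closed [simp]: "a \<in> carrier A \<Longrightarrow> base a \<in> carrier P"
  by (simp add: base_def ascending_hnn_eq wclass_closed)

lemma base_mult: 
  assumes "a \<in> carrier A" "b \<in> carrier A"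
  shows "base (a \<otimes> b) = base a \<otimes>\<^bsub>P\<^esub> base b"
proof -
  have "([(Base a, True), (Base b, True)], [(Base (a \<otimes> b), True)]) \<in> hnn_rels A \<phi>"
    using assms by (auto simp: hnn_rels_def)
  from wclass_relation[OF this, of "hnn_gens A"] assms show ?thesis
    by (simp add: base_def ascending_hnn_eq wclass_append)
qed

sublocale base: group_hom A P base
  by unfold_locales (auto simp: hom_def base_mult)

lemma st_base:
  assumes "a \<in> carrier A"
  shows "st \<otimes>\<^bsub>P\<^esub> base a = base (\<phi> a) \<otimes>\<^bsub>P\<^esub> st"
proof -
  have "([(Stable, True), (Base a, True), (Stable, False)], [(Base (\<phi> a), True)]) \<in> hnn_rels A \<phi>"
    using assms by (auto simp: hnn_rels_def)
  from wclass_relation[OF this, of "hnn_gens A"] assms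
  have "wclass (hnn_gens A) (hnn_rels A \<phi>) [(Stable, True), (Base a, True), (Stable, False)] = base (\<phi> a)"
    by (simp add: base_def)
  moreover have "wclass (hnn_gens A) (hnn_rels A \<phi>) [(Stable, True), (Base a, True), (Stable, False)]
      = st \<otimes>\<^bsub>P\<^esub> base a \<otimes>\<^bsub>P\<^esub> inv\<^bsub>P\<^esub> st"
    using assms by (simp add: base_def st_def ascending_hnn_eq wclass_append inv_wclass)
  ultimately have "st \<otimes>\<^bsub>P\<^esub> base a \<otimes>\<^bsub>P\<^esub> inv\<^bsub>P\<^esub> st = base (\<phi> a)"
    by simp
  then show ?thesis
    using assms by (metis P.inv_solve_right' P.m_closed base_closed \<phi>.hom_closed st_closed)
qed

text \<open>Positive powers of the stable letter t move to the right past the base at the price of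
  iterating \<phi>; this dictates the shape t^-i a t^j of the normal form.\<close>

lemma st_pow_base:
  assumes "a \<in> carrier A"
  shows "st [^]\<^bsub>P\<^esub> (i::nat) \<otimes>\<^bsub>P\<^esub> base a = base ((\<phi> ^^ i) a) \<otimes>\<^bsub>P\<^esub> st [^]\<^bsub>P\<^esub> i"
    and "(\<phi> ^^ i) a \<in> carrier A"
proof (induction i)
  case 0
  {
    case 1
    then show ?case
      using assms by simp
  next
    case 2
    then show ?case
      using assms by simp
  }
next
  case (Suc i)
  {
    case 1
    have "st [^]\<^bsub>P\<^esub> Suc i \<otimes>\<^bsub>P\<^esub> base a = st \<otimes>\<^bsub>P\<^esub> (st [^]\<^bsub>P\<^esub> i \<otimes>\<^bsub>P\<^esub> base a)"
      using assms P.nat_pow_Suc2[OF st_closed] by (simp add: P.m_assoc)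
    also have "\<dots> = (st \<otimes>\<^bsub>P\<^esub> base ((\<phi> ^^ i) a)) \<otimes>\<^bsub>P\<^esub> st [^]\<^bsub>P\<^esub> i"
      using Suc by (simp add: P.m_assoc)
    also have "\<dots> = base ((\<phi> ^^ Suc i) a) \<otimes>\<^bsub>P\<^esub> (st \<otimes>\<^bsub>P\<^esub> st [^]\<^bsub>P\<^esub> i)"
      using Suc by (simp add: st_base P.m_assoc)
    also have "st \<otimes>\<^bsub>P\<^esub> st [^]\<^bsub>P\<^esub> i = st [^]\<^bsub>P\<^esub> Suc i"
      using P.nat_pow_Suc2[OF st_closed] by simp
    finally show ?case .
  next
    case 2
    then show ?case
      using Suc by simp
  }
qed

text \<open>Multiply t^-i a t^j on the left by a letter. A base element c passes t^-i and turns a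
  into \<phi>^i(c) a; the letter t cancels against t^-i or, when i = 0, passes a and joins t^j; the
  letter t^-1 raises i.\<close>

lemma normal_form:
  assumes "g \<in> carrier P"
  shows "\<exists>(i::nat) (j::nat) a. a \<in> carrier A \<and> g = inv\<^bsub>P\<^esub> (st [^]\<^bsub>P\<^esub> i) \<otimes>\<^bsub>P\<^esub> base a \<otimes>\<^bsub>P\<^esub> st [^]\<^bsub>P\<^esub> j"
  using assms[unfolded ascending_hnn_eq]
proof (induction rule: presented_group_induct)
  case one
  then show ?case
    by (intro exI[of _ 0] exI[of _ \<one>]) (simp flip: ascending_hnn_eq)
next
  case (gen x b g)
  then obtain i j :: nat and a
    where a: "a \<in> carrier A" and g: "g = inv\<^bsub>P\<^esub> (st [^]\<^bsub>P\<^esub> i) \<otimes>\<^bsub>P\<^esub> base a \<otimes>\<^bsub>P\<^esub> st [^]\<^bsub>P\<^esub> j"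
    by (auto simp flip: ascending_hnn_eq)
  let ?w = "wclass (hnn_gens A) (hnn_rels A \<phi>) [(x, b)]"
  have "\<exists>i' j' a'. a' \<in> carrier A \<and>
      ?w \<otimes>\<^bsub>P\<^esub> g = inv\<^bsub>P\<^esub> (st [^]\<^bsub>P\<^esub> (i'::nat)) \<otimes>\<^bsub>P\<^esub> base a' \<otimes>\<^bsub>P\<^esub> st [^]\<^bsub>P\<^esub> (j'::nat)"
  proof (cases x)
    case (Base c)
    then have c: "c \<in> carrier A"
      using gen(1) by (auto simp: hnn_gens_def)
    obtain c' where c': "c' \<in> carrier A" "?w = base c'"
    proof (cases b)
      case True
      then show ?thesis
        using that[OF c] Base by (simp add: base_def)
    next
      case False
      then have "?w = inv\<^bsub>P\<^esub> base c"
        using inv_wclass[OF gen(1), of "hnn_rels A \<phi>" True] Base by (simp add: base_def ascending_hnn_eq)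
      then show ?thesis
        using that[of "inv c"] c by simp
    qed
    let ?d = "(\<phi> ^^ i) c'"
    have d: "?d \<in> carrier A" "st [^]\<^bsub>P\<^esub> i \<otimes>\<^bsub>P\<^esub> base c' = base ?d \<otimes>\<^bsub>P\<^esub> st [^]\<^bsub>P\<^esub> i"
      using st_pow_base c' by auto
    have "base c' \<otimes>\<^bsub>P\<^esub> inv\<^bsub>P\<^esub> (st [^]\<^bsub>P\<^esub> i) = inv\<^bsub>P\<^esub> (st [^]\<^bsub>P\<^esub> i) \<otimes>\<^bsub>P\<^esub> base ?d"
      using c' d by (simp add: P.inv_solve_left P.inv_solve_right' P.m_assoc[symmetric])
        (simp add: P.m_assoc)
    then have "base c' \<otimes>\<^bsub>P\<^esub> g = inv\<^bsub>P\<^esub> (st [^]\<^bsub>P\<^esub> i) \<otimes>\<^bsub>P\<^esub> base (?d \<otimes> a) \<otimes>\<^bsub>P\<^esub> st [^]\<^bsub>P\<^esub> j"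
      using a c' d by (simp add: g base_mult P.m_assoc[symmetric])
    then show ?thesis
      using a d(1) c'(2) by (metis A.m_closed)
  next
    case Stable
    show ?thesis
    proof (cases b)
      case True
      then have w: "?w = st"
        using Stable by (simp add: st_def)
      show ?thesis
      proof (cases i)
        case 0
        then have "st \<otimes>\<^bsub>P\<^esub> g = (st \<otimes>\<^bsub>P\<^esub> base a) \<otimes>\<^bsub>P\<^esub> st [^]\<^bsub>P\<^esub> j"
          using a by (simp add: g P.m_assoc)
        also have "\<dots> = base (\<phi> a) \<otimes>\<^bsub>P\<^esub> (st \<otimes>\<^bsub>P\<^esub> st [^]\<^bsub>P\<^esub> j)"
          using a by (simp add: st_base P.m_assoc)
        also have "\<dots> = inv\<^bsub>P\<^esub> (st [^]\<^bsub>P\<^esub> (0::nat)) \<otimes>\<^bsub>P\<^esub> base (\<phi> a) \<otimes>\<^bsub>P\<^esub> st [^]\<^bsub>P\<^esub> Suc j"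
          using a P.nat_pow_Suc2[OF st_closed] by simp
        finally show ?thesis
          using a w \<phi>.hom_closed by metis
      next
        case (Suc k)
        then have "st \<otimes>\<^bsub>P\<^esub> g = inv\<^bsub>P\<^esub> (st [^]\<^bsub>P\<^esub> k) \<otimes>\<^bsub>P\<^esub> base a \<otimes>\<^bsub>P\<^esub> st [^]\<^bsub>P\<^esub> j"
          using a by (simp add: g P.inv_mult_group P.m_assoc[symmetric])
        then show ?thesis
          using a w by auto
      qed
    next
      case False
      then have w: "?w = inv\<^bsub>P\<^esub> st"
        using inv_wclass[OF gen(1), of "hnn_rels A \<phi>" True] Stable by (simp add: st_def ascending_hnn_eq)
      have "inv\<^bsub>P\<^esub> st \<otimes>\<^bsub>P\<^esub> g = inv\<^bsub>P\<^esub> (st [^]\<^bsub>P\<^esub> Suc i) \<otimes>\<^bsub>P\<^esub> base a \<otimes>\<^bsub>P\<^esub> st [^]\<^bsub>P\<^esub> j"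
        using a by (simp add: g P.inv_mult_group P.m_assoc)
      then show ?thesis
        using a w by metis
    qed
  qed
  then show ?case
    by (auto simp flip: ascending_hnn_eq)
qed

end

text \<open>If the exponents i and j of the normal form differ, a finite cyclic quotient sees the
  exponent of the stable letter. If they agree, the element is conjugate to a base element, which an
  affine action modulo \<open>m\<close> detects.\<close>

lemma residually_finite_ascending_hnn:
  assumes \<phi>: "\<phi> \<in> mon (Z_pow n) (Z_pow n)"
  shows "residually_finite (ascending_hnn (Z_pow n) \<phi>)"
proof -
  interpret hnn "Z_pow n" \<phi>
    using \<phi> by unfold_locales (simp add: mon_def)
  show ?thesis
  proof (rule P.residually_finiteI)
    fix g assume g: "g \<in> carrier P" "g \<noteq> \<one>\<^bsub>P\<^esub>"
    obtain i j :: nat and a where a: "a \<in> carrier (Z_pow n)"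
      and g_eq: "g = inv\<^bsub>P\<^esub> (st [^]\<^bsub>P\<^esub> i) \<otimes>\<^bsub>P\<^esub> base a \<otimes>\<^bsub>P\<^esub> st [^]\<^bsub>P\<^esub> j"
      using normal_form[OF g(1)] by blast
    have "\<exists>M. M \<lhd> P \<and> finite (rcosets\<^bsub>P\<^esub> M) \<and> g \<notin> M"
    proof (cases "i = j")
      case False
      \<comment> \<open>The modulus exceeds both exponents, so they remain different modulo
        \<open>k\<close>.\<close>
      define k where "k = i + j + 1"
      define F where "F x b s = (case x of Base a \<Rightarrow> s | Stable \<Rightarrow> if b then (s + 1) mod k else (s + k - 1) mod k)"
        for x :: "(nat \<Rightarrow> int) hnn_gen" and b s
      interpret B0: presented_act "hnn_gens (Z_pow n)" "hnn_rels (Z_pow n) \<phi>" "{..<k}" F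
      proof
        show "F x b s \<in> {..<k}" if "s \<in> {..<k}" for x b s
          using that by (auto simp: F_def k_def split: hnn_gen.split)
        show "F x b (F x (\<not> b) s) = s" if "s \<in> {..<k}" for x b s
          using that by (auto simp: F_def k_def mod_Suc mod_if split: hnn_gen.split)
        show "run F l s = run F r s" if "(l, r) \<in> hnn_rels (Z_pow n) \<phi>" "s \<in> {..<k}" for l r s
          using that by (auto simp: hnn_rels_def F_def k_def mod_Suc mod_if)
      qed
      interpret B: group_act P "{..<k}" "pres_lift F"
        unfolding ascending_hnn_eq by (rule B0.group_act_axioms)
      have st_act: "pres_lift F (st [^]\<^bsub>P\<^esub> m) s = (s + m) mod k" if "s \<in> {..<k}" for m :: nat and s
        using that
      proof (induction m arbitrary: s)
        case (Suc m)
        have "pres_lift F st s = (s + 1) mod k"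
          using Suc.prems by (simp add: st_def B0.pres_lift_gen F_def)
        then show ?case
          using Suc by (simp add: B.act_mult k_def mod_simps)
      qed simp
      have 0: "0 \<in> {..<k}"
        by (simp add: k_def)
      have base_act: "pres_lift F (base a) s = s" if "s \<in> {..<k}" for s
        using that a by (simp add: base_def B0.pres_lift_gen F_def)
      have "pres_lift F g 0 \<noteq> 0"
      proof
        assume "pres_lift F g 0 = 0"
        then have "pres_lift F (st [^]\<^bsub>P\<^esub> j) 0 = pres_lift F (st [^]\<^bsub>P\<^esub> i) 0"
          using a 0 by (simp add: g_eq B.act_mult B.act_inv_eq_iff base_act del: lessThan_iff)
        then show False
          using False 0 by (simp add: st_act k_def del: lessThan_iff)
      qed
      then show ?thesis
        using B.finite_act_moves[OF _ 0] by blast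
    next
      case True
      have "a \<noteq> \<one>\<^bsub>Z_pow n\<^esub>"
        using g g_eq True by auto
      then obtain c where c: "c < n" "a c \<noteq> 0"
        using Z_pow_eqI[OF a, of "\<one>\<^bsub>Z_pow n\<^esub>"] by auto
      obtain d :: int where d: "d > 0"
        and d_img: "\<And>x. x \<in> carrier (Z_pow n) \<Longrightarrow> (\<And>i. i < n \<Longrightarrow> d dvd x i) \<Longrightarrow> x \<in> \<phi> ` carrier (Z_pow n)"
        using Z_pow_mon_image_multiples[OF \<phi>] by blast
      \<comment> \<open>\<open>m\<close> is prime to \<open>d\<close>, so \<open>\<phi>\<close> is invertible modulo \<open>m\<close>.\<close>
      define m where "m = d * \<bar>a c\<bar> + 1"
      \<comment> \<open>Hence \<open>m\<close> does not divide the nonzero coordinate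
        \<open>a c\<close>, and translation by \<open>a\<close> moves every point modulo
        \<open>m\<close>.\<close>
      have m: "m > \<bar>a c\<bar>"
        using mult_right_mono[of 1 d "\<bar>a c\<bar>"] d by (simp add: m_def)
      define red where "red x = (\<lambda>i\<in>{..<n}. x i mod m)" for x :: "nat \<Rightarrow> int"
      define \<Omega> where "\<Omega> = {..<n} \<rightarrow>\<^sub>E {0..<m}"
      have fin: "finite \<Omega>"
        by (simp add: \<Omega>_def finite_PiE)
      have \<Omega>_carr: "s \<in> carrier (Z_pow n)" if "s \<in> \<Omega>" for s
        using that by (auto simp: \<Omega>_def carrier_Z_pow PiE_def)
      have red_\<Omega>: "red x \<in> \<Omega>" for x
        using m by (auto simp: red_def \<Omega>_def)
      have red_id: "red s = s" if s: "s \<in> \<Omega>" for s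
      proof (rule Z_pow_eqI[of _ n])
        fix i assume i: "i < n"
        then have "s i \<in> {0..<m}"
          using PiE_mem[OF s[unfolded \<Omega>_def], of i] by simp
        then show "red s i = s i"
          using i by (simp add: red_def)
      qed (use s red_\<Omega> \<Omega>_carr in blast)+
      have red_eq: "red x = red y \<longleftrightarrow> (\<forall>i<n. m dvd x i - y i)" for x y
      proof
        assume "red x = red y"
        then have "red x i = red y i" for i
          by simp
        then show "\<forall>i<n. m dvd x i - y i"
          by (metis (no_types, lifting) lessThan_iff mod_eq_dvd_iff red_def restrict_apply')
      next
        assume "\<forall>i<n. m dvd x i - y i"
        then show "red x = red y"
          by (auto simp: red_def mod_eq_dvd_iff)
      qed
      have red_nth: "m dvd red x i - x i" if "i < n" for x i
        using that by (simp add: red_def mod_eq_dvd_iff[symmetric])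
      have red_mult: "red (red x \<otimes>\<^bsub>Z_pow n\<^esub> y) = red (x \<otimes>\<^bsub>Z_pow n\<^esub> y)" for x y
        by (simp add: red_eq red_nth)
      have red_\<phi>: "red (\<phi> x) = red (\<phi> y)"
        if "x \<in> carrier (Z_pow n)" "y \<in> carrier (Z_pow n)" "red x = red y" for x y
        unfolding red_eq
      proof (intro allI impI)
        fix j assume j: "j < n"
        have "\<phi> x j - \<phi> y j = (\<Sum>l<n. (x l - y l) * \<phi> (Z_unit n l) j)"
          using that j by (simp add: Z_pow_hom_linear[OF hom] sum_subtractf left_diff_distrib)
        then show "m dvd \<phi> x j - \<phi> y j"
          using that(3) by (auto simp: red_eq intro!: dvd_sum)
      qed
      define T where "T s = red (\<phi> s)" for s
      have "s \<in> T ` \<Omega>" if s: "s \<in> \<Omega>" for s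
      proof -
        note sc = \<Omega>_carr[OF s]
        obtain z where z: "z \<in> carrier (Z_pow n)" "\<phi> z = s [^]\<^bsub>Z_pow n\<^esub> d"
          using d_img[of "s [^]\<^bsub>Z_pow n\<^esub> d"] sc by (auto simp: image_iff)
        \<comment> \<open>Here \<phi>(z) = d s, and -d |a c| = 1 - m is congruent to 1 modulo m, so
          this multiple of \<open>z\<close> maps to \<open>s\<close> modulo
          \<open>m\<close>.\<close>
        let ?z = "z [^]\<^bsub>Z_pow n\<^esub> (- \<bar>a c\<bar>)"
        have "T (red ?z) = red (\<phi> ?z)"
          unfolding T_def using z by (intro red_\<phi>[OF \<Omega>_carr[OF red_\<Omega>] _ red_id[OF red_\<Omega>]]) simp
        also have "\<phi> ?z = s [^]\<^bsub>Z_pow n\<^esub> (d * (- \<bar>a c\<bar>))"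
          using z sc by (simp add: \<phi>.hom_int_pow Z_pow.int_pow_pow)
        also have "red \<dots> = red s"
          unfolding red_eq
        proof (intro allI impI)
          fix i assume "i < n"
          then have "(s [^]\<^bsub>Z_pow n\<^esub> (d * (- \<bar>a c\<bar>))) i - s i = m * (- s i)"
            using sc by (simp add: m_def algebra_simps)
          then show "m dvd (s [^]\<^bsub>Z_pow n\<^esub> (d * (- \<bar>a c\<bar>))) i - s i"
            by simp
        qed
        finally show ?thesis
          using red_id[OF s] red_\<Omega> by (metis image_eqI)
      qed
      then have T_img: "T ` \<Omega> = \<Omega>"
        using red_\<Omega> by (auto simp: T_def)
      then have T_inj: "inj_on T \<Omega>"
        using fin by (intro eq_card_imp_inj_on) simp_all
      \<comment> \<open>Base elements act as translations and the stable letter as the permutation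
        induced by \<phi>; conjugating a translation by it applies \<phi> to the translation
        vector.\<close>
      define F where "F x b s = (case x of
          Base u \<Rightarrow> red (s \<otimes>\<^bsub>Z_pow n\<^esub> (if b then u else inv\<^bsub>Z_pow n\<^esub> u))
        | Stable \<Rightarrow> if b then T s else inv_into \<Omega> T s)" for x b s
      have T_inv: "T (inv_into \<Omega> T s) = s" "inv_into \<Omega> T s \<in> \<Omega>" if "s \<in> \<Omega>" for s
        using that T_img by (auto simp: f_inv_into_f inv_into_into)
      interpret B0: presented_act "hnn_gens (Z_pow n)" "hnn_rels (Z_pow n) \<phi>" \<Omega> F
      proof
        show "F x b s \<in> \<Omega>" if "s \<in> \<Omega>" for x b s
          using that red_\<Omega> T_inv T_img by (auto simp: F_def split: hnn_gen.split)
        show "F x b (F x (\<not> b) s) = s" if "x \<in> hnn_gens (Z_pow n)" "s \<in> \<Omega>" for x b s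
        proof (cases x)
          case (Base u)
          then have "u \<in> carrier (Z_pow n)"
            using that by (auto simp: hnn_gens_def)
          then show ?thesis
            using Base \<Omega>_carr[OF that(2)] red_id[OF that(2)]
            by (auto simp: F_def red_mult Z_pow.m_assoc)
        next
          case Stable
          then show ?thesis
            using that T_inv T_inj T_img by (auto simp: F_def)
        qed
        show "run F l s = run F r s" if lr: "(l, r) \<in> hnn_rels (Z_pow n) \<phi>" and s: "s \<in> \<Omega>" for l r s
          using lr unfolding hnn_rels_def
        proof (elim UnE CollectE exE conjE)
          fix u v
          assume "(l, r) = ([(Base u, True), (Base v, True)], [(Base (u \<otimes>\<^bsub>Z_pow n\<^esub> v), True)])"
            and "u \<in> carrier (Z_pow n)" "v \<in> carrier (Z_pow n)"
          then show ?thesis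
            using \<Omega>_carr[OF s] by (simp add: F_def red_mult Z_pow.m_ac)
        next
          fix u
          assume lr: "(l, r) = ([(Stable, True), (Base u, True), (Stable, False)], [(Base (\<phi> u), True)])"
            and u: "u \<in> carrier (Z_pow n)"
          define s' where "s' = inv_into \<Omega> T s"
          have s': "s' \<in> \<Omega>" "s' \<in> carrier (Z_pow n)" "T s' = s"
            using T_inv[OF s] \<Omega>_carr by (auto simp: s'_def)
          have "T (red (s' \<otimes>\<^bsub>Z_pow n\<^esub> u)) = red (\<phi> (s' \<otimes>\<^bsub>Z_pow n\<^esub> u))"
            unfolding T_def using s' u by (intro red_\<phi>[OF \<Omega>_carr[OF red_\<Omega>] _ red_id[OF red_\<Omega>]]) simp
          also have "\<dots> = red (red (\<phi> s') \<otimes>\<^bsub>Z_pow n\<^esub> \<phi> u)"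
            using s' u by (simp add: red_mult)
          also have "red (\<phi> s') = s"
            using s' by (simp add: T_def)
          finally show ?thesis
            using lr by (simp add: F_def s'_def)
        qed
      qed
      interpret B: group_act P \<Omega> "pres_lift F"
        unfolding ascending_hnn_eq by (rule B0.group_act_axioms)
      have no_fix: "pres_lift F (base a) s \<noteq> s" if s: "s \<in> \<Omega>" for s
      proof
        assume "pres_lift F (base a) s = s"
        then have "red (s \<otimes>\<^bsub>Z_pow n\<^esub> a) = red s"
          using s a red_id by (simp add: base_def B0.pres_lift_gen F_def)
        then have "m dvd a c"
          using c by (simp add: red_eq)
        then show False
          using c m by (metis abs_of_pos dvd_imp_le_int linorder_not_less m order.strict_trans2 abs_ge_zero)
      qed
      define s where "s = red (\<lambda>_. 0)"
      have s: "s \<in> \<Omega>"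
        by (simp add: s_def red_\<Omega>)
      \<comment> \<open>As \<open>i = j\<close>, the power \<open>j\<close> of \<open>st\<close>
        would carry a fixed point of \<open>g\<close> to a fixed point of
        \<open>base a\<close>.\<close>
      have "pres_lift F g s \<noteq> s"
        using no_fix[of "pres_lift F (st [^]\<^bsub>P\<^esub> j) s"] s a True by (simp add: g_eq B.act_mult B.act_inv_eq_iff)
      then show ?thesis
        using B.finite_act_moves[OF fin s] by blast
    qed
    then show "\<exists>L. subgroup L P \<and> finite (rcosets\<^bsub>P\<^esub> L) \<and> g \<notin> L"
      using normal_imp_subgroup by blast
  qed
qed

section \<open>Free groups\<close>

definition reduced :: "'x word \<Rightarrow> bool"
  where "reduced w \<longleftrightarrow> successively (\<lambda>(x, b) (y, c). x = y \<longrightarrow> b = c) w"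

lemma reduced_nth:
  assumes "reduced w" "Suc i < length w" "w ! i = (x, b)"
  shows "w ! Suc i \<noteq> (x, \<not> b)"
  using assms by (auto simp: reduced_def successively_conv_nth)

lemma pres_rel_reduced:
  assumes "w \<in> words X"
  shows "\<exists>w'\<in>words X. reduced w' \<and> (w, w') \<in> pres_rel X R"
  using assms
proof (induction w)
  case Nil
  then show ?case
    by (intro bexI[of _ "[]"]) (auto simp: reduced_def pres_rel.refl)
next
  case (Cons y w)
  obtain x b where y: "y = (x, b)"
    by force
  have x: "x \<in> X"
    using Cons.prems y by simp
  obtain w' where w': "w' \<in> words X" "reduced w'" "(w, w') \<in> pres_rel X R"
    using Cons y by auto
  have eq: "(y # w, y # w') \<in> pres_rel X R"
    using pres_rel_append[OF pres_rel.refl w'(3), of "[y]"] x y by simp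
  show ?case
  proof (cases "\<exists>w''. w' = (x, \<not> b) # w''")
    case True
    then obtain w'' where w'': "w' = (x, \<not> b) # w''"
      by blast
    have "(y # w', w'') \<in> pres_rel X R"
      using pres_rel.cancel[of "[]" X w'' x b R] x w'(1) by (simp add: y w'')
    moreover have "w'' \<in> words X" "reduced w''"
      using w' w'' by (auto simp: reduced_def successively_Cons)
    ultimately show ?thesis
      using eq pres_rel.trans by fast
  next
    case False
    then have "reduced (y # w')"
      using w'(2) by (cases w') (auto simp: y reduced_def)
    moreover have "y # w' \<in> words X"
      using x w'(1) y by simp
    ultimately show ?thesis
      using eq by blast
  qed
qed

text \<open>Domain and range have complements of equal size in \<open>S\<close>, and any bijection
  between the complements completes the map.\<close>

lemma extend_partial_injection:
  assumes "finite S" "D \<subseteq> S" "inj_on f D" "f ` D \<subseteq> S"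
  shows "\<exists>p. bij_betw p S S \<and> (\<forall>x\<in>D. p x = f x)"
proof -
  have "card (S - D) = card (S - f ` D)"
    using assms by (simp add: card_Diff_subset finite_subset card_image)
  then obtain h where h: "bij_betw h (S - D) (S - f ` D)"
    using assms(1) finite_same_card_bij by blast
  have "bij_betw (\<lambda>x. if x \<in> D then f x else h x) (D \<union> (S - D)) (f ` D \<union> (S - f ` D))"
    using assms(3) h by (intro bij_betw_disjoint_Un) (auto simp: bij_betw_def)
  moreover have "D \<union> (S - D) = S" "f ` D \<union> (S - f ` D) = S"
    using assms by auto
  ultimately show ?thesis
    by (intro exI[of _ "\<lambda>x. if x \<in> D then f x else h x"]) auto
qed

text \<open>A reduced word of length \<open>k\<close> prescribes a partial injection of \<open>{0,\<dots>,k}\<close> for every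
  generator, in such a way that the word moves \<open>k\<close> to \<open>0\<close>.\<close>

lemma residually_finite_free_group: "residually_finite (free_group X)"
proof -
  interpret P: group "free_group X"
    unfolding free_group_def by (rule group_presented_group)
  show ?thesis
  proof (rule P.residually_finiteI)
    fix g assume g: "g \<in> carrier (free_group X)" "g \<noteq> \<one>\<^bsub>free_group X\<^esub>"
    obtain w where w: "w \<in> words X" "reduced w" "g = wclass X {} w"
    proof -
      obtain u where u: "u \<in> words X" "g = wclass X {} u"
        using g(1) by (auto simp: free_group_def carrier_presented_group)
      then show ?thesis
        using that pres_rel_reduced[OF u(1), of "{}"] wclass_eq_iff by metis
    qed
    define k where "k = length w"
    have k: "k > 0"
      using g(2) w by (auto simp: k_def free_group_def one_presented_group)
    \<comment> \<open>Reading the word from the right, the position starts at \<open>k\<close> and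
      drops by one with each letter. The letter \<open>(x, True)\<close> at index
      \<open>j - 1\<close> wants \<open>p x\<close> to send \<open>j\<close> to
      \<open>j - 1\<close>; the letter \<open>(x, False)\<close> at index \<open>j\<close> wants
      \<open>p x\<close> to send \<open>j\<close> to \<open>j + 1\<close>.\<close>
    define D where "D x = {j. 0 < j \<and> j \<le> k \<and> w ! (j - 1) = (x, True)} \<union> {j. j < k \<and> w ! j = (x, False)}" for x
    define f where "f x j = (if 0 < j \<and> w ! (j - 1) = (x, True) then j - 1 else j + 1)" for x j
    \<comment> \<open>The prescriptions for one generator could conflict, or two of them could share
      a value, only at adjacent inverse letters, which a reduced word excludes.\<close>
    have red: False if "Suc j < k" "w ! j = (x, b)" "w ! Suc j = (x, \<not> b)" for j x b
      using reduced_nth[OF w(2) _ that(2)] that by (simp add: k_def)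
    have f_True: "f x (Suc j) = j" "Suc j \<in> D x" if "j < k" "w ! j = (x, True)" for x j
      using that by (auto simp: f_def D_def)
    have f_False: "f x j = Suc j" "j \<in> D x" if "j < k" "w ! j = (x, False)" for x j
      using that red[of "j - 1" x True] by (auto simp: f_def D_def)
    have "\<exists>p. bij_betw p {..k} {..k} \<and> (\<forall>j\<in>D x. p j = f x j)" for x
    proof (rule extend_partial_injection)
      show "f x ` D x \<subseteq> {..k}"
        by (auto simp: D_def f_def)
      show "inj_on (f x) (D x)"
      proof (rule inj_onI)
        fix i j assume ij: "i \<in> D x" "j \<in> D x" and eq: "f x i = f x j"
        have case_D: "(\<exists>l<k. i = Suc l \<and> w ! l = (x, True) \<and> f x i = l) \<or> (i < k \<and> w ! i = (x, False) \<and> f x i = Suc i)"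
          if "i \<in> D x" for i
          using that f_True(1)[of "i - 1" x] f_False(1)[of i x] by (cases i) (auto simp: D_def)
        show "i = j"
          using case_D[OF ij(1)] case_D[OF ij(2)] eq red[of i x False] red[of j x False] by auto
      qed
    qed (auto simp: D_def)
    then obtain p where p: "\<And>x. bij_betw (p x) {..k} {..k}" "\<And>x j. j \<in> D x \<Longrightarrow> p x j = f x j"
      by metis
    define F where "F x b = (if b then p x else inv_into {..k} (p x))" for x b
    have p_img: "p x ` {..k} = {..k}" "inj_on (p x) {..k}" for x
      using p(1)[of x] by (auto simp: bij_betw_def)
    interpret B0: presented_act X "{}" "{..k}" F
    proof
      show "F x b s \<in> {..k}" if "s \<in> {..k}" for x b s
        using that p_img[of x] inv_into_into[of s "p x" "{..k}"] unfolding F_def by auto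
      show "F x b (F x (\<not> b) s) = s" if "s \<in> {..k}" for x b s
        using that p_img[of x] f_inv_into_f[of s "p x" "{..k}"] unfolding F_def by auto
    qed simp
    interpret B: group_act "free_group X" "{..k}" "pres_lift F"
      unfolding free_group_def by (rule B0.group_act_axioms)
    have "run F (drop (k - m) w) k = k - m" if "m \<le> k" for m
      using that
    proof (induction m)
      case 0
      then show ?case
        by (simp add: k_def)
    next
      case (Suc m)
      define j where "j = k - Suc m"
      have j: "j < k" "k - m = Suc j"
        using Suc.prems by (auto simp: j_def)
      obtain x b where xb: "w ! j = (x, b)"
        by force
      have "drop j w = (x, b) # drop (Suc j) w"
        using j xb by (simp add: k_def Cons_nth_drop_Suc[symmetric])
      then have "run F (drop j w) k = F x b (Suc j)"
        using Suc j by simp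
      also have "\<dots> = j"
      proof (cases b)
        case True
        then show ?thesis
          using f_True[OF j(1)] xb p(2) by (simp add: F_def)
      next
        case False
        then have "p x j = Suc j"
          using f_False[OF j(1)] xb p(2) by simp
        then show ?thesis
          using False p_img(2)[of x] j(1) inv_into_f_f[of "p x" "{..k}" j] by (simp add: F_def)
      qed
      finally show ?case
        by (simp add: j_def)
    qed
    from this[of k] have "pres_lift F g k \<noteq> k"
      using k w by (simp add: B0.pres_lift_wclass)
    then show "\<exists>L. subgroup L (free_group X) \<and> finite (rcosets\<^bsub>free_group X\<^esub> L) \<and> g \<notin> L"
      using B.finite_act_moves[of k g] normal_imp_subgroup by fastforce
  qed
qed

lemma residually_finite_is_free:
  fixes Q :: "('q, 'm) monoid_scheme"
  assumes "group Q" "is_free Q"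
  shows "residually_finite Q"
proof -
  obtain X :: "'q set" where "Q \<cong> free_group X"
    using assms(2) by (auto simp: is_free_def)
  then show ?thesis
    using residually_finite_iso[OF assms(1)] residually_finite_free_group group_presented_group
    by (metis free_group_def)
qed

lemma presented_group_hom_eq:
  assumes K: "group K" and h: "h \<in> hom (presented_group X R) K" and h': "h' \<in> hom (presented_group X R) K"
    and eq: "\<And>x. x \<in> X \<Longrightarrow> h (wclass X R [(x, True)]) = h' (wclass X R [(x, True)])"
    and g: "g \<in> carrier (presented_group X R)"
  shows "h g = h' g"
proof -
  interpret h: group_hom "presented_group X R" K h
    using K h by (simp add: group_hom_def group_hom_axioms_def group_presented_group)
  interpret h': group_hom "presented_group X R" K h'
    using K h' by (simp add: group_hom_def group_hom_axioms_def group_presented_group)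
  have letter: "h (wclass X R [(x, b)]) = h' (wclass X R [(x, b)])" if x: "x \<in> X" for x b
  proof (cases b)
    case False
    have "wclass X R [(x, b)] = inv\<^bsub>presented_group X R\<^esub> wclass X R [(x, True)]"
      using x False by (simp add: inv_wclass)
    then show ?thesis
      using x eq by (simp add: wclass_closed)
  qed (use eq x in simp)
  show ?thesis
    using g
  proof (induction rule: presented_group_induct)
    case (gen x b g)
    then show ?case
      using letter by (simp add: wclass_closed)
  qed simp
qed

text \<open>Free groups are projective: preimages of the basis elements are chosen, and with no
  relations to respect every choice extends to a homomorphism.\<close>

lemma is_free_section:
  fixes Q :: "('q, 'm) monoid_scheme"
  assumes groups: "group H" "group Q" and free: "is_free Q"
    and p: "p \<in> hom H Q" "p ` carrier H = carrier Q"
  obtains \<sigma> where "\<sigma> \<in> hom Q H" "\<And>q. q \<in> carrier Q \<Longrightarrow> p (\<sigma> q) = q"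
proof -
  interpret H: group H by fact
  interpret Q: group Q by fact
  obtain X :: "'q set" and \<theta> where \<theta>: "\<theta> \<in> iso Q (presented_group X {})"
    using free by (auto simp: is_free_def free_group_def is_iso_def)
  let ?\<theta>' = "inv_into (carrier Q) \<theta>"
  have \<theta>': "?\<theta>' \<in> iso (presented_group X {}) Q"
    by (rule Q.iso_set_sym[OF \<theta>])
  have "\<exists>y. y \<in> carrier H \<and> p y = ?\<theta>' (wclass X {} [(x, True)])" if "x \<in> X" for x
  proof -
    have "?\<theta>' (wclass X {} [(x, True)]) \<in> carrier Q"
      using \<theta>' that by (auto simp: iso_def hom_def wclass_closed)
    then show ?thesis
      using p(2) by (metis imageE)
  qed
  then obtain f where f: "\<And>x. x \<in> X \<Longrightarrow> f x \<in> carrier H \<and> p (f x) = ?\<theta>' (wclass X {} [(x, True)])"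
    by metis
  obtain s where s: "s \<in> hom (presented_group X {}) H"
    and s_eval: "\<And>w. w \<in> words X \<Longrightarrow> s (wclass X {} w) = word_eval H f w"
    using H.presented_group_hom[of f X "{}"] f by auto
  have ps: "p (s g) = ?\<theta>' g" if g: "g \<in> carrier (presented_group X {})" for g
  proof -
    have "(p \<circ> s) g = ?\<theta>' g"
    proof (rule presented_group_hom_eq[OF groups(2) _ _ _ g])
      show "p \<circ> s \<in> hom (presented_group X {}) Q"
        using s p(1) hom_compose by blast
      show "?\<theta>' \<in> hom (presented_group X {}) Q"
        using \<theta>' by (simp add: iso_def)
      fix x assume "x \<in> X"
      then show "(p \<circ> s) (wclass X {} [(x, True)]) = ?\<theta>' (wclass X {} [(x, True)])"
        using f by (simp add: s_eval)
    qed
    then show ?thesis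
      by simp
  qed
  show ?thesis
  proof
    show "s \<circ> \<theta> \<in> hom Q H"
      using s \<theta> by (auto simp: iso_def intro: hom_compose)
    fix q assume q: "q \<in> carrier Q"
    then have "\<theta> q \<in> carrier (presented_group X {})"
      using \<theta> by (auto simp: iso_def hom_def)
    then show "p ((s \<circ> \<theta>) q) = q"
      using ps q \<theta> by (simp add: iso_def bij_betw_def)
  qed
qed

text \<open>An element of the normal subgroup \<open>N \<cong> \<int>\<^sup>n\<close> is separated by \<open>N\<^sup>m S\<close> for suitable \<open>m\<close>,
  where \<open>S\<close> is a complement of \<open>N\<close>; \<open>r\<close> below is the retraction onto \<open>S\<close>.\<close>

lemma residually_finite_Z_pow_by_free:
  assumes "group H" "Z_pow_by_free n H"
  shows "residually_finite H"
proof -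
  interpret H: group H by fact
  obtain N where N: "N \<lhd> H" and N_iso: "H\<lparr>carrier := N\<rparr> \<cong> Z_pow n" and free: "is_free (H Mod N)"
    using assms(2) by (auto simp: Z_pow_by_free_def)
  interpret N: normal N H by fact
  interpret Q: group "H Mod N"
    by (rule N.factorgroup_is_group)
  interpret pr: group_hom H "H Mod N" "\<lambda>a. N #>\<^bsub>H\<^esub> a"
    by unfold_locales (rule N.r_coset_hom_Mod)
  obtain \<sigma> where \<sigma>: "\<sigma> \<in> hom (H Mod N) H"
    and \<sigma>_section: "\<And>q. q \<in> carrier (H Mod N) \<Longrightarrow> N #>\<^bsub>H\<^esub> \<sigma> q = q"
    using is_free_section[OF assms(1) Q.is_group free N.r_coset_hom_Mod]
    by (metis carrier_FactGroup)
  interpret \<sigma>: group_hom "H Mod N" H \<sigma>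
    by unfold_locales (rule \<sigma>)
  define r where "r h = \<sigma> (N #>\<^bsub>H\<^esub> h)" for h
  have r_closed [simp]: "r h \<in> carrier H" if "h \<in> carrier H" for h
    using that by (simp add: r_def)
  have r_mult: "r (h \<otimes>\<^bsub>H\<^esub> k) = r h \<otimes>\<^bsub>H\<^esub> r k" if "h \<in> carrier H" "k \<in> carrier H" for h k
    using that by (simp add: r_def pr.hom_mult \<sigma>.hom_mult del: mult_FactGroup)
  have r_inv: "r (inv\<^bsub>H\<^esub> h) = inv\<^bsub>H\<^esub> r h" if "h \<in> carrier H" for h
    using that by (simp add: r_def)
  have r_coset: "N #>\<^bsub>H\<^esub> r h = N #>\<^bsub>H\<^esub> h" if "h \<in> carrier H" for h
    using that \<sigma>_section[OF pr.hom_closed[OF that]] by (simp add: r_def)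
  have r_N: "r y = \<one>\<^bsub>H\<^esub>" if "y \<in> N" for y
    using that H.coset_join2[OF N.mem_carrier N.is_subgroup that] \<sigma>.hom_one by (simp add: r_def)
  \<comment> \<open>The \<open>N\<close>-part of \<open>h\<close> in the factorization that has the
    complement on the left.\<close>
  define \<epsilon> where "\<epsilon> h = inv\<^bsub>H\<^esub> r h \<otimes>\<^bsub>H\<^esub> h" for h
  have \<epsilon>_N: "\<epsilon> h \<in> N" if h: "h \<in> carrier H" for h
  proof -
    have "h \<otimes>\<^bsub>H\<^esub> inv\<^bsub>H\<^esub> r h \<in> N"
      using h r_coset[OF h] by (simp add: H.r_coset_eq_iff[OF N.is_subgroup, symmetric])
    then have "inv\<^bsub>H\<^esub> r h \<otimes>\<^bsub>H\<^esub> (h \<otimes>\<^bsub>H\<^esub> inv\<^bsub>H\<^esub> r h) \<otimes>\<^bsub>H\<^esub> r h \<in> N"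
      using N.inv_op_closed1 h by simp
    then show ?thesis
      using h by (simp add: \<epsilon>_def H.m_assoc)
  qed
  obtain \<psi> where \<psi>: "\<psi> \<in> iso (H\<lparr>carrier := N\<rparr>) (Z_pow n)"
    using N_iso by (auto simp: is_iso_def)
  have \<psi>_mult: "\<psi> (x \<otimes>\<^bsub>H\<^esub> y) = \<psi> x \<otimes>\<^bsub>Z_pow n\<^esub> \<psi> y" if "x \<in> N" "y \<in> N" for x y
    using \<psi> that by (auto simp: iso_def hom_def)
  have \<psi>_bij: "\<psi> ` N = carrier (Z_pow n)" "inj_on \<psi> N"
    using \<psi> by (auto simp: iso_def bij_betw_def)
  have \<psi>_closed: "\<psi> y \<in> carrier (Z_pow n)" if "y \<in> N" for y
    using \<psi>_bij that by blast
  have \<psi>_pow: "\<psi> (z [^]\<^bsub>H\<^esub> (k::int)) = \<psi> z [^]\<^bsub>Z_pow n\<^esub> k" if "z \<in> N" for z k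
    using hom_int_pow[of \<psi> "H\<lparr>carrier := N\<rparr>" "Z_pow n" z k] \<psi> that
      H.int_pow_consistent[OF N.is_subgroup that] H.subgroup_imp_group[OF N.is_subgroup]
    by (simp add: iso_def)
  have pow_N: "z [^]\<^bsub>H\<^esub> (k::int) \<in> N" if "z \<in> N" for z k
    using H.int_pow_consistent[OF N.is_subgroup that]
      group.int_pow_closed[OF H.subgroup_imp_group[OF N.is_subgroup], of z k] that by simp
  have conj_pow: "(h \<otimes>\<^bsub>H\<^esub> z \<otimes>\<^bsub>H\<^esub> inv\<^bsub>H\<^esub> h) [^]\<^bsub>H\<^esub> (k::int) = h \<otimes>\<^bsub>H\<^esub> z [^]\<^bsub>H\<^esub> k \<otimes>\<^bsub>H\<^esub> inv\<^bsub>H\<^esub> h"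
    if "h \<in> carrier H" "z \<in> carrier H" for h z k
  proof -
    have "(\<lambda>z. h \<otimes>\<^bsub>H\<^esub> z \<otimes>\<^bsub>H\<^esub> inv\<^bsub>H\<^esub> h) \<in> hom H H"
      using that(1) by (auto simp: hom_def H.m_assoc[symmetric]) (simp add: H.m_assoc)
    then show ?thesis
      using hom_int_pow[OF _ that(2) assms(1) assms(1)] by metis
  qed
  show ?thesis
  proof (rule H.residually_finiteI)
    fix g assume g: "g \<in> carrier H" "g \<noteq> \<one>\<^bsub>H\<^esub>"
    show "\<exists>L. subgroup L H \<and> finite (rcosets\<^bsub>H\<^esub> L) \<and> g \<notin> L"
    proof (cases "g \<in> N")
      case False
      then have "N #>\<^bsub>H\<^esub> g \<noteq> \<one>\<^bsub>H Mod N\<^esub>"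
        using g(1) H.coset_join1 N.is_subgroup by auto
      then obtain M where M: "M \<lhd> H Mod N" "finite (rcosets\<^bsub>H Mod N\<^esub> M)" "N #>\<^bsub>H\<^esub> g \<notin> M"
        using Q.residually_finiteD residually_finite_is_free[OF Q.is_group free] by blast
      then show ?thesis
        using pr.subgroup_vimage pr.finite_rcosets_vimage normal_imp_subgroup
        by (intro exI[of _ "{h \<in> carrier H. N #>\<^bsub>H\<^esub> h \<in> M}"]) auto
    next
      case True
      have "\<psi> g \<noteq> \<one>\<^bsub>Z_pow n\<^esub>"
      proof
        assume "\<psi> g = \<one>\<^bsub>Z_pow n\<^esub>"
        moreover have "\<psi> \<one>\<^bsub>H\<^esub> = \<one>\<^bsub>Z_pow n\<^esub>"
          using \<psi>_pow[OF True, of 0] by simp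
        ultimately show False
          using \<psi>_bij(2) True g(2) N.one_closed by (metis inj_onD)
      qed
      then obtain c where c: "c < n" "\<psi> g c \<noteq> 0"
        using Z_pow_eqI[OF \<psi>_closed[OF True], of "\<one>\<^bsub>Z_pow n\<^esub>"] by auto
      \<comment> \<open>Exceeding the absolute value of a nonzero entry, \<open>m\<close> does not
        divide it.\<close>
      define m where "m = \<bar>\<psi> g c\<bar> + 1"
      have m: "m > 0"
        by (simp add: m_def)
      define N' where "N' = {y \<in> N. \<forall>i<n. m dvd \<psi> y i}"
      have sub: "subgroup N' H"
      proof (rule H.subgroupI)
        show "inv\<^bsub>H\<^esub> y \<in> N'" if "y \<in> N'" for y
        proof -
          have "inv\<^bsub>H\<^esub> y = y [^]\<^bsub>H\<^esub> (-1::int)"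
            using that H.int_pow_neg[of y 1] by (simp add: N'_def)
          then show ?thesis
            using that pow_N[of y "-1"] by (simp add: N'_def \<psi>_pow \<psi>_closed)
        qed
        have "\<one>\<^bsub>H\<^esub> \<in> N'"
          using \<psi>_pow[OF True, of 0] by (simp add: N'_def)
        then show "N' \<noteq> {}"
          by blast
      qed (auto simp: N'_def \<psi>_mult)
      \<comment> \<open>The members of \<open>N'\<close> are the \<open>m\<close>-th powers of
        elements of \<open>N\<close>, and conjugation preserves powers.\<close>
      have conj: "h \<otimes>\<^bsub>H\<^esub> y \<otimes>\<^bsub>H\<^esub> inv\<^bsub>H\<^esub> h \<in> N'" if h: "h \<in> carrier H" and y: "y \<in> N'" for h y
      proof -
        have yN: "y \<in> N"
          using y by (simp add: N'_def)
        obtain z where z: "z \<in> N" "\<psi> z = (\<lambda>i\<in>{..<n}. \<psi> y i div m)"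
          using \<psi>_bij(1) by (metis carrier_Z_pow imageE restrict_extensional)
        have "\<psi> (z [^]\<^bsub>H\<^esub> m) = \<psi> y"
        proof (rule Z_pow_eqI[of _ n])
          fix i assume "i < n"
          then show "\<psi> (z [^]\<^bsub>H\<^esub> m) i = \<psi> y i"
            using y z \<psi>_closed[OF z(1)] by (simp add: \<psi>_pow N'_def)
        qed (use z yN pow_N \<psi>_closed in auto)
        then have "y = z [^]\<^bsub>H\<^esub> m"
          using \<psi>_bij(2) yN pow_N[OF z(1)] by (metis inj_onD)
        then have eq: "h \<otimes>\<^bsub>H\<^esub> y \<otimes>\<^bsub>H\<^esub> inv\<^bsub>H\<^esub> h = (h \<otimes>\<^bsub>H\<^esub> z \<otimes>\<^bsub>H\<^esub> inv\<^bsub>H\<^esub> h) [^]\<^bsub>H\<^esub> m"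
          using h z by (simp add: conj_pow)
        have "h \<otimes>\<^bsub>H\<^esub> z \<otimes>\<^bsub>H\<^esub> inv\<^bsub>H\<^esub> h \<in> N"
          using N.inv_op_closed2 h z by blast
        then show ?thesis
          unfolding eq N'_def by (simp add: pow_N \<psi>_pow \<psi>_closed)
      qed
      \<comment> \<open>This is the product of the complement and \<open>N'\<close>.\<close>
      define L where "L = {h \<in> carrier H. \<epsilon> h \<in> N'}"
      have conj': "inv\<^bsub>H\<^esub> h \<otimes>\<^bsub>H\<^esub> y \<otimes>\<^bsub>H\<^esub> h \<in> N'" if "h \<in> carrier H" "y \<in> N'" for h y
        using conj[of "inv\<^bsub>H\<^esub> h" y] that by simp
      have N'_carr: "y \<in> carrier H" if "y \<in> N'" for y
        using that by (simp add: N'_def)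
      have \<epsilon>_eq: "h = r h \<otimes>\<^bsub>H\<^esub> \<epsilon> h" if "h \<in> carrier H" for h
        using that by (simp add: \<epsilon>_def H.m_assoc[symmetric])
      have subL: "subgroup L H"
      proof (rule H.subgroupI)
        have "\<epsilon> \<one>\<^bsub>H\<^esub> = \<one>\<^bsub>H\<^esub>"
          by (simp add: \<epsilon>_def r_N)
        then show "L \<noteq> {}"
          using subgroup.one_closed[OF sub] by (auto simp: L_def intro!: exI[of _ "\<one>\<^bsub>H\<^esub>"])
      next
        fix h assume h: "h \<in> L"
        then have "\<epsilon> (inv\<^bsub>H\<^esub> h) = r h \<otimes>\<^bsub>H\<^esub> inv\<^bsub>H\<^esub> (\<epsilon> h) \<otimes>\<^bsub>H\<^esub> inv\<^bsub>H\<^esub> r h"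
          by (simp add: L_def \<epsilon>_def r_inv H.inv_mult_group H.m_assoc)
        then show "inv\<^bsub>H\<^esub> h \<in> L"
          using h conj[of "r h" "inv\<^bsub>H\<^esub> (\<epsilon> h)"] subgroup.m_inv_closed[OF sub] by (simp add: L_def)
      next
        fix h k assume hk: "h \<in> L" "k \<in> L"
        then have "\<epsilon> (h \<otimes>\<^bsub>H\<^esub> k) = (inv\<^bsub>H\<^esub> r k \<otimes>\<^bsub>H\<^esub> \<epsilon> h \<otimes>\<^bsub>H\<^esub> r k) \<otimes>\<^bsub>H\<^esub> \<epsilon> k"
          by (simp add: L_def \<epsilon>_def r_mult H.inv_mult_group H.m_assoc[symmetric]) (simp add: H.m_assoc)
        then show "h \<otimes>\<^bsub>H\<^esub> k \<in> L"
          using hk conj'[of "r k" "\<epsilon> h"] subgroup.m_closed[OF sub] by (simp add: L_def)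
      qed (auto simp: L_def)
      \<comment> \<open>The \<open>N\<close>-part modulo \<open>m\<close>-th powers determines the
        coset, and its coordinates modulo \<open>m\<close> take finitely many values.\<close>
      have "finite (rcosets\<^bsub>H\<^esub> L)"
      proof (rule H.finite_rcosetsI[where f = "\<lambda>h. \<lambda>i\<in>{..<n}. \<psi> (\<epsilon> h) i mod m"])
        show "finite ((\<lambda>h. \<lambda>i\<in>{..<n}. \<psi> (\<epsilon> h) i mod m) ` carrier H)"
          by (rule finite_subset[of _ "{..<n} \<rightarrow>\<^sub>E {0..<m}"])
            (use m in \<open>auto simp: finite_PiE split: if_splits\<close>)
      next
        fix h k
        assume hk: "h \<in> carrier H" "k \<in> carrier H"
          and eq: "(\<lambda>i\<in>{..<n}. \<psi> (\<epsilon> h) i mod m) = (\<lambda>i\<in>{..<n}. \<psi> (\<epsilon> k) i mod m)"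
        define y where "y = \<epsilon> h \<otimes>\<^bsub>H\<^esub> \<epsilon> k [^]\<^bsub>H\<^esub> (-1::int)"
        have y_eq: "y = \<epsilon> h \<otimes>\<^bsub>H\<^esub> inv\<^bsub>H\<^esub> \<epsilon> k"
          using hk \<epsilon>_N H.int_pow_neg[of "\<epsilon> k" 1] by (simp add: y_def)
        have "y \<in> N'"
          unfolding N'_def
        proof (intro CollectI conjI allI impI)
          show "y \<in> N"
            using hk \<epsilon>_N pow_N by (simp add: y_def)
          fix i assume i: "i < n"
          have "\<psi> (\<epsilon> h) i mod m = \<psi> (\<epsilon> k) i mod m"
            using fun_cong[OF eq, of i] i by simp
          then show "m dvd \<psi> y i"
            using i hk \<epsilon>_N pow_N[OF \<epsilon>_N[OF hk(2)]] \<psi>_closed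
            by (simp add: y_def \<psi>_mult \<psi>_pow mod_eq_dvd_iff)
        qed
        have "h \<otimes>\<^bsub>H\<^esub> inv\<^bsub>H\<^esub> k = r h \<otimes>\<^bsub>H\<^esub> y \<otimes>\<^bsub>H\<^esub> inv\<^bsub>H\<^esub> r k"
          using hk by (simp add: y_eq \<epsilon>_def H.inv_mult_group H.m_assoc[symmetric]) (simp add: H.m_assoc)
        moreover have "r (h \<otimes>\<^bsub>H\<^esub> inv\<^bsub>H\<^esub> k) = r h \<otimes>\<^bsub>H\<^esub> inv\<^bsub>H\<^esub> r k"
          using hk by (simp add: r_mult r_inv)
        ultimately have "\<epsilon> (h \<otimes>\<^bsub>H\<^esub> inv\<^bsub>H\<^esub> k) = r k \<otimes>\<^bsub>H\<^esub> y \<otimes>\<^bsub>H\<^esub> inv\<^bsub>H\<^esub> r k"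
          using hk N'_carr[OF \<open>y \<in> N'\<close>]
          by (simp add: \<epsilon>_def H.inv_mult_group H.m_assoc[symmetric]) (simp add: H.m_assoc)
        then show "h \<otimes>\<^bsub>H\<^esub> inv\<^bsub>H\<^esub> k \<in> L"
          using hk conj[OF _ \<open>y \<in> N'\<close>, of "r k"] by (simp add: L_def)
      qed (rule subL)
      moreover have "g \<notin> L"
      proof
        assume "g \<in> L"
        moreover have "\<epsilon> g = g"
          using g(1) True by (simp add: \<epsilon>_def r_N)
        ultimately have "m dvd \<psi> g c"
          using c by (simp add: L_def N'_def)
        then show False
          using c(2) dvd_imp_le_int[of "\<psi> g c" m] by (simp add: m_def)
      qed
      ultimately show ?thesis
        using subL by blast
    qed
  qed
qed

lemma residually_finite_virtually_Z_pow_by_free: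
  assumes "group G" "virtually_Z_pow_by_free n G"
  shows "residually_finite G"
proof -
  interpret group G by fact
  obtain H where H: "subgroup H G" "finite (rcosets\<^bsub>G\<^esub> H)" "Z_pow_by_free n (G\<lparr>carrier := H\<rparr>)"
    using assms(2) by (auto simp: virtually_Z_pow_by_free_def)
  interpret H: group "G\<lparr>carrier := H\<rparr>"
    using H(1) by (rule subgroup_imp_group)
  show ?thesis
  proof (rule residually_finiteI)
    fix g assume g: "g \<in> carrier G" "g \<noteq> \<one>\<^bsub>G\<^esub>"
    show "\<exists>L. subgroup L G \<and> finite (rcosets\<^bsub>G\<^esub> L) \<and> g \<notin> L"
    proof (cases "g \<in> H")
      case True
      obtain M where "M \<lhd> G\<lparr>carrier := H\<rparr>" "finite (rcosets\<^bsub>G\<lparr>carrier := H\<rparr>\<^esub> M)" "g \<notin> M"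
        using H.residually_finiteD[OF residually_finite_Z_pow_by_free[OF H.is_group H(3)], of g] g(2) by auto
      then show ?thesis
        using finite_rcosets_trans[OF H(1,2)] normal_imp_subgroup by blast
    qed (use H in blast)
  qed
qed

section \<open>Groups acting on trees\<close>

text \<open>Trees are encoded as connected graphs in which every edge is a bridge: the set \<open>Y\<close> in the
  axiom \<open>bridge\<close> is one of the two halves into which the edge cuts the tree.\<close>

locale bridge_tree =
  fixes V :: "'v set" and adj :: "'v \<Rightarrow> 'v \<Rightarrow> bool"
  assumes adj_V: "adj x y \<Longrightarrow> x \<in> V \<and> y \<in> V"
    and adj_sym: "adj x y \<Longrightarrow> adj y x"
    and connected: "x \<in> V \<Longrightarrow> y \<in> V \<Longrightarrow> adj\<^sup>*\<^sup>* x y"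
    and bridge: "adj x y \<Longrightarrow> \<exists>Y. x \<in> Y \<and> y \<notin> Y \<and> (\<forall>a b. adj a b \<longrightarrow> a \<in> Y \<longrightarrow> b \<notin> Y \<longrightarrow> a = x \<and> b = y)"
begin

text \<open>The component of \<open>x\<close> after the edge between \<open>x\<close> and
  \<open>y\<close> is removed. Unlike the set provided by \<open>bridge\<close> it is canonical,
  hence compatible with the group action.\<close>

definition half :: "'v \<Rightarrow> 'v \<Rightarrow> 'v set"
  where "half x y = {z. (\<lambda>a b. adj a b \<and> (a, b) \<noteq> (x, y) \<and> (a, b) \<noteq> (y, x))\<^sup>*\<^sup>* x z}"

lemma half_self [simp]: "x \<in> half x y"
  by (simp add: half_def)

lemma half_induct [consumes 1, case_names base step]:
  assumes "z \<in> half x y" and "P x"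
    and "\<And>a b. a \<in> half x y \<Longrightarrow> P a \<Longrightarrow> adj a b \<Longrightarrow> (a, b) \<noteq> (x, y) \<Longrightarrow> (a, b) \<noteq> (y, x) \<Longrightarrow> P b"
  shows "P z"
proof -
  have "(\<lambda>a b. adj a b \<and> (a, b) \<noteq> (x, y) \<and> (a, b) \<noteq> (y, x))\<^sup>*\<^sup>* x z"
    using assms(1) by (simp add: half_def)
  then show ?thesis
    by (induction rule: rtranclp_induct) (use assms(2,3) in \<open>auto simp: half_def\<close>)
qed

lemma half_leave:
  assumes "adj a b" "a \<in> half x y" "b \<notin> half x y"
  shows "a = x \<and> b = y"
proof (rule ccontr)
  assume "\<not> ?thesis"
  moreover have "b \<noteq> x"
    using assms(3) by auto
  ultimately have "adj a b \<and> (a, b) \<noteq> (x, y) \<and> (a, b) \<noteq> (y, x)"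
    using assms(1) by auto
  then have "b \<in> half x y"
    using assms(2) unfolding half_def by (auto intro: rtranclp.rtrancl_into_rtrancl)
  then show False
    using assms(3) by simp
qed

lemma half_other:
  assumes "adj x y"
  shows "y \<notin> half x y"
proof
  assume "y \<in> half x y"
  obtain Y where Y: "x \<in> Y" "y \<notin> Y" "\<And>a b. adj a b \<Longrightarrow> a \<in> Y \<Longrightarrow> b \<notin> Y \<Longrightarrow> a = x \<and> b = y"
    using bridge[OF assms] by blast
  have "z \<in> Y" if "z \<in> half x y" for z
    using that by (induction rule: half_induct) (use Y in blast)+
  then show False
    using \<open>y \<in> half x y\<close> Y(2) by blast
qed

lemma half_disjoint:
  assumes "adj x y" "z \<in> half y x"
  shows "z \<notin> half x y"
  using assms(2)
proof (induction rule: half_induct)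
  case base
  then show ?case
    by (rule half_other[OF assms(1)])
next
  case (step a b)
  then show ?case
    using half_leave[OF adj_sym[OF step.hyps(2)], of x y] by blast
qed

lemma half_cover:
  assumes "adj x y" "z \<in> V"
  shows "z \<in> half x y \<or> z \<in> half y x"
proof -
  have "adj\<^sup>*\<^sup>* x z"
    using connected adj_V assms by blast
  then show ?thesis
  proof (induction rule: rtranclp_induct)
    case (step a b)
    then show ?case
      using half_leave[of a b x y] half_leave[of a b y x] half_self by metis
  qed simp
qed

text \<open>Paths inside \<open>half p q\<close> start in \<open>half x y\<close> and could leave it
  only through \<open>x\<close>, which they avoid.\<close>

lemma half_subset:
  assumes "adj x y" "p \<in> half x y" "x \<notin> half p q"
  shows "half p q \<subseteq> half x y"
proof
  fix z assume "z \<in> half p q"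
  then show "z \<in> half x y"
  proof (induction rule: half_induct)
    case (step a b)
    then show ?case
      using half_leave[of a b x y] assms(3) by blast
  qed (rule assms(2))
qed

lemma adj_irrefl: "\<not> adj x x"
  using half_other half_self by blast

end

locale tree_act = group_act G V act + bridge_tree V adj
  for G (structure) and V :: "'v set" and act and adj +
  assumes act_adj: "g \<in> carrier G \<Longrightarrow> adj x y \<Longrightarrow> adj (act g x) (act g y)"
    and no_inversion: "g \<in> carrier G \<Longrightarrow> adj x y \<Longrightarrow> act g x = y \<Longrightarrow> act g y \<noteq> x"
begin

lemma act_half:
  assumes "g \<in> carrier G" "adj x y" "z \<in> half x y"
  shows "act g z \<in> half (act g x) (act g y)"
  using assms(3)
proof (induction rule: half_induct)
  case (step a b)
  have "a \<in> V" "b \<in> V" "x \<in> V" "y \<in> V"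
    using step.hyps(2) assms(2) adj_V by blast+
  then have "(act g a, act g b) \<noteq> (act g x, act g y)"
    using step assms(1) by (simp add: act_eq_iff)
  then show ?case
    using half_leave act_adj[OF assms(1) step.hyps(2)] step.IH by blast
qed simp

text \<open>Fixed-point sets are convex: if \<open>g\<close> moved \<open>y\<close>, the half-trees
  behind \<open>y\<close> and behind its image would be disjoint, although both contain the fixed
  point \<open>z\<close>.\<close>

lemma fix_edge_if_fix_sides:
  assumes g: "g \<in> carrier G" and xy: "adj x y" and fix_x: "act g x = x"
    and z: "z \<in> V" "z \<notin> half x y" "act g z = z"
  shows "act g y = y"
proof (rule ccontr)
  assume ne: "act g y \<noteq> y"
  have xy': "adj x (act g y)"
    using act_adj[OF g xy] fix_x by simp
  have "act g y \<in> half x y"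
    using half_leave[OF xy' half_self, of y] ne by auto
  moreover have "x \<notin> half (act g y) x"
    by (rule half_other[OF adj_sym[OF xy']])
  ultimately have sub: "half (act g y) x \<subseteq> half x y"
    using half_subset[OF xy] by blast
  have "z \<in> half y x"
    using half_cover[OF xy z(1)] z(2) by blast
  then have "z \<in> half (act g y) x"
    using act_half[OF g adj_sym[OF xy]] fix_x z(3) by metis
  then show False
    using sub z(2) by blast
qed

end

subsection \<open>Free actions\<close>

locale free_tree_act = tree_act G V act adj
  for G (structure) and V :: "'v set" and act and adj +
  assumes free: "g \<in> carrier G \<Longrightarrow> x \<in> V \<Longrightarrow> act g x = x \<Longrightarrow> g = \<one>"
    and V_nonempty: "V \<noteq> {}"
begin

definition conn :: "'v set \<Rightarrow> 'v \<Rightarrow> 'v \<Rightarrow> bool"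
  where "conn D = (\<lambda>a b. adj a b \<and> a \<in> D \<and> b \<in> D)\<^sup>*\<^sup>*"

lemma conn_mono: "conn D x y \<Longrightarrow> D \<subseteq> D' \<Longrightarrow> conn D' x y"
  unfolding conn_def by (erule rtranclp_mono[THEN predicate2D, rotated]) auto

text \<open>Zorn's lemma gives a maximal connected set \<open>D\<close> that meets every orbit at
  most once. If its translates missed a vertex, some edge would lead from a translate to a missed
  vertex; carried back to \<open>D\<close>, the end of this edge could be added to
  \<open>D\<close>.\<close>

lemma ex_fundamental_tree:
  "\<exists>x0 D. x0 \<in> D \<and> D \<subseteq> V \<and> (\<forall>d\<in>D. conn D x0 d) \<and>
    (\<forall>d\<in>D. \<forall>k\<in>carrier G. act k d \<in> D \<longrightarrow> act k d = d) \<and>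
    (\<forall>z\<in>V. \<exists>k\<in>carrier G. \<exists>d\<in>D. z = act k d)"
proof -
  obtain x0 where x0: "x0 \<in> V"
    using V_nonempty by blast
  define \<D> where "\<D> = {D. x0 \<in> D \<and> D \<subseteq> V \<and> (\<forall>d\<in>D. conn D x0 d) \<and>
    (\<forall>d\<in>D. \<forall>k\<in>carrier G. act k d \<in> D \<longrightarrow> act k d = d)}"
  have "\<exists>M\<in>\<D>. \<forall>D\<in>\<D>. M \<subseteq> D \<longrightarrow> D = M"
  proof (rule subset_Zorn_nonempty)
    have "{x0} \<in> \<D>"
      using x0 by (auto simp: \<D>_def conn_def)
    then show "\<D> \<noteq> {}"
      by blast
    fix C assume C: "C \<noteq> {}" "subset.chain \<D> C"
    have sub: "D \<in> \<D>" if "D \<in> C" for D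
      using C(2) that by (auto simp: subset.chain_def)
    have "conn (\<Union>C) x0 d" if "d \<in> D" "D \<in> C" for d D
      using sub[OF that(2)] that by (auto simp: \<D>_def intro: conn_mono)
    moreover have "act k d = d" if d: "d \<in> D" "D \<in> C" and k: "k \<in> carrier G" "act k d \<in> D'" "D' \<in> C" for d D k D'
    proof -
      have "D \<subseteq> D' \<or> D' \<subseteq> D"
        using C(2) d(2) k(3) by (auto simp: subset.chain_def)
      then show ?thesis
        using sub[OF d(2)] sub[OF k(3)] d k by (auto simp: \<D>_def)
    qed
    moreover have "x0 \<in> \<Union>C" "\<Union>C \<subseteq> V"
      using C(1) sub unfolding \<D>_def by blast+
    ultimately show "\<Union>C \<in> \<D>"
      unfolding \<D>_def by blast
  qed
  then obtain D where D: "D \<in> \<D>" and D_max: "\<And>D'. D' \<in> \<D> \<Longrightarrow> D \<subseteq> D' \<Longrightarrow> D' = D"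
    by blast
  have D': "x0 \<in> D" "D \<subseteq> V" "\<And>d. d \<in> D \<Longrightarrow> conn D x0 d"
    "\<And>d k. d \<in> D \<Longrightarrow> k \<in> carrier G \<Longrightarrow> act k d \<in> D \<Longrightarrow> act k d = d"
    using D by (auto simp: \<D>_def)
  have "\<exists>k\<in>carrier G. \<exists>d\<in>D. z = act k d" if z: "z \<in> V" for z
  proof -
    have "adj\<^sup>*\<^sup>* x0 z"
      using connected x0 z by blast
    then show ?thesis
    proof (induction rule: rtranclp_induct)
      case base
      then show ?case
        using D' x0 by (intro bexI[of _ \<one>] bexI[of _ x0]) auto
    next
      case (step a b)
      obtain k d where kd: "k \<in> carrier G" "d \<in> D" "a = act k d"
        using step.IH by blast
      define b' where "b' = act (inv k) b"
      have V: "a \<in> V" "b \<in> V" "d \<in> V"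
        using step(2) adj_V kd D' by auto
      have db: "adj d b'"
        using act_adj[OF inv_closed[OF kd(1)] step(2)] kd V by (simp add: b'_def)
      have b: "b = act k b'" "b' \<in> V"
        using V kd by (auto simp: b'_def)
      show ?case
      proof (rule ccontr)
        assume "\<not> ?case"
        then have no: "b \<noteq> act j d" if "j \<in> carrier G" "d \<in> D" for j d
          using that by blast
        have no': "act j d \<noteq> b'" if "j \<in> carrier G" "d \<in> D" for j d
          using no[of "k \<otimes> j" d] that kd b D' by (auto simp: act_mult)
        have c1: "conn (insert b' D) x0 e" if "e \<in> D" for e
          using D'(3)[OF that] by (rule conn_mono) auto
        from this[OF kd(2)] have c2: "conn (insert b' D) x0 b'"
          using db kd(2) unfolding conn_def by (auto intro: rtranclp.rtrancl_into_rtrancl)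
        have a1: "act j b' = b'" if "j \<in> carrier G" "act j b' \<in> insert b' D" for j
          using that no'[of "inv j" "act j b'"] b(2) by auto
        have a2: "act j e = e" if "j \<in> carrier G" "e \<in> D" "act j e \<in> insert b' D" for j e
          using that no' D'(4) by auto
        have "\<forall>e\<in>insert b' D. conn (insert b' D) x0 e"
        proof
          fix e assume "e \<in> insert b' D"
          then show "conn (insert b' D) x0 e"
            using c1[of e] c2 by (cases "e = b'") simp_all
        qed
        moreover have "\<forall>e\<in>insert b' D. \<forall>j\<in>carrier G. act j e \<in> insert b' D \<longrightarrow> act j e = e"
        proof (intro ballI impI)
          fix e j assume e: "e \<in> insert b' D" and j: "j \<in> carrier G" "act j e \<in> insert b' D"
          show "act j e = e"
          proof (cases "e = b'")
            case True
            show ?thesis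
              using a1[OF j[unfolded True]] by (simp only: True)
          next
            case False
            then have "e \<in> D"
              using e by blast
            then show ?thesis
              by (rule a2[OF j(1) _ j(2)])
          qed
        qed
        moreover have "x0 \<in> insert b' D" "insert b' D \<subseteq> V"
          using D'(1,2) b(2) by simp_all
        ultimately have "insert b' D \<in> \<D>"
          by (simp only: \<D>_def mem_Collect_eq)
        then have "b' \<in> D"
          using D_max[of "insert b' D"] by blast
        then have "act \<one> b' \<noteq> b'"
          by (rule no'[OF one_closed])
        then show False
          using b(2) by simp
      qed
    qed
  qed
  then show ?thesis
    using D' by (intro exI[of _ x0] exI[of _ D] conjI ballI impI) simp_all
qed

text \<open>For a fundamental subtree \<open>D\<close> let \<open>S\<close> be the set of \<open>k \<noteq> 1\<close> for which \<open>k D\<close> is adjacent to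
  \<open>D\<close>, and \<open>Y k\<close> the half-tree behind the edge that joins \<open>D\<close> to \<open>k D\<close>.  The sets \<open>Y k\<close> are
  pairwise disjoint and \<open>k\<close> maps the complement of \<open>Y (inv k)\<close> into \<open>Y k\<close>: by ping-pong, one
  generator from each pair \<open>{k, inv k}\<close> gives a basis.\<close>

theorem is_free: "is_free G"
proof -
  obtain x0 D where x0: "x0 \<in> D" and DV: "D \<subseteq> V" and D_conn: "\<And>d. d \<in> D \<Longrightarrow> conn D x0 d"
    and D_inj: "\<And>d k. d \<in> D \<Longrightarrow> k \<in> carrier G \<Longrightarrow> act k d \<in> D \<Longrightarrow> act k d = d"
    and D_cover: "\<And>z. z \<in> V \<Longrightarrow> \<exists>k\<in>carrier G. \<exists>d\<in>D. z = act k d"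
    using ex_fundamental_tree by auto
  have D_V: "d \<in> V" if "d \<in> D" for d
    using DV that by blast
  have D_one: "k = \<one>" if "d \<in> D" "k \<in> carrier G" "act k d \<in> D" for d k
    using free[OF that(2)] D_inj[OF that] DV that(1) by blast
  have D_eq: "k = l" if "d \<in> D" "d' \<in> D" "k \<in> carrier G" "l \<in> carrier G" "act k d = act l d'" for d d' k l
  proof -
    have "act (inv l \<otimes> k) d = d'"
      using that D_V by (auto simp: act_mult)
    then have "inv l \<otimes> k = \<one>"
      using D_one[of d "inv l \<otimes> k"] that by simp
    then show ?thesis
      using that by (metis inv_closed inv_equality inv_inv)
  qed
  \<comment> \<open>A property that passes along edges inside \<open>D\<close> holds on all of
    \<open>D\<close> once it holds somewhere, because \<open>D\<close> is connected. It places
    \<open>D\<close> and its translates on one side of an edge.\<close>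
  have D_spread: "d' \<in> Y" if "d \<in> D" "d' \<in> D" "d \<in> Y"
    and step: "\<And>a b. a \<in> D \<Longrightarrow> b \<in> D \<Longrightarrow> adj a b \<Longrightarrow> a \<in> Y \<Longrightarrow> b \<in> Y" for d d' Y
  proof -
    have "x0 \<in> Y \<longleftrightarrow> e \<in> Y" if "e \<in> D" for e
      using D_conn[OF that] unfolding conn_def
      by (induction rule: rtranclp_induct) (use step adj_sym in blast)+
    then show ?thesis
      using that by blast
  qed
  define S where "S = {k \<in> carrier G. k \<noteq> \<one> \<and> (\<exists>d\<in>D. \<exists>d'\<in>D. adj d (act k d'))}"
  have S_closed: "k \<in> carrier G" "k \<noteq> \<one>" if "k \<in> S" for k
    using that by (auto simp: S_def)
  have "\<forall>k\<in>S. \<exists>e. fst e \<in> D \<and> snd e \<in> D \<and> adj (fst e) (act k (snd e))"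
    by (auto simp: S_def)
  then obtain e where e: "\<forall>k\<in>S. fst (e k) \<in> D \<and> snd (e k) \<in> D \<and> adj (fst (e k)) (act k (snd (e k)))"
    by (rule bchoice[THEN exE])
  define p q where "p k = fst (e k)" and "q k = snd (e k)" for k
  have pq: "p k \<in> D \<and> q k \<in> D \<and> adj (p k) (act k (q k))" if "k \<in> S" for k
    using e that by (simp add: p_def q_def)
  define Y where "Y k = half (act k (q k)) (p k)" for k
  have D_Y: "d \<notin> Y k" if k: "k \<in> S" and d: "d \<in> D" for k d
  proof -
    have "d \<in> - Y k"
    proof (rule D_spread[of "p k" d])
      show "p k \<in> - Y k"
        using half_other[OF adj_sym] pq[OF k] by (simp add: Y_def)
      fix a b assume ab: "a \<in> D" "b \<in> D" "adj a b" "a \<in> - Y k"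
      show "b \<in> - Y k"
      proof
        assume "b \<in> Y k"
        then have "b = act k (q k)"
          using half_leave[OF adj_sym[OF ab(3)]] ab(4) by (simp add: Y_def)
        then show False
          using D_one[of "q k" k] pq[OF k] ab(2) S_closed[OF k] by auto
      qed
    qed (use pq[OF k] d in auto)
    then show ?thesis
      by simp
  qed
  have kD_Y: "act k d \<in> Y k" if k: "k \<in> S" and d: "d \<in> D" for k d
  proof -
    have "d \<in> {d. act k d \<in> Y k}"
    proof (rule D_spread[of "q k" d])
      fix a b assume ab: "a \<in> D" "b \<in> D" "adj a b" "a \<in> {d. act k d \<in> Y k}"
      show "b \<in> {d. act k d \<in> Y k}"
      proof (rule ccontr)
        assume "\<not> ?thesis"
        then have "act k b = p k"
          using half_leave[OF act_adj[OF S_closed(1)[OF k] ab(3)]] ab(4) by (simp add: Y_def)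
        then show False
          using D_one[of b k] pq[OF k] ab(2) S_closed[OF k] by auto
      qed
    qed (use pq[OF k] d in \<open>auto simp: Y_def\<close>)
    then show ?thesis
      by simp
  qed
  \<comment> \<open>\<open>D\<close> and \<open>k D\<close> lie on opposite sides of the chosen
    edge, and no other edge crosses.\<close>
  have pq_unique: "d = p k \<and> d' = q k" if k: "k \<in> S" and d: "d \<in> D" "d' \<in> D" "adj d (act k d')" for k d d'
  proof -
    have "act k d' = act k (q k) \<and> d = p k"
      using half_leave[OF adj_sym[OF d(3)]] kD_Y[OF k d(2)] D_Y[OF k d(1)] by (simp add: Y_def)
    then show ?thesis
      using act_eq_iff[OF S_closed(1)[OF k], of d' "q k"] d pq[OF k] DV by blast
  qed
  have inv_edge: "adj (q k) (act (inv k) (p k))" if k: "k \<in> S" for k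
    using act_adj[OF inv_closed[OF S_closed(1)[OF k]] adj_sym, of "p k" "act k (q k)"] pq[OF k] DV S_closed[OF k]
    by auto
  have inv_S: "inv k \<in> S" if k: "k \<in> S" for k
    using inv_edge[OF k] pq[OF k] S_closed[OF k] by (auto simp: S_def)
  have inv_pq: "p (inv k) = q k" "q (inv k) = p k" if k: "k \<in> S" for k
    using pq_unique[OF inv_S[OF k] _ _ inv_edge[OF k]] pq[OF k] by auto
  have ping: "act k z \<in> Y k" if k: "k \<in> S" and z: "z \<in> V" "z \<notin> Y (inv k)" for k z
  proof -
    note e = inv_edge[OF k]
    have "z \<notin> half (act (inv k) (p k)) (q k)"
      using z(2) by (simp add: Y_def inv_pq[OF k])
    then have "z \<in> half (q k) (act (inv k) (p k))"
      using half_cover[OF e z(1)] by blast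
    then have "act k z \<in> half (act k (q k)) (act k (act (inv k) (p k)))"
      using act_half[OF S_closed(1)[OF k] e] by blast
    moreover have "act k (act (inv k) (p k)) = p k"
      using S_closed[OF k] pq[OF k] D_V by auto
    ultimately show ?thesis
      by (simp add: Y_def)
  qed
  have Y_disjoint: "z \<notin> Y k" if k: "k \<in> S" and l: "l \<in> S" and "k \<noteq> l" "z \<in> Y l" for k l z
  proof -
    \<comment> \<open>This vertex is adjacent to \<open>D\<close>, so it could lie in
      \<open>Y k\<close> only as the end of the edge towards \<open>k D\<close>; then the translates
      of \<open>D\<close> by \<open>k\<close> and \<open>l\<close> would meet.\<close>
    have "act l (q l) \<notin> Y k"
    proof
      assume "act l (q l) \<in> Y k"
      then have "act l (q l) = act k (q k)"
        using half_leave[OF adj_sym, of "p l" "act l (q l)"] pq[OF l] D_Y[OF k] by (auto simp: Y_def)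
      then show False
        using D_eq[of "q l" "q k" l k] pq k l S_closed \<open>k \<noteq> l\<close> by auto
    qed
    then have "act l (q l) \<in> half (p k) (act k (q k))"
      using half_cover[of "p k" "act k (q k)" "act l (q l)"] pq[OF k] pq[OF l] adj_V by (auto simp: Y_def)
    then have "half (act l (q l)) (p l) \<subseteq> half (p k) (act k (q k))"
      using half_subset[of "p k" "act k (q k)" "act l (q l)" "p l"] pq[OF k] D_Y[OF l, of "p k"]
      by (simp add: Y_def)
    then show ?thesis
      using half_disjoint[OF adj_sym, of "p k" "act k (q k)" z] pq[OF k] \<open>z \<in> Y l\<close> by (auto simp: Y_def)
  qed
  \<comment> \<open>An involution in \<open>S\<close> would swap the ends of its own edge; this is
    where the absence of inversions enters.\<close>
  have inv_ne: "inv k \<noteq> k" if k: "k \<in> S" for k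
  proof
    assume "inv k = k"
    then have "q k = p k"
      using inv_pq[OF k] by simp
    then have "adj (p k) (act k (p k))" "act k (act k (p k)) = p k"
      using pq[OF k] \<open>inv k = k\<close> S_closed[OF k] D_V act_inv_act[of k "p k"] by auto
    then show False
      using no_inversion[OF S_closed(1)[OF k]] by blast
  qed
  \<comment> \<open>\<open>SOME\<close> evaluates the same predicate for \<open>k\<close> and for
    its inverse, so exactly one of the two is kept.\<close>
  define X where "X = {k \<in> S. k = (SOME t. t = k \<or> t = inv k)}"
  have X_S: "k \<in> S" if "k \<in> X" for k
    using that by (simp add: X_def)
  have X_carr: "X \<subseteq> carrier G"
    using X_S S_closed by blast
  have X_or: "k \<in> X \<or> inv k \<in> X" if k: "k \<in> S" for k
  proof -
    have "(SOME t. t = inv k \<or> t = inv (inv k)) = (SOME t. t = k \<or> t = inv k)"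
      using S_closed[OF k] by (intro arg_cong[where f = Eps]) auto
    moreover have "(SOME t. t = k \<or> t = inv k) = k \<or> (SOME t. t = k \<or> t = inv k) = inv k"
      by (rule someI[of _ k]) simp
    ultimately show ?thesis
      using k inv_S[OF k] by (auto simp: X_def)
  qed
  have X_not_both: "inv k \<notin> X" if k: "k \<in> X" for k
  proof
    assume "inv k \<in> X"
    have "(SOME t. t = inv k \<or> t = inv (inv k)) = (SOME t. t = k \<or> t = inv k)"
      using S_closed[OF X_S[OF k]] by (intro arg_cong[where f = Eps]) auto
    then show False
      using k \<open>inv k \<in> X\<close> inv_ne[OF X_S[OF k]] by (simp add: X_def)
  qed
  define letter where "letter x b = (if b then x else inv x)" for x and b :: bool
  have letter_S: "letter x b \<in> S" if "x \<in> X" for x b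
    using X_S[OF that] inv_S by (simp add: letter_def)
  have letter_ne: "letter y c \<noteq> inv (letter x b)" if "x \<in> X" "y \<in> X" "x = y \<longrightarrow> b = c" for x y b c
    using that X_not_both X_carr inv_ne[OF X_S]
    by (auto simp: letter_def subset_iff split: if_splits) (metis inv_inv)+
  let ?eval = "word_eval G (\<lambda>x. x)"
  have id_X: "(\<lambda>x. x) \<in> X \<rightarrow> carrier G"
    using X_carr by auto
  \<comment> \<open>The first letter decides into which half-tree a reduced word carries
    \<open>x0\<close>. As \<open>D\<close> avoids all these half-trees, no nonempty reduced word
    evaluates to the identity.\<close>
  have pong: "act (?eval ((x, b) # w)) x0 \<in> Y (letter x b)" if "(x, b) # w \<in> words X" "reduced ((x, b) # w)" for x b w
    using that
  proof (induction w arbitrary: x b)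
    case Nil
    then have "letter x b \<in> S" "letter x b \<in> carrier G"
      using letter_S S_closed by auto
    then show ?case
      using kD_Y[OF _ x0, of "letter x b"] by (simp add: letter_def[symmetric])
  next
    case (Cons yc w)
    obtain y c where yc: "yc = (y, c)"
      by force
    have xy: "x \<in> X" "y \<in> X" "x = y \<longrightarrow> b = c" and w: "(y, c) # w \<in> words X" "reduced ((y, c) # w)"
      using Cons.prems by (auto simp: yc reduced_def)
    have ev: "?eval ((y, c) # w) \<in> carrier G"
      using word_eval_closed[OF id_X w(1)] .
    have "act (?eval ((y, c) # w)) x0 \<in> Y (letter y c)"
      by (rule Cons.IH[OF w])
    then have "act (?eval ((y, c) # w)) x0 \<notin> Y (inv (letter x b))"
      using Y_disjoint[OF inv_S[OF letter_S[OF xy(1)]] letter_S[OF xy(2)]] letter_ne[OF xy] by metis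
    then have "act (letter x b) (act (?eval ((y, c) # w)) x0) \<in> Y (letter x b)"
      using ping[OF letter_S[OF xy(1)]] ev x0 D_V by blast
    moreover have "?eval ((x, b) # yc # w) = letter x b \<otimes> ?eval ((y, c) # w)"
      unfolding yc word_eval_Cons[of _ x] letter_def ..
    ultimately show ?case
      using ev S_closed(1)[OF letter_S[OF xy(1)]] x0 D_V by (auto simp: act_mult)
  qed
  obtain h where h: "h \<in> hom (presented_group X {}) G"
    and h_eval: "\<And>w. w \<in> words X \<Longrightarrow> h (wclass X {} w) = ?eval w"
    using presented_group_hom[OF id_X, of "{}"] by auto
  interpret h: group_hom "presented_group X {}" G h
    using h by (simp add: group_hom_def group_hom_axioms_def group_presented_group)
  let ?I = "h ` carrier (presented_group X {})"
  have I: "subgroup ?I G"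
    by (rule h.img_is_subgroup)
  have X_I: "k \<in> ?I" if "k \<in> X" for k
  proof -
    have "h (wclass X {} [(k, True)]) = k"
      using that X_carr by (auto simp: h_eval)
    then show ?thesis
      using that by (metis image_eqI wclass_closed words_Cons words_Nil)
  qed
  have S_I: "k \<in> ?I" if k: "k \<in> S" for k
    using X_or[OF k] X_I[of k] subgroup.m_inv_closed[OF I X_I[of "inv k"]] S_closed[OF k] by auto
  \<comment> \<open>An edge leaving \<open>k D\<close> leads to the translate by \<open>k\<close>
    times an element of \<open>S\<close>, so the translates by the subgroup generated by
    \<open>S\<close> exhaust the tree.\<close>
  have reach: "\<exists>k\<in>?I. \<exists>d\<in>D. z = act k d" if z: "z \<in> V" for z
  proof -
    have "adj\<^sup>*\<^sup>* x0 z"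
      using connected x0 DV z by blast
    then show ?thesis
    proof (induction rule: rtranclp_induct)
      case base
      then show ?case
        using x0 act_one[OF D_V[OF x0]] subgroup.one_closed[OF I] by metis
    next
      case (step a b)
      obtain k d where kd: "k \<in> ?I" "d \<in> D" "a = act k d"
        using step.IH by blast
      then have k: "k \<in> carrier G"
        by (auto intro: h.hom_closed)
      obtain j d' where jd: "j \<in> carrier G" "d' \<in> D" "b = act j d'"
        using D_cover adj_V[OF step(2)] by blast
      define l where "l = inv k \<otimes> j"
      have l: "l \<in> carrier G" "j = k \<otimes> l"
        using k jd by (auto simp: l_def m_assoc[symmetric])
      have "adj (act (inv k) a) (act (inv k) b)"
        using act_adj step(2) k by blast
      moreover have "act (inv k) a = d" "act (inv k) b = act l d'"
        using kd(2,3) jd k D_V by (auto simp: l_def act_mult)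
      ultimately have "l = \<one> \<or> l \<in> S"
        using kd(2) jd(2) l(1) by (auto simp: S_def)
      then have "l \<in> ?I"
        using S_I subgroup.one_closed[OF I] by blast
      then have "j \<in> ?I"
        using l kd(1) subgroup.m_closed[OF I] by blast
      then show ?case
        using jd by blast
    qed
  qed
  have "h \<in> iso (presented_group X {}) G"
    unfolding h.iso_iff
  proof (intro conjI subsetI ballI impI)
    fix g assume g: "g \<in> carrier G"
    obtain k d where kd: "k \<in> ?I" "d \<in> D" "act g x0 = act k d"
      using reach[of "act g x0"] g x0 D_V by blast
    then have "g = k"
      using D_eq[OF x0 kd(2) g _ kd(3)] subgroup.mem_carrier[OF I] by blast
    then show "g \<in> ?I"
      using kd(1) by simp
  next
    fix g assume g: "g \<in> carrier (presented_group X {})" and hg: "h g = \<one>"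
    obtain u where u: "u \<in> words X" "g = wclass X {} u"
      using g by (auto simp: carrier_presented_group)
    obtain w where w: "w \<in> words X" "reduced w" "g = wclass X {} w"
      using u pres_rel_reduced[OF u(1), of "{}"] wclass_eq_iff by metis
    have "w = []"
    proof (rule ccontr)
      assume "w \<noteq> []"
      then obtain x b w' where w': "w = (x, b) # w'"
        by (metis list.exhaust surj_pair)
      have "?eval w = \<one>"
        using hg w h_eval by simp
      then have "x0 \<in> Y (letter x b)"
        using pong[of x b w'] w w' x0 D_V act_one by fastforce
      then show False
        using D_Y[OF letter_S x0] w w' by auto
    qed
    then show "g = \<one>\<^bsub>presented_group X {}\<^esub>"
      using w by (simp add: one_presented_group)
  qed
  then have "presented_group X {} \<cong> G"
    by (rule is_isoI)
  then have "G \<cong> free_group X"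
    unfolding free_group_def by (rule group.iso_sym[OF group_presented_group])
  then show ?thesis
    by (auto simp: is_free_def)
qed

end

subsection \<open>Residually finite groups acting on trees with abelian stabilizers\<close>

lemma (in group_act) finite_orbit_period:
  assumes g: "g \<in> carrier G" and s: "s \<in> \<Omega>" and fin: "finite (range (\<lambda>k::nat. act (g [^] k) s))"
  shows "\<exists>k::nat. k > 0 \<and> act (g [^] k) s = s"
proof -
  have "\<not> inj (\<lambda>k::nat. act (g [^] k) s)"
    using fin infinite_UNIV_nat finite_imageD by blast
  then obtain i j :: nat where ij: "i < j" "act (g [^] i) s = act (g [^] j) s"
    by (auto simp: inj_def) (metis linorder_neqE_nat)
  have "g [^] j = g [^] i \<otimes> g [^] (j - i)"
    using ij(1) g by (simp add: nat_pow_mult)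
  then have "act (g [^] i) s = act (g [^] i) (act (g [^] (j - i)) s)"
    using ij(2) g s by (simp add: act_mult)
  then have "act (g [^] (j - i)) s = s"
    using g s by (simp add: act_eq_iff)
  then show ?thesis
    using ij(1) by (intro exI[of _ "j - i"]) simp
qed

text \<open>\<open>finite_stab_orbit\<close> says that the stabilizers of \<open>x\<close> and
  \<open>y\<close> meet in a subgroup of finite index in the first, that is, all stabilizers are
  commensurable. \<open>R\<close> and \<open>W\<close> represent the orbits of oriented edges and of
  vertices; the size of \<open>W\<close> measures progress under contraction.\<close>

locale commensurable_tree_act = tree_act G V act adj
  for G (structure) and V :: "'v set" and act and adj +
  fixes R :: "('v \<times> 'v) set" and W :: "'v set"
  assumes stab_commute: "x \<in> V \<Longrightarrow> g \<in> fixer x \<Longrightarrow> h \<in> fixer x \<Longrightarrow> g \<otimes> h = h \<otimes> g"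
    and finite_stab_orbit: "x \<in> V \<Longrightarrow> y \<in> V \<Longrightarrow> finite ((\<lambda>g. act g y) ` fixer x)"
    and V_nonempty: "V \<noteq> {}"
    and finite_R: "finite R"
    and R_edges: "(a, b) \<in> R \<Longrightarrow> adj a b"
    and R_cover: "adj x y \<Longrightarrow> \<exists>g\<in>carrier G. \<exists>(a, b)\<in>R. x = act g a \<and> y = act g b"
    and finite_W: "finite W"
    and W_V: "W \<subseteq> V"
    and W_cover: "x \<in> V \<Longrightarrow> \<exists>g\<in>carrier G. \<exists>a\<in>W. x = act g a"

section \<open>Contraction of edge orbits\<close>

definition (in commensurable_tree_act) tree_reduced :: bool
  where "tree_reduced \<longleftrightarrow> (\<forall>v u. adj v u \<longrightarrow> fixer v \<subseteq> fixer u \<longrightarrow> (\<exists>g\<in>carrier G. u = act g v))"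

context tree_act
begin

lemma fixer_carrier: "g \<in> fixer x \<Longrightarrow> g \<in> carrier G"
  by (simp add: fixer_def)

lemma fixer_act_subset_iff:
  assumes "g \<in> carrier G" "x \<in> V" "y \<in> V"
  shows "fixer (act g x) \<subseteq> fixer (act g y) \<longleftrightarrow> fixer x \<subseteq> fixer y"
proof -
  have sub: "fixer (act h a) \<subseteq> fixer (act h b)"
    if "h \<in> carrier G" "a \<in> V" "b \<in> V" "fixer a \<subseteq> fixer b" for h a b
    using that by (auto simp: fixer_conj)
  show ?thesis
    using sub[of g x y] sub[of "inv g" "act g x" "act g y"] assms by auto
qed

end

context commensurable_tree_act
begin

text \<open>The edges in the orbit of \<open>(v, u)\<close> are contracted; a bridge that survives keeps the same
  half-trees.\<close>

lemma contract_edge_orbit: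
  assumes vu: "adj v u" and sub: "fixer v \<subseteq> fixer u" and no: "\<not> (\<exists>g\<in>carrier G. u = act g v)"
  shows "\<exists>V' adj' R' W'. commensurable_tree_act G V' act adj' R' W' \<and> V' \<subseteq> V \<and> card W' < card W"
proof -
  have uv: "u \<in> V" "v \<in> V"
    using adj_V[OF vu] by auto
  define Orb where "Orb = (\<lambda>g. act g v) ` carrier G"
  have Orb_act: "act g x \<in> Orb \<longleftrightarrow> x \<in> Orb" if "g \<in> carrier G" "x \<in> V" for g x
  proof
    assume "act g x \<in> Orb"
    then obtain h where "h \<in> carrier G" "act g x = act h v"
      by (auto simp: Orb_def)
    then have "x = act (inv g \<otimes> h) v"
      using that uv by (simp add: act_mult) (metis act_inv_act)
    then show "x \<in> Orb"
      using that \<open>h \<in> carrier G\<close> by (auto simp: Orb_def)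
  next
    assume "x \<in> Orb"
    then show "act g x \<in> Orb"
      using that uv by (auto simp: Orb_def act_mult[symmetric])
  qed
  have u_Orb: "act g u \<notin> Orb" if "g \<in> carrier G" for g
    using no Orb_act[OF that uv(1)] by (auto simp: Orb_def)
  \<comment> \<open>Each translate of \<open>v\<close> slides along its edge to the corresponding
    translate of \<open>u\<close>. The choice of the translating element does not matter because the
    stabilizer of \<open>v\<close> fixes \<open>u\<close>.\<close>
  define \<rho> where "\<rho> z = (if z \<in> Orb then act (SOME g. g \<in> carrier G \<and> z = act g v) u else z)" for z
  have \<rho>_v: "\<rho> (act g v) = act g u" if g: "g \<in> carrier G" for g
  proof -
    let ?h = "SOME h. h \<in> carrier G \<and> act g v = act h v"
    have h: "?h \<in> carrier G \<and> act g v = act ?h v"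
      by (rule someI[of _ g]) (use g in simp)
    then have "act (inv g \<otimes> ?h) v = v"
      using g uv by (metis act_inv_act act_mult inv_closed)
    then have "inv g \<otimes> ?h \<in> fixer v"
      using g h by (simp add: fixer_def)
    then have "inv g \<otimes> ?h \<in> fixer u"
      using sub by blast
    then have "act g (act (inv g) (act ?h u)) = act g u"
      using g h uv by (simp add: fixer_def act_mult)
    then have "act ?h u = act g u"
      using g h uv by simp
    then show ?thesis
      using g by (auto simp: \<rho>_def Orb_def)
  qed
  have \<rho>_id: "\<rho> z = z" if "z \<notin> Orb" for z
    using that by (simp add: \<rho>_def)
  have \<rho>_V: "\<rho> z \<in> V - Orb" if "z \<in> V" for z
  proof (cases "z \<in> Orb")
    case True
    then obtain g where "g \<in> carrier G" "z = act g v"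
      by (auto simp: Orb_def)
    then show ?thesis
      using \<rho>_v u_Orb uv by simp
  qed (use that \<rho>_id in simp)
  have \<rho>_act: "\<rho> (act g z) = act g (\<rho> z)" if "g \<in> carrier G" "z \<in> V" for g z
  proof (cases "z \<in> Orb")
    case True
    then obtain h where h: "h \<in> carrier G" "z = act h v"
      by (auto simp: Orb_def)
    then have "act g z = act (g \<otimes> h) v"
      using that uv by (simp add: act_mult)
    then have "\<rho> (act g z) = act (g \<otimes> h) u"
      using \<rho>_v that h by simp
    then show ?thesis
      using \<rho>_v h that uv by (simp add: act_mult)
  next
    case False
    then show ?thesis
      using Orb_act that \<rho>_id by simp
  qed
  define V' where "V' = V - Orb"
  define adj' where "adj' x y \<longleftrightarrow> x \<noteq> y \<and> (\<exists>a b. adj a b \<and> \<rho> a = x \<and> \<rho> b = y)" for x y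
  define R' where "R' = {(\<rho> a, \<rho> b) | a b. (a, b) \<in> R \<and> \<rho> a \<noteq> \<rho> b}"
  \<comment> \<open>A contracted edge joins a vertex to its image under \<rho>. It cannot be the
    edge between \<open>x0\<close> and \<open>y0\<close>, whose ends have different images, so it
    does not cross \<open>Y\<close>.\<close>
  have cert: "z \<in> Y \<longleftrightarrow> \<rho> z \<in> Y"
    if Y: "\<And>a b. adj a b \<Longrightarrow> a \<in> Y \<Longrightarrow> b \<notin> Y \<Longrightarrow> a = x0 \<and> b = y0" and ne: "\<rho> x0 \<noteq> \<rho> y0"
    for z Y x0 y0
  proof (cases "z \<in> Orb")
    case True
    then obtain g where g: "g \<in> carrier G" "z = act g v"
      by (auto simp: Orb_def)
    have e: "adj z (act g u)" "\<rho> z = act g u" "\<rho> (act g u) = act g u"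
      using act_adj[OF g(1) vu] \<rho>_v[OF g(1)] \<rho>_id[OF u_Orb[OF g(1)]] g by auto
    show ?thesis
      using Y[OF e(1)] Y[OF adj_sym[OF e(1)]] e ne by metis
  qed (simp add: \<rho>_id)
  have "commensurable_tree_act G V' act adj' R' (W - Orb)"
  proof unfold_locales
    fix g s assume "g \<in> carrier G" "s \<in> V'"
    then show "act g s \<in> V'"
      using Orb_act by (auto simp: V'_def)
  next
    fix s assume "s \<in> V'"
    then show "act \<one> s = s"
      by (simp add: V'_def)
  next
    fix g h s assume "g \<in> carrier G" "h \<in> carrier G" "s \<in> V'"
    then show "act (g \<otimes> h) s = act g (act h s)"
      by (simp add: V'_def act_mult)
  next
    fix x y assume "adj' x y"
    then show "x \<in> V' \<and> y \<in> V'"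
      using \<rho>_V adj_V by (auto simp: adj'_def V'_def)
  next
    fix x y assume "adj' x y"
    then show "adj' y x"
      using adj_sym by (auto simp: adj'_def)
  next
    fix x y assume xy: "x \<in> V'" "y \<in> V'"
    then have "adj\<^sup>*\<^sup>* x y"
      using connected by (simp add: V'_def)
    then have "adj'\<^sup>*\<^sup>* (\<rho> x) (\<rho> y)"
    proof (induction rule: rtranclp_induct)
      case (step a b)
      have "\<rho> a = \<rho> b \<or> adj' (\<rho> a) (\<rho> b)"
        using step(2) by (auto simp: adj'_def)
      then show ?case
        using step.IH by (auto intro: rtranclp.rtrancl_into_rtrancl)
    qed simp
    then show "adj'\<^sup>*\<^sup>* x y"
      using xy \<rho>_id by (simp add: V'_def)
  next
    fix x y assume "adj' x y"
    then obtain x0 y0 where e: "adj x0 y0" "\<rho> x0 = x" "\<rho> y0 = y" "x \<noteq> y"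
      by (auto simp: adj'_def)
    obtain Y where Y: "x0 \<in> Y" "y0 \<notin> Y"
      "\<And>a b. adj a b \<Longrightarrow> a \<in> Y \<Longrightarrow> b \<notin> Y \<Longrightarrow> a = x0 \<and> b = y0"
      using bridge[OF e(1)] by blast
    note c = cert[of Y x0 y0, OF Y(3)]
    have c': "z \<in> Y \<longleftrightarrow> \<rho> z \<in> Y" for z
      using c e by blast
    have "x \<in> Y" "y \<notin> Y"
      using c'[of x0] c'[of y0] Y(1,2) e(2,3) by simp_all
    moreover have "a = x \<and> b = y" if ab: "adj' a b" "a \<in> Y" "b \<notin> Y" for a b
    proof -
      obtain a0 b0 where a0: "adj a0 b0" "\<rho> a0 = a" "\<rho> b0 = b"
        using ab(1) by (auto simp: adj'_def)
      then have "a0 = x0 \<and> b0 = y0"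
        using Y(3)[OF a0(1)] c'[of a0] c'[of b0] ab by simp
      then show ?thesis
        using a0 e by simp
    qed
    ultimately show "\<exists>Y. x \<in> Y \<and> y \<notin> Y \<and> (\<forall>a b. adj' a b \<longrightarrow> a \<in> Y \<longrightarrow> b \<notin> Y \<longrightarrow> a = x \<and> b = y)"
      by blast
  next
    fix g x y assume g: "g \<in> carrier G" and "adj' x y"
    then obtain a b where ab: "adj a b" "\<rho> a = x" "\<rho> b = y" "x \<noteq> y"
      by (auto simp: adj'_def)
    moreover have "x \<in> V" "y \<in> V"
      using \<rho>_V[of a] \<rho>_V[of b] adj_V[OF ab(1)] ab by auto
    ultimately have "adj (act g a) (act g b)" "\<rho> (act g a) = act g x" "\<rho> (act g b) = act g y" "act g x \<noteq> act g y"
      using act_adj[OF g, of a b] \<rho>_act[OF g] adj_V[of a b] act_eq_iff[OF g, of x y] by simp_all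
    then show "adj' (act g x) (act g y)"
      unfolding adj'_def by blast
  next
    fix g x y assume g: "g \<in> carrier G" and "adj' x y" and gx: "act g x = y"
    then obtain x0 y0 where e: "adj x0 y0" "\<rho> x0 = x" "\<rho> y0 = y" "x \<noteq> y"
      by (auto simp: adj'_def)
    obtain Y where Y: "x0 \<in> Y" "y0 \<notin> Y"
      "\<And>a b. adj a b \<Longrightarrow> a \<in> Y \<Longrightarrow> b \<notin> Y \<Longrightarrow> a = x0 \<and> b = y0"
      using bridge[OF e(1)] by blast
    note c = cert[of Y x0 y0, OF Y(3)]
    have c': "z \<in> Y \<longleftrightarrow> \<rho> z \<in> Y" for z
      using c e by blast
    show "act g y \<noteq> x"
    proof
      assume gy: "act g y = x"
      have "x0 \<in> V" "y0 \<in> V"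
        using adj_V e(1) by auto
      then have "\<rho> (act g y0) = x" "\<rho> (act g x0) = y"
        using \<rho>_act[OF g] e gx gy by auto
      \<comment> \<open>An inversion after contraction exchanges the two sides of the cut, and only
        one original edge crosses it; so that edge would already be inverted.\<close>
      then have "act g y0 \<in> Y" "act g x0 \<notin> Y"
        using c'[of "act g y0"] c'[of "act g x0"] c'[of x0] c'[of y0] Y(1,2) e(2,3) by simp_all
      then have "act g y0 = x0 \<and> act g x0 = y0"
        using Y(3)[OF adj_sym[OF act_adj[OF g e(1)]]] by blast
      then show False
        using no_inversion[OF g e(1)] by blast
    qed
  next
    fix x g h
    interpret A: group_act G V' act
      by unfold_locales (use Orb_act in \<open>auto simp: V'_def act_mult\<close>)
    assume "x \<in> V'" "g \<in> group_act.fixer G act x" "h \<in> group_act.fixer G act x"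
    then show "g \<otimes> h = h \<otimes> g"
      using stab_commute[of x g h] by (simp add: A.fixer_def fixer_def V'_def)
  next
    fix x y
    interpret A: group_act G V' act
      by unfold_locales (use Orb_act in \<open>auto simp: V'_def act_mult\<close>)
    assume "x \<in> V'" "y \<in> V'"
    then show "finite ((\<lambda>g. act g y) ` group_act.fixer G act x)"
      using finite_stab_orbit[of x y] by (simp add: A.fixer_def fixer_def V'_def)
  next
    show "V' \<noteq> {}"
      using \<rho>_V[OF uv(1)] by (auto simp: V'_def)
  next
    have "R' \<subseteq> (\<lambda>(a, b). (\<rho> a, \<rho> b)) ` R"
      by (auto simp: R'_def)
    then show "finite R'"
      using finite_R finite_surj by blast
  next
    fix a b assume "(a, b) \<in> R'"
    then show "adj' a b"
      using R_edges by (auto simp: R'_def adj'_def)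
  next
    fix x y assume "adj' x y"
    then obtain x0 y0 where e: "adj x0 y0" "\<rho> x0 = x" "\<rho> y0 = y" "x \<noteq> y"
      by (auto simp: adj'_def)
    obtain g a b where g: "g \<in> carrier G" "(a, b) \<in> R" "x0 = act g a" "y0 = act g b"
      using R_cover[OF e(1)] by blast
    have "a \<in> V" "b \<in> V"
      using R_edges[OF g(2)] adj_V by auto
    then have "x = act g (\<rho> a)" "y = act g (\<rho> b)"
      using \<rho>_act[OF g(1)] e g by auto
    moreover have "(\<rho> a, \<rho> b) \<in> R'"
    proof -
      have "\<rho> a \<noteq> \<rho> b"
        using calculation e(4) by auto
      then show ?thesis
        using g(2) unfolding R'_def by blast
    qed
    ultimately show "\<exists>g\<in>carrier G. \<exists>(a, b)\<in>R'. x = act g a \<and> y = act g b"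
      using g(1) by blast
  next
    show "finite (W - Orb)"
      using finite_W by simp
    show "W - Orb \<subseteq> V'"
      using W_V by (auto simp: V'_def)
    fix x assume "x \<in> V'"
    then show "\<exists>g\<in>carrier G. \<exists>a\<in>W - Orb. x = act g a"
      using W_cover[of x] Orb_act W_V unfolding V'_def by blast
  qed
  \<comment> \<open>\<open>W\<close> contains a representative of the orbit of \<open>v\<close>, and
    it disappears.\<close>
  moreover have "card (W - Orb) < card W"
  proof -
    obtain g w where "g \<in> carrier G" "w \<in> W" "v = act g w"
      using W_cover[OF uv(2)] by blast
    moreover have "v \<in> Orb"
      unfolding Orb_def using uv(2) by (intro image_eqI[of _ _ \<one>]) auto
    ultimately have "w \<in> W \<inter> Orb"
      using Orb_act[of g w] W_V by auto
    then show ?thesis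
      using finite_W by (intro psubset_card_mono) auto
  qed
  moreover have "V' \<subseteq> V"
    by (auto simp: V'_def)
  ultimately show ?thesis
    by blast
qed

end

text \<open>Every contraction loses a vertex representative, so the process stops. The action is
  merely restricted to fewer vertices, which leaves their stabilizers unchanged.\<close>

lemma ex_reduced_tree:
  assumes "commensurable_tree_act G V act adj R W"
  shows "\<exists>V' adj' R' W'. commensurable_tree_act G V' act adj' R' W' \<and> V' \<subseteq> V \<and>
    commensurable_tree_act.tree_reduced G act adj'"
  using assms
proof (induction "card W" arbitrary: V adj R W rule: less_induct)
  case less
  interpret commensurable_tree_act G V act adj R W
    by fact
  show ?case
  proof (cases tree_reduced)
    case True
    then show ?thesis
      using less.prems by blast
  next
    case False
    then obtain v u where "adj v u" "fixer v \<subseteq> fixer u" "\<not> (\<exists>g\<in>carrier G. u = act g v)"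
      by (auto simp: tree_reduced_def)
    then obtain V' adj' R' W' where "commensurable_tree_act G V' act adj' R' W'" "V' \<subseteq> V" "card W' < card W"
      using contract_edge_orbit by blast
    then show ?thesis
      using less.hyps[of W' V' adj' R'] by (meson order_trans)
  qed
qed

section \<open>Separation of stabilizers in the profinite topology\<close>

context commensurable_tree_act
begin

text \<open>As \<open>fixer u\<close> and \<open>fixer w\<close> meet in a subgroup of finite index
  in \<open>fixer u\<close>, this says that the intersection is closed, equivalently open, in the
  topology that \<open>fixer u\<close> inherits from the profinite topology of
  \<open>G\<close>.\<close>

definition separated :: "'v \<Rightarrow> 'v \<Rightarrow> bool"
  where "separated u w \<longleftrightarrow> (\<exists>M. M \<lhd> G \<and> finite (rcosets M) \<and> fixer u \<inter> M \<subseteq> fixer w)"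

text \<open>If \<open>x\<close> carried \<open>w\<close> into the half-tree away from
  \<open>u\<close>, it would map this half-tree strictly into itself, and its powers would never
  bring \<open>w\<close> back; but \<open>x\<close> lies in \<open>fixer u\<close>, under which
  \<open>w\<close> has a finite orbit.\<close>

lemma moved_out_of_half:
  assumes ww': "adj w w'" and u: "u \<in> V" "u \<notin> half w w'" and x: "x \<in> fixer u" "act x w \<noteq> w"
  shows "act x w \<notin> half w w'"
proof
  assume xw: "act x w \<in> half w w'"
  have V: "w \<in> V" "w' \<in> V" and xc: "x \<in> carrier G"
    using adj_V[OF ww'] x(1) by (auto simp: fixer_def)
  have e: "adj (act x w) (act x w')"
    by (rule act_adj[OF xc ww'])
  have xw': "act x w' \<in> half w w'"
    using half_leave[OF e xw] x(2) by blast
  have u_other: "u \<in> half (act x w') (act x w)"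
  proof -
    have "u \<in> half w' w"
      using half_cover[OF ww' u(1)] u(2) by blast
    then have "act x u \<in> half (act x w') (act x w)"
      by (rule act_half[OF xc adj_sym[OF ww']])
    then show ?thesis
      using x(1) by (simp add: fixer_def)
  qed
  have w_out: "w \<notin> half (act x w) (act x w')"
  proof
    assume "w \<in> half (act x w) (act x w')"
    then have "w \<notin> half (act x w') (act x w)"
      using half_disjoint[OF adj_sym[OF e]] by blast
    then have "half (act x w') (act x w) \<subseteq> half w w'"
      using half_subset[OF ww' xw'] by blast
    then show False
      using u_other u(2) by blast
  qed
  have sub: "half (act x w) (act x w') \<subseteq> half w w'"
    by (rule half_subset[OF ww' xw w_out])
  have pow: "act (x [^] Suc k) w \<in> half (act x w) (act x w')" for k
  proof (induction k)
    case 0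
    then show ?case
      using xc by simp
  next
    case (Suc k)
    have "act (x [^] Suc (Suc k)) w = act x (act (x [^] Suc k) w)"
      using nat_pow_Suc2[OF xc, of "Suc k"] xc V by (simp add: act_mult del: nat_pow_Suc)
    then show ?case
      using act_half[OF xc ww', of "act (x [^] Suc k) w"] Suc sub by auto
  qed
  have "range (\<lambda>k::nat. act (x [^] k) w) \<subseteq> (\<lambda>g. act g w) ` fixer u"
  proof clarify
    fix k :: nat
    have "x [^] k \<in> fixer u"
      using subgroup_fixer[OF u(1)] x(1) monoid.nat_pow_closed[OF group.is_monoid[OF subgroup_imp_group], of "fixer u" x k]
      by (simp add: nat_pow_consistent[symmetric])
    then show "act (x [^] k) w \<in> (\<lambda>g. act g w) ` fixer u"
      by blast
  qed
  then have "finite (range (\<lambda>k::nat. act (x [^] k) w))"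
    using finite_stab_orbit[OF u(1) V(1)] finite_subset by blast
  then obtain k :: nat where k: "k > 0" "act (x [^] k) w = w"
    using finite_orbit_period[OF xc V(1)] by blast
  then show False
    using pow[of "k - 1"] w_out by simp
qed

text \<open>If \<open>fixer u \<inter> fixer w\<close> is not closed in \<open>fixer u\<close>, residual finiteness yields \<open>x\<close> in
  \<open>fixer u\<close> that moves \<open>w\<close> and commutes with \<open>fixer w\<close>, so that \<open>fixer w\<close> fixes a path from \<open>w\<close>
  to \<open>act x w\<close>.\<close>

lemma separated_if_not_subset:
  assumes rf: "residually_finite G" and ww': "adj w w'" and u: "u \<in> V" "u \<notin> half w w'"
    and nsub: "\<not> fixer w \<subseteq> fixer w'"
  shows "separated u w"
proof -
  have V: "w \<in> V" "w' \<in> V"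
    using adj_V[OF ww'] by auto
  define Orb where "Orb = (\<lambda>g. act g w) ` fixer u - {w}"
  have fin: "finite Orb"
    using finite_stab_orbit[OF u(1) V(1)] by (simp add: Orb_def)
  show ?thesis
  proof (cases "\<forall>p\<in>Orb. \<exists>M. M \<lhd> G \<and> finite (rcosets M) \<and> (\<forall>y\<in>fixer u \<inter> M. act y w \<noteq> p)")
    \<comment> \<open>Each wrong image of \<open>w\<close> is avoided by some \<open>M\<close>; as
      there are finitely many of them, one \<open>M\<close> avoids them all.\<close>
    case True
    have "\<exists>M. M \<lhd> G \<and> finite (rcosets M) \<and> (\<forall>p\<in>Orb. \<forall>y\<in>fixer u \<inter> M. act y w \<noteq> p)"
      by (rule finite_index_normal_family[OF fin]) (use True in auto)
    then obtain M where M: "M \<lhd> G" "finite (rcosets M)" "\<And>p y. p \<in> Orb \<Longrightarrow> y \<in> fixer u \<inter> M \<Longrightarrow> act y w \<noteq> p"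
      by blast
    have "y \<in> fixer w" if y: "y \<in> fixer u \<inter> M" for y
    proof -
      have "act y w = w"
        using M(3)[OF _ y, of "act y w"] y by (auto simp: Orb_def)
      then show ?thesis
        using y by (simp add: fixer_def)
    qed
    then show ?thesis
      unfolding separated_def using M(1,2) by blast
  next
    case False
    then obtain p where p: "p \<in> Orb"
      and dense: "\<And>M. M \<lhd> G \<Longrightarrow> finite (rcosets M) \<Longrightarrow> \<exists>y\<in>fixer u \<inter> M. act y w = p"
      by blast
    obtain x where x: "x \<in> fixer u" "p = act x w" "act x w \<noteq> w"
      using p by (auto simp: Orb_def)
    have xc: "x \<in> carrier G"
      using x(1) by (simp add: fixer_def)
    have "act b w' = w'" if b: "b \<in> fixer w" for b
    proof -
      have bc: "b \<in> carrier G"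
        using b by (simp add: fixer_def)
      \<comment> \<open>Modulo any \<open>M\<close> the element \<open>x\<close> agrees with some
        \<open>c\<close> in \<open>fixer w\<close>, which commutes with \<open>b\<close>; so the
        commutator lies in every \<open>M\<close>.\<close>
      have "x \<otimes> b \<otimes> inv x \<otimes> inv b = \<one>"
      proof (rule ccontr)
        assume "\<not> ?thesis"
        then obtain M where M: "M \<lhd> G" "finite (rcosets M)" "x \<otimes> b \<otimes> inv x \<otimes> inv b \<notin> M"
          using residually_finiteD[OF rf] by blast
        then obtain y where y: "y \<in> fixer u" "y \<in> M" "act y w = p"
          using dense by blast
        have yc: "y \<in> carrier G"
          using y(1) by (simp add: fixer_def)
        define c where "c = inv y \<otimes> x"
        have c: "c \<in> fixer w" "c \<in> carrier G" "x = y \<otimes> c"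
          using xc yc y x V by (auto simp: c_def fixer_def act_mult act_inv_eq_iff m_assoc[symmetric])
        have "x \<otimes> b \<otimes> inv x \<otimes> inv b = y \<otimes> (c \<otimes> b) \<otimes> inv c \<otimes> inv y \<otimes> inv b"
          using c yc bc by (simp add: inv_mult_group m_assoc)
        also have "c \<otimes> b = b \<otimes> c"
          by (rule stab_commute[OF V(1) c(1) b])
        also have "y \<otimes> (b \<otimes> c) \<otimes> inv c \<otimes> inv y \<otimes> inv b = y \<otimes> (b \<otimes> inv y \<otimes> inv b)"
          using c(2) yc bc by (simp add: m_assoc)
        also have "\<dots> \<in> M"
          using y(2) M(1) bc normal.inv_op_closed2[OF M(1) bc, of "inv y"]
          by (simp add: normal_imp_subgroup subgroup.m_closed subgroup.m_inv_closed)
        finally show False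
          using M(3) by simp
      qed
      then have "x \<otimes> b = b \<otimes> x"
        using xc bc by (metis inv_closed inv_mult_group inv_solve_right' l_one m_assoc m_closed)
      then have "act b (act x w) = act x (act b w)"
        using xc bc V by (simp add: act_mult[symmetric])
      then have "act b (act x w) = act x w"
        using b by (simp add: fixer_def)
      \<comment> \<open>\<open>b\<close> fixes \<open>w\<close> and also the vertex
        \<open>act x w\<close> on the side of \<open>w'\<close>, hence the vertex \<open>w'\<close>
        between them.\<close>
      then show ?thesis
        using fix_edge_if_fix_sides[OF bc ww', of "act x w"] b moved_out_of_half[OF ww' u x(1,3)] xc V
        by (simp add: fixer_def)
    qed
    then show ?thesis
      using nsub by (auto simp: fixer_def)
  qed
qed

text \<open>The \<open>ascending\<close> case is shaped for recognizing an HNN extension: a base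
  group, an element conjugating it into itself, no positive power of this element in the base, and
  generation by both.\<close>

lemma dichotomy:
  assumes rf: "residually_finite G" and reduced: tree_reduced
  obtains
    (ascending) v s where "v \<in> V" "s \<in> carrier G" "fixer (act s v) \<subseteq> fixer v"
      "\<And>k::nat. k > 0 \<Longrightarrow> s [^] k \<notin> fixer v" "carrier G = generate G (insert s (fixer v))"
  | (normal) M where "M \<lhd> G" "finite (rcosets M)" "\<And>x y. x \<in> V \<Longrightarrow> y \<in> V \<Longrightarrow> fixer x \<inter> M \<subseteq> fixer y"
proof (cases "\<forall>u v. adj u v \<longrightarrow> separated u v")
  case True
  have "\<exists>M. M \<lhd> G \<and> finite (rcosets M) \<and> (\<forall>e\<in>R. fixer (fst e) \<inter> M \<subseteq> fixer (snd e))"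
    by (rule finite_index_normal_family[OF finite_R]) (use True R_edges in \<open>auto simp: separated_def\<close>)
  then obtain M where M: "M \<lhd> G" "finite (rcosets M)" "\<And>a b. (a, b) \<in> R \<Longrightarrow> fixer a \<inter> M \<subseteq> fixer b"
    by fastforce
  \<comment> \<open>Normality of \<open>M\<close> carries the inclusion from the representatives in
    \<open>R\<close> to all edges.\<close>
  have step: "fixer x \<inter> M \<subseteq> fixer y" if "adj x y" for x y
  proof
    fix h assume h: "h \<in> fixer x \<inter> M"
    obtain g a b where g: "g \<in> carrier G" "(a, b) \<in> R" "x = act g a" "y = act g b"
      using R_cover[OF \<open>adj x y\<close>] by blast
    have ab: "a \<in> V" "b \<in> V"
      using adj_V R_edges[OF g(2)] by auto
    have "inv g \<otimes> h \<otimes> g \<in> fixer a \<inter> M"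
      using h g ab normal.inv_op_closed1[OF M(1)] by (simp add: fixer_conj)
    then have "inv g \<otimes> h \<otimes> g \<in> fixer b"
      using M(3)[OF g(2)] by blast
    then show "h \<in> fixer y"
      using h g ab by (simp add: fixer_conj fixer_carrier)
  qed
  have "fixer x \<inter> M \<subseteq> fixer y" if "x \<in> V" "y \<in> V" for x y
    using connected[OF that]
  proof (induction rule: rtranclp_induct)
    case (step a b)
    then show ?case
      using \<open>adj a b \<Longrightarrow> fixer a \<inter> M \<subseteq> fixer b\<close> by blast
  qed blast
  then show ?thesis
    using normal M by blast
next
  case False
  then obtain u v where uv: "adj u v" and nsep: "\<not> separated u v"
    by blast
  have V: "u \<in> V" "v \<in> V"
    using adj_V[OF uv] by auto
  have vu: "adj v u"
    by (rule adj_sym[OF uv])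
  \<comment> \<open>The separation lemma is applied to the single edge, with \<open>w = v\<close>
    and \<open>w' = u\<close>.\<close>
  have sub: "fixer v \<subseteq> fixer u"
    using separated_if_not_subset[OF rf vu V(1) half_other[OF vu]] nsep by blast
  have nsub: "\<not> fixer u \<subseteq> fixer v"
  proof
    assume "fixer u \<subseteq> fixer v"
    then have "separated u v"
      unfolding separated_def using normal_carrier finite_rcosets_carrier by blast
    then show False
      using nsep by simp
  qed
  obtain t where t: "t \<in> carrier G" "u = act t v"
    using reduced vu sub unfolding tree_reduced_def by blast
  \<comment> \<open>Consider the path \<open>w\<close>, \<open>v\<close>, \<open>u\<close>. If the
    inclusion failed, some \<open>M\<close> would make \<open>fixer u \<inter> M\<close> fix
    \<open>w\<close>, hence also \<open>v\<close> in between, against the choice of the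
    edge.\<close>
  have below: "fixer w \<subseteq> fixer v" if w: "adj w v" "w \<noteq> u" for w
  proof (rule ccontr)
    assume "\<not> fixer w \<subseteq> fixer v"
    have "v \<notin> half w v"
      by (rule half_other[OF w(1)])
    then have u_out: "u \<notin> half w v"
      using half_leave[OF uv] w(2) by blast
    then have "separated u w"
      using separated_if_not_subset[OF rf w(1) V(1)] \<open>\<not> fixer w \<subseteq> fixer v\<close> by blast
    then obtain M where M: "M \<lhd> G" "finite (rcosets M)" "fixer u \<inter> M \<subseteq> fixer w"
      by (auto simp: separated_def)
    have "fixer u \<inter> M \<subseteq> fixer v"
    proof
      fix g assume g: "g \<in> fixer u \<inter> M"
      then have "act g u = u" "act g w = w" "g \<in> carrier G"
        using M(3) by (auto simp: fixer_def)
      then show "g \<in> fixer v"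
        using fix_edge_if_fix_sides[OF _ w(1) _ V(1) u_out] by (simp add: fixer_def)
    qed
    then show False
      using nsep M(1,2) by (auto simp: separated_def)
  qed
  have neighbour: "\<exists>a\<in>fixer v. w = act a (act (inv t) v)" if w: "adj w v" "w \<noteq> u" for w
  proof -
    have wV: "w \<in> V"
      using adj_V[OF w(1)] by simp
    obtain g where "g \<in> carrier G" "v = act g w"
      using reduced w(1) below[OF w] unfolding tree_reduced_def by blast
    then obtain h where h: "h \<in> carrier G" "w = act h v"
      using wV by (metis act_inv_act inv_closed)
    \<comment> \<open>Consider the path \<open>act h u\<close>, \<open>w\<close>, \<open>v\<close>,
      \<open>u\<close>. Its first vertex would be separated from \<open>u\<close>, so
      \<open>fixer u \<inter> M\<close> would fix \<open>w\<close> for some \<open>M\<close>, and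
      then \<open>v\<close> by \<open>below\<close>.\<close>
    have nle: "\<not> fixer v \<subseteq> fixer w"
    proof
      assume le: "fixer v \<subseteq> fixer w"
      define x where "x = act h u"
      have xw: "adj x w"
        using act_adj[OF h(1) uv] h by (simp add: x_def)
      have x_nsub: "\<not> fixer x \<subseteq> fixer w"
        using nsub fixer_act_subset_iff[OF h(1) V] h by (simp add: x_def)
      have "x \<noteq> v"
        using x_nsub le by blast
      have "w \<notin> half x w"
        by (rule half_other[OF xw])
      then have "v \<notin> half x w"
        using half_leave[OF adj_sym[OF w(1)], of x w] \<open>x \<noteq> v\<close> by blast
      then have u_out: "u \<notin> half x w"
        using half_leave[OF uv, of x w] adj_irrefl w(1) by blast
      then have "separated u x"
        using separated_if_not_subset[OF rf xw V(1)] x_nsub by blast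
      then obtain M where M: "M \<lhd> G" "finite (rcosets M)" "fixer u \<inter> M \<subseteq> fixer x"
        by (auto simp: separated_def)
      have "fixer u \<inter> M \<subseteq> fixer v"
      proof
        fix g assume g: "g \<in> fixer u \<inter> M"
        then have "act g u = u" "act g x = x" "g \<in> carrier G"
          using M(3) by (auto simp: fixer_def)
        then have "g \<in> fixer w"
          using fix_edge_if_fix_sides[OF _ xw _ V(1) u_out] by (simp add: fixer_def)
        then show "g \<in> fixer v"
          using below[OF w] by blast
      qed
      then show False
        using nsep M(1,2) by (auto simp: separated_def)
    qed
    \<comment> \<open>Carried back by \<open>h\<close>, the edge between \<open>v\<close> and
      \<open>w\<close> becomes an edge at \<open>v\<close>. Were its other end not \<open>u\<close>,
      the inclusion \<open>below\<close>, translated by \<open>h\<close>, would be the one just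
      excluded.\<close>
    have "v = act h u"
    proof (rule ccontr)
      assume "v \<noteq> act h u"
      define z where "z = act (inv h) v"
      have z: "v = act h z" "z \<in> V"
        using h V by (auto simp: z_def)
      have "adj (act (inv h) v) (act (inv h) w)"
        using act_adj[OF inv_closed[OF h(1)] adj_sym[OF w(1)]] .
      then have "adj z v"
        using h V by (simp add: z_def)
      moreover have "z \<noteq> u"
        using z \<open>v \<noteq> act h u\<close> by blast
      ultimately have "fixer z \<subseteq> fixer v"
        using below by blast
      then have "fixer v \<subseteq> fixer w"
        using fixer_act_subset_iff[OF h(1) z(2) V(2)] z(1) h(2) by simp
      then show False
        using nle by simp
    qed
    then have "h \<otimes> t \<in> fixer v"
      using h t V by (simp add: fixer_def act_mult)
    moreover have "w = act (h \<otimes> t) (act (inv t) v)"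
      using h t V by (simp add: act_mult)
    ultimately show ?thesis
      by blast
  qed
  \<comment> \<open>The inverse is taken because conjugation by the stable letter has to map the
    stabilizer of \<open>v\<close> into itself.\<close>
  define s where "s = inv t"
  have s: "s \<in> carrier G" "t = inv s"
    using t by (auto simp: s_def)
  have desc: "fixer (act s v) \<subseteq> fixer v"
    using fixer_act_subset_iff[OF t(1), of "act s v" v] s V sub t(2) by simp
  have nasc: "\<not> fixer v \<subseteq> fixer (act s v)"
    using fixer_act_subset_iff[OF t(1), of v "act s v"] s V nsub t(2) by simp
  have pow: "s [^] k \<notin> fixer v" if "k > 0" for k :: nat
  proof
    assume fix_k: "s [^] k \<in> fixer v"
    \<comment> \<open>Stabilizers descend along the powers of \<open>s\<close>, strictly at the
      first step, so no later power returns to \<open>v\<close>.\<close>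
    have "fixer (act (s [^] Suc m) v) \<subseteq> fixer (act s v)" for m
    proof (induction m)
      case 0
      then show ?case
        using s by simp
    next
      case (Suc m)
      have "fixer (act (s [^] Suc m) (act s v)) \<subseteq> fixer (act (s [^] Suc m) v)"
        using fixer_act_subset_iff[of "s [^] Suc m" "act s v" v] s V desc by simp
      moreover have "act (s [^] Suc m) (act s v) = act (s [^] Suc (Suc m)) v"
        using s V by (simp add: act_mult)
      ultimately show ?case
        using Suc by (metis order_trans)
    qed
    from this[of "k - 1"] have "fixer v \<subseteq> fixer (act s v)"
      using fix_k that by (simp add: fixer_def)
    then show False
      using nasc by simp
  qed
  let ?K = "generate G (insert s (fixer v))"
  have gens: "insert s (fixer v) \<subseteq> carrier G"
    using s by (auto simp: fixer_def)
  have K: "subgroup ?K G"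
    by (rule generate_is_subgroup[OF gens])
  have K_in: "a \<in> ?K" if "a \<in> fixer v" for a
    using that by (auto intro: generate.incl)
  have sK: "s \<in> ?K"
    by (auto intro: generate.incl)
  \<comment> \<open>The neighbours of \<open>v\<close> are \<open>u\<close>, its translate by the
    inverse of \<open>s\<close>, and translates of \<open>act s v\<close> by \<open>fixer v\<close>;
    all of them lie in the orbit of \<open>v\<close> under \<open>?K\<close>.\<close>
  have reach: "\<exists>k\<in>?K. z = act k v" if "z \<in> V" for z
    using connected[OF V(2) that]
  proof (induction rule: rtranclp_induct)
    case base
    then show ?case
      using act_one[OF V(2)] subgroup.one_closed[OF K] by metis
  next
    case (step a b)
    obtain k where k: "k \<in> ?K" "a = act k v"
      using step.IH by blast
    have kc: "k \<in> carrier G"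
      by (rule subgroup.mem_carrier[OF K k(1)])
    have bV: "b \<in> V"
      using adj_V[OF step.hyps(2)] by simp
    define z where "z = act (inv k) b"
    have b: "b = act k z"
      using kc bV by (simp add: z_def)
    have "adj (act (inv k) b) (act (inv k) a)"
      using act_adj[OF inv_closed[OF kc] adj_sym[OF step.hyps(2)]] .
    then have zv: "adj z v"
      using k kc V by (simp add: z_def)
    have "\<exists>l\<in>?K. z = act l v"
    proof (cases "z = u")
      case True
      then show ?thesis
        using t s subgroup.m_inv_closed[OF K sK] by blast
    next
      case False
      then obtain c where c: "c \<in> fixer v" "z = act c (act s v)"
        using neighbour[OF zv] by (auto simp: s_def)
      then have "z = act (c \<otimes> s) v"
        using s V by (simp add: act_mult fixer_carrier)
      then show ?thesis
        using subgroup.m_closed[OF K K_in[OF c(1)] sK] by blast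
    qed
    then obtain l where l: "l \<in> ?K" "z = act l v"
      by blast
    then have "b = act (k \<otimes> l) v"
      using b kc V subgroup.mem_carrier[OF K l(1)] by (simp add: act_mult)
    then show ?case
      using subgroup.m_closed[OF K k(1) l(1)] by blast
  qed
  have "g \<in> ?K" if g: "g \<in> carrier G" for g
  proof -
    obtain k where k: "k \<in> ?K" "act g v = act k v"
      using reach[of "act g v"] g V by blast
    have kc: "k \<in> carrier G"
      by (rule subgroup.mem_carrier[OF K k(1)])
    have "inv k \<otimes> g \<in> fixer v"
      using g kc k V by (simp add: fixer_def act_mult)
    then have "k \<otimes> (inv k \<otimes> g) \<in> ?K"
      using subgroup.m_closed[OF K k(1) K_in] by blast
    then show ?thesis
      using g kc by (simp add: m_assoc[symmetric])
  qed
  then have "carrier G = ?K"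
    using subgroup.subset[OF K] by blast
  then show ?thesis
    using ascending[OF V(2) s(1) desc pow] by blast
qed

end

text \<open>Von Dyck's theorem provides the map from the HNN extension. A kernel element t^-i a t^j
  gives a s^j = s^i in \<open>G\<close>; since no positive power of \<open>s\<close> lies in
  \<open>A\<close>, the exponents agree, and then a is trivial.\<close>

lemma (in group) iso_ascending_hnn:
  assumes A: "subgroup A G" and A_iso: "G\<lparr>carrier := A\<rparr> \<cong> Z_pow n" and s: "s \<in> carrier G"
    and conj: "\<And>a. a \<in> A \<Longrightarrow> s \<otimes> a \<otimes> inv s \<in> A"
    and pow: "\<And>k::nat. k > 0 \<Longrightarrow> s [^] k \<notin> A"
    and gen: "carrier G = generate G (insert s A)"
  shows "\<exists>\<phi>\<in>mon (Z_pow n) (Z_pow n). G \<cong> ascending_hnn (Z_pow n) \<phi>"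
proof -
  interpret A: group "G\<lparr>carrier := A\<rparr>"
    by (rule subgroup_imp_group[OF A])
  obtain \<psi> where \<psi>: "\<psi> \<in> iso (Z_pow n) (G\<lparr>carrier := A\<rparr>)"
    using A.iso_sym[OF A_iso] by (auto simp: is_iso_def)
  have \<psi>_A: "\<psi> x \<in> A" if "x \<in> carrier (Z_pow n)" for x
    using \<psi> that by (auto simp: iso_def hom_def)
  have A_carr: "a \<in> carrier G" if "a \<in> A" for a
    using subgroup.mem_carrier[OF A that] .
  note \<psi>_carr = A_carr[OF \<psi>_A]
  have \<psi>_mult: "\<psi> (x \<otimes>\<^bsub>Z_pow n\<^esub> y) = \<psi> x \<otimes> \<psi> y" if "x \<in> carrier (Z_pow n)" "y \<in> carrier (Z_pow n)" for x y
    using \<psi> that by (auto simp: iso_def hom_def)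
  have \<psi>_inj: "inj_on \<psi> (carrier (Z_pow n))" and \<psi>_img: "\<psi> ` carrier (Z_pow n) = A"
    using \<psi> by (auto simp: iso_def bij_betw_def)
  interpret \<psi>: group_hom "Z_pow n" G \<psi>
    by unfold_locales (auto simp: hom_def \<psi>_mult intro: \<psi>_carr)
  define \<phi> where "\<phi> x = inv_into (carrier (Z_pow n)) \<psi> (s \<otimes> \<psi> x \<otimes> inv s)" for x
  have \<phi>: "\<phi> x \<in> carrier (Z_pow n)" "\<psi> (\<phi> x) = s \<otimes> \<psi> x \<otimes> inv s" if "x \<in> carrier (Z_pow n)" for x
    using conj[OF \<psi>_A[OF that]] \<psi>_img unfolding \<phi>_def by (metis inv_into_into, metis f_inv_into_f)
  have \<phi>_mon: "\<phi> \<in> mon (Z_pow n) (Z_pow n)"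
    unfolding mon_def
  proof (intro CollectI conjI homI inj_onI)
    fix x y assume xy: "x \<in> carrier (Z_pow n)" "y \<in> carrier (Z_pow n)"
    have "\<psi> (\<phi> (x \<otimes>\<^bsub>Z_pow n\<^esub> y)) = \<psi> (\<phi> x \<otimes>\<^bsub>Z_pow n\<^esub> \<phi> y)"
      using xy \<phi> s by (simp add: m_assoc[symmetric]) (simp add: m_assoc)
    then show "\<phi> (x \<otimes>\<^bsub>Z_pow n\<^esub> y) = \<phi> x \<otimes>\<^bsub>Z_pow n\<^esub> \<phi> y"
      by (rule inj_onD[OF \<psi>_inj]) (use xy \<phi> in simp_all)
  next
    fix x y assume xy: "x \<in> carrier (Z_pow n)" "y \<in> carrier (Z_pow n)" and "\<phi> x = \<phi> y"
    then have "s \<otimes> \<psi> x \<otimes> inv s = s \<otimes> \<psi> y \<otimes> inv s"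
      using \<phi> by metis
    then have "\<psi> x = \<psi> y"
      using xy s by simp
    then show "x = y"
      using xy \<psi>_inj by (auto dest: inj_onD)
  qed (use \<phi> in blast)
  interpret hnn "Z_pow n" \<phi>
    using \<phi>_mon by unfold_locales (simp add: mon_def)
  define f where "f x = (case x of Base a \<Rightarrow> \<psi> a | Stable \<Rightarrow> s)" for x
  have f: "f \<in> hnn_gens (Z_pow n) \<rightarrow> carrier G"
    using s \<psi>_carr by (auto simp: f_def hnn_gens_def)
  have rel: "word_eval G f l = word_eval G f r" if "(l, r) \<in> hnn_rels (Z_pow n) \<phi>" for l r
    using that s \<phi> by (auto simp: hnn_rels_def f_def m_assoc)
  obtain h where h: "h \<in> hom (presented_group (hnn_gens (Z_pow n)) (hnn_rels (Z_pow n) \<phi>)) G"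
    and h_eval: "\<And>w. w \<in> words (hnn_gens (Z_pow n)) \<Longrightarrow>
      h (wclass (hnn_gens (Z_pow n)) (hnn_rels (Z_pow n) \<phi>) w) = word_eval G f w"
    using presented_group_hom[OF f, of "hnn_rels (Z_pow n) \<phi>"] rel by blast
  interpret h: group_hom P G h
    by unfold_locales (use h in \<open>simp add: ascending_hnn_eq\<close>)
  have h_base: "h (base a) = \<psi> a" if "a \<in> carrier (Z_pow n)" for a
    using that by (simp add: base_def h_eval f_def)
  have h_st: "h st = s"
    using s by (simp add: st_def h_eval f_def)
  have "h \<in> iso P G"
    unfolding h.iso_iff
  proof (intro conjI ballI impI)
    have "s \<in> h ` carrier P"
      using h_st st_closed by blast
    moreover have "A \<subseteq> h ` carrier P"
      using \<psi>_img h_base base_closed by (metis (no_types, lifting) image_iff subsetI)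
    ultimately show "carrier G \<subseteq> h ` carrier P"
      using generate_subgroup_incl[OF _ h.img_is_subgroup, of "insert s A"] gen by blast
  next
    fix g assume g: "g \<in> carrier P" and hg: "h g = \<one>"
    obtain i j :: nat and a where a: "a \<in> carrier (Z_pow n)"
      and g_eq: "g = inv\<^bsub>P\<^esub> (st [^]\<^bsub>P\<^esub> i) \<otimes>\<^bsub>P\<^esub> base a \<otimes>\<^bsub>P\<^esub> st [^]\<^bsub>P\<^esub> j"
      using normal_form[OF g] by blast
    have pc: "s [^] k \<in> carrier G" for k :: nat
      using s by simp
    have "inv (s [^] i) \<otimes> \<psi> a \<otimes> s [^] j = \<one>"
      using hg a by (simp add: g_eq h.hom_nat_pow h_base h_st)
    then have "s [^] i \<otimes> (inv (s [^] i) \<otimes> \<psi> a \<otimes> s [^] j) = s [^] i"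
      using s by simp
    then have eq: "\<psi> a \<otimes> s [^] j = s [^] i"
      using pc \<psi>_carr[OF a] by (simp add: m_assoc[symmetric])
    have "i = j"
    proof (rule ccontr)
      assume "i \<noteq> j"
      then consider "j < i" | "i < j"
        by linarith
      then show False
      proof cases
        case 1
        then have "s [^] i = s [^] (i - j) \<otimes> s [^] j"
          using s by (simp add: nat_pow_mult)
        then have "\<psi> a = s [^] (i - j)"
          using eq pc \<psi>_carr[OF a] by simp
        then show False
          using pow[of "i - j"] 1 \<psi>_A[OF a] by simp
      next
        case 2
        then have "s [^] j = s [^] (j - i) \<otimes> s [^] i"
          using s by (simp add: nat_pow_mult)
        then have "(\<psi> a \<otimes> s [^] (j - i)) \<otimes> s [^] i = s [^] i"
          using eq pc \<psi>_carr[OF a] by (simp add: m_assoc)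
        then have "\<psi> a \<otimes> s [^] (j - i) = \<one>"
          using pc \<psi>_carr[OF a] by simp
        then have "s [^] (j - i) = inv (\<psi> a)"
          using pc \<psi>_carr[OF a] by (metis inv_equality inv_inv inv_closed)
        then show False
          using pow[of "j - i"] 2 subgroup.m_inv_closed[OF A \<psi>_A[OF a]] by simp
      qed
    qed
    then have "\<psi> a = \<psi> \<one>\<^bsub>Z_pow n\<^esub>"
      using eq pc \<psi>_carr[OF a] by simp
    then have "a = \<one>\<^bsub>Z_pow n\<^esub>"
      by (rule inj_onD[OF \<psi>_inj]) (use a in simp_all)
    then show "g = \<one>\<^bsub>P\<^esub>"
      using \<open>i = j\<close> by (simp add: g_eq)
  qed
  then have "P \<cong> G"
    by (rule is_isoI)
  then show ?thesis
    using \<phi>_mon P.iso_sym by blast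
qed

text \<open>By uniformity all vertices have the same stabilizer \<open>N\<close> in
  \<open>M\<close>, so \<open>N\<close> is the kernel of the action of \<open>M\<close> and the
  quotient acts freely. As \<open>N\<close> has finite index in a full stabilizer, it is again
  Z^n.\<close>

lemma (in tree_act) virtually_Z_pow_by_free_if_uniform:
  assumes V: "V \<noteq> {}" and stab: "\<And>x. x \<in> V \<Longrightarrow> G\<lparr>carrier := fixer x\<rparr> \<cong> Z_pow n"
    and M: "M \<lhd> G" "finite (rcosets M)"
    and uniform: "\<And>x y. x \<in> V \<Longrightarrow> y \<in> V \<Longrightarrow> fixer x \<inter> M \<subseteq> fixer y"
  shows "virtually_Z_pow_by_free n G"
proof -
  obtain x0 where x0: "x0 \<in> V"
    using V by blast
  define N where "N = fixer x0 \<inter> M"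
  have N_iff: "h \<in> N \<longleftrightarrow> h \<in> M \<and> act h x = x" if "x \<in> V" for h x
    using uniform[OF x0 that] uniform[OF that x0] subgroup.mem_carrier[OF normal_imp_subgroup[OF M(1)]]
    by (auto simp: N_def fixer_def)
  have subM: "subgroup M G"
    by (rule normal_imp_subgroup[OF M(1)])
  interpret M: group "G\<lparr>carrier := M\<rparr>"
    by (rule subgroup_imp_group[OF subM])
  have M_carr: "h \<in> carrier G" if "h \<in> M" for h
    by (rule subgroup.mem_carrier[OF subM that])
  have subN: "subgroup N G"
    unfolding N_def by (rule subgroups_Inter_pair[OF subgroup_fixer[OF x0] subM])
  have N_normal: "N \<lhd> G\<lparr>carrier := M\<rparr>"
    unfolding M.normal_inv_iff
  proof (intro conjI ballI)
    show "subgroup N (G\<lparr>carrier := M\<rparr>)"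
      by (rule subgroup_incl[OF subN subM]) (simp add: N_def)
    fix g h assume g: "g \<in> carrier (G\<lparr>carrier := M\<rparr>)" and h: "h \<in> N"
    then have gM: "g \<in> M" and hM: "h \<in> M"
      by (auto simp: N_def)
    have "act (inv g) x0 \<in> V"
      using x0 M_carr[OF gM] by simp
    then have "act h (act (inv g) x0) = act (inv g) x0"
      using h N_iff by blast
    then have "act (g \<otimes> h \<otimes> inv g) x0 = x0"
      using x0 M_carr[OF gM] M_carr[OF hM] by (simp add: act_mult)
    moreover have "g \<otimes> h \<otimes> inv g \<in> M"
      using normal.inv_op_closed2[OF M(1) M_carr[OF gM] hM] .
    ultimately show "g \<otimes>\<^bsub>G\<lparr>carrier := M\<rparr>\<^esub> h \<otimes>\<^bsub>G\<lparr>carrier := M\<rparr>\<^esub> inv\<^bsub>G\<lparr>carrier := M\<rparr>\<^esub> g \<in> N"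
      using N_iff[OF x0] m_inv_consistent[OF subM gM] by simp
  qed
  have N_iso: "G\<lparr>carrier := N\<rparr> \<cong> Z_pow n"
  proof -
    interpret S: group "G\<lparr>carrier := fixer x0\<rparr>"
      by (rule subgroup_imp_group[OF subgroup_fixer[OF x0]])
    have sub: "subgroup N (G\<lparr>carrier := fixer x0\<rparr>)"
      by (rule subgroup_incl[OF subN subgroup_fixer[OF x0]]) (simp add: N_def)
    have "finite (rcosets\<^bsub>G\<lparr>carrier := fixer x0\<rparr>\<^esub> N)"
    proof (rule S.finite_rcosetsI[OF sub, where f = "\<lambda>g. M #> g"])
      show "finite ((\<lambda>g. M #> g) ` carrier (G\<lparr>carrier := fixer x0\<rparr>))"
        by (rule finite_subset[OF _ M(2)]) (auto simp: rcosets_eq_image fixer_def)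
      fix g h
      assume gh: "g \<in> carrier (G\<lparr>carrier := fixer x0\<rparr>)" "h \<in> carrier (G\<lparr>carrier := fixer x0\<rparr>)"
        and eq: "M #> g = M #> h"
      then have "g \<otimes> inv h \<in> M"
        using r_coset_eq_iff[OF subM, of g h] by (simp add: fixer_def)
      moreover have "g \<otimes> inv h \<in> fixer x0"
        using gh subgroup_fixer[OF x0] by (simp add: subgroup.m_closed subgroup.m_inv_closed)
      ultimately show "g \<otimes>\<^bsub>G\<lparr>carrier := fixer x0\<rparr>\<^esub> inv\<^bsub>G\<lparr>carrier := fixer x0\<rparr>\<^esub> h \<in> N"
        using m_inv_consistent[OF subgroup_fixer[OF x0], of h] gh by (simp add: N_def)
    qed
    then show ?thesis
      using S.finite_index_iso_Z_pow[OF stab[OF x0] sub] by simp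
  qed
  interpret N: normal N "G\<lparr>carrier := M\<rparr>"
    by (rule N_normal)
  \<comment> \<open>A coset may act through any representative because \<open>N\<close> fixes every
    vertex.\<close>
  define act' where "act' C = act (SOME h. h \<in> C)" for C
  have act'_eq: "act' (N #> h) x = act h x" if h: "h \<in> M" and x: "x \<in> V" for h x
  proof -
    let ?k = "SOME k. k \<in> N #> h"
    have "?k \<in> N #> h"
      by (rule someI[of _ h]) (rule rcos_self[OF M_carr[OF h] subN])
    then obtain y where y: "y \<in> N" "?k = y \<otimes> h"
      by (auto simp: r_coset_def)
    have "act (y \<otimes> h) x = act y (act h x)"
      using y h x M_carr by (auto simp: act_mult N_def)
    also have "\<dots> = act h x"
      using y(1) N_iff[of "act h x"] h x M_carr by simp
    finally show ?thesis
      by (simp add: act'_def y(2))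
  qed
  have Q_carr: "carrier (G\<lparr>carrier := M\<rparr> Mod N) = (\<lambda>h. N #> h) ` M"
    by (simp add: carrier_FactGroup)
  interpret Q: group "G\<lparr>carrier := M\<rparr> Mod N"
    by (rule N.factorgroup_is_group)
  have Q_mult: "(N #> g) \<otimes>\<^bsub>G\<lparr>carrier := M\<rparr> Mod N\<^esub> (N #> h) = N #> (g \<otimes> h)" if "g \<in> M" "h \<in> M" for g h
    using N.rcos_sum[of g h] that by simp
  interpret Q: free_tree_act "G\<lparr>carrier := M\<rparr> Mod N" V act' adj
  proof unfold_locales
    fix C s assume "C \<in> carrier (G\<lparr>carrier := M\<rparr> Mod N)" "s \<in> V"
    then show "act' C s \<in> V"
      using M_carr by (auto simp: Q_carr act'_eq)
  next
    fix s assume s: "s \<in> V"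
    have "act' (N #> \<one>) s = s"
      using s act'_eq[OF subgroup.one_closed[OF subM] s] by simp
    then show "act' \<one>\<^bsub>G\<lparr>carrier := M\<rparr> Mod N\<^esub> s = s"
      using coset_mult_one[OF subgroup.subset[OF subN]] by simp
  next
    fix C D s
    assume "C \<in> carrier (G\<lparr>carrier := M\<rparr> Mod N)" "D \<in> carrier (G\<lparr>carrier := M\<rparr> Mod N)" and s: "s \<in> V"
    then obtain g h where gh: "g \<in> M" "h \<in> M" "C = N #> g" "D = N #> h"
      by (auto simp: Q_carr)
    then have "C \<otimes>\<^bsub>G\<lparr>carrier := M\<rparr> Mod N\<^esub> D = N #> (g \<otimes> h)"
      using Q_mult by blast
    then show "act' (C \<otimes>\<^bsub>G\<lparr>carrier := M\<rparr> Mod N\<^esub> D) s = act' C (act' D s)"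
      using gh s M_carr subgroup.m_closed[OF subM] by (simp add: act'_eq act_mult del: mult_FactGroup)
  next
    fix C x y
    assume "C \<in> carrier (G\<lparr>carrier := M\<rparr> Mod N)" and xy: "adj x y"
    then obtain g where g: "g \<in> M" "C = N #> g"
      by (auto simp: Q_carr)
    have V: "x \<in> V" "y \<in> V"
      using adj_V[OF xy] by auto
    show "adj (act' C x) (act' C y)"
      using act_adj[OF M_carr[OF g(1)] xy] g V by (simp add: act'_eq)
    show "act' C y \<noteq> x" if "act' C x = y"
      using no_inversion[OF M_carr[OF g(1)] xy] that g V by (simp add: act'_eq)
  next
    fix C x
    assume "C \<in> carrier (G\<lparr>carrier := M\<rparr> Mod N)" and x: "x \<in> V" and fix_x: "act' C x = x"
    then obtain g where g: "g \<in> M" "C = N #> g"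
      by (auto simp: Q_carr)
    then have "g \<in> N"
      using fix_x x N_iff[OF x] by (simp add: act'_eq)
    then show "C = \<one>\<^bsub>G\<lparr>carrier := M\<rparr> Mod N\<^esub>"
      using g coset_join2[OF M_carr[OF g(1)] subN] by simp
  qed (use V in simp)
  have "Z_pow_by_free n (G\<lparr>carrier := M\<rparr>)"
    unfolding Z_pow_by_free_def using N_normal N_iso Q.is_free by auto
  then show ?thesis
    unfolding virtually_Z_pow_by_free_def using subM M(2) by blast
qed

theorem residually_finite_tree_act:
  assumes act: "commensurable_tree_act G V act adj R W"
    and stab: "\<And>x. x \<in> V \<Longrightarrow> G\<lparr>carrier := {g \<in> carrier G. act g x = x}\<rparr> \<cong> Z_pow n"
    and rf: "residually_finite G"
  shows "(\<exists>\<phi>\<in>mon (Z_pow n) (Z_pow n). G \<cong> ascending_hnn (Z_pow n) \<phi>) \<or> virtually_Z_pow_by_free n G"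
proof -
  obtain V' adj' R' W' where act': "commensurable_tree_act G V' act adj' R' W'" and sub: "V' \<subseteq> V"
    and red: "commensurable_tree_act.tree_reduced G act adj'"
    using ex_reduced_tree[OF act] by blast
  interpret commensurable_tree_act G V' act adj' R' W'
    by (rule act')
  have stab': "G\<lparr>carrier := fixer x\<rparr> \<cong> Z_pow n" if "x \<in> V'" for x
    using stab sub that by (auto simp: fixer_def)
  show ?thesis
  proof (cases rule: dichotomy[OF rf red])
    case (1 v s)
    have "s \<otimes>\<^bsub>G\<^esub> a \<otimes>\<^bsub>G\<^esub> inv\<^bsub>G\<^esub> s \<in> fixer v" if a: "a \<in> fixer v" for a
    proof -
      have "s \<otimes>\<^bsub>G\<^esub> a \<otimes>\<^bsub>G\<^esub> inv\<^bsub>G\<^esub> s \<in> fixer (act s v)"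
        using a 1(1,2) by (simp add: fixer_def act_mult)
      then show ?thesis
        using 1(3) by blast
    qed
    from iso_ascending_hnn[OF subgroup_fixer[OF 1(1)] stab'[OF 1(1)] 1(2) this 1(4,5)]
    show ?thesis ..
  next
    case (2 M)
    from virtually_Z_pow_by_free_if_uniform[OF V_nonempty stab' 2]
    show ?thesis ..
  qed
qed

section \<open>Graphs of groups\<close>

subsection \<open>Trees in the sense of Serre\<close>

lemma walk_append: "walk \<Gamma> u (p @ q) v \<longleftrightarrow> (\<exists>w. walk \<Gamma> u p w \<and> walk \<Gamma> w q v)" if "u \<in> verts \<Gamma>" "serre_graph \<Gamma>"
  using that(1)
proof (induction p arbitrary: u)
  case (Cons e p)
  show ?case
  proof (cases "e \<in> edges \<Gamma>")
    case True
    then have "tgt \<Gamma> e \<in> verts \<Gamma>"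
      using that(2) by (auto simp: serre_graph_def)
    then show ?thesis
      using Cons.IH by auto
  qed simp
qed auto

lemma walk_edges: "walk \<Gamma> u p v \<Longrightarrow> set p \<subseteq> edges \<Gamma>"
  by (induction p arbitrary: u) auto

lemma walk_tgt_nth: "walk \<Gamma> u p v \<Longrightarrow> i < length p \<Longrightarrow> tgt \<Gamma> (p ! i) = (map (src \<Gamma>) p @ [v]) ! Suc i"
proof (induction p arbitrary: u i)
  case (Cons e p)
  show ?case
  proof (cases i)
    case 0
    then show ?thesis
      using Cons.prems by (cases p) auto
  next
    case (Suc j)
    then show ?thesis
      using Cons.IH[of "tgt \<Gamma> e" j] Cons.prems by auto
  qed
qed simp

text \<open>If the new source occurs again in the simple tail, the walk restarts at that occurrence.
  The control of the sources keeps the walk in a prescribed set of vertices.\<close>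

lemma ex_simple_walk:
  assumes "walk \<Gamma> u p v" "serre_graph \<Gamma>"
  shows "\<exists>q. walk \<Gamma> u q v \<and> distinct (map (src \<Gamma>) q @ [v]) \<and> src \<Gamma> ` set q \<subseteq> src \<Gamma> ` set p"
  using assms(1)
proof (induction p arbitrary: u)
  case Nil
  then show ?case
    by (intro exI[of _ "[]"]) auto
next
  case (Cons e p)
  then obtain q where q: "walk \<Gamma> (tgt \<Gamma> e) q v" "distinct (map (src \<Gamma>) q @ [v])" "src \<Gamma> ` set q \<subseteq> src \<Gamma> ` set p"
    by fastforce
  have e: "e \<in> edges \<Gamma>" "src \<Gamma> e = u" "u \<in> verts \<Gamma>"
    using Cons.prems assms(2) by (auto simp: serre_graph_def)
  consider "u = v" | "u \<in> src \<Gamma> ` set q" | "u \<noteq> v" "u \<notin> src \<Gamma> ` set q"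
    by blast
  then show ?case
  proof cases
    case 1
    then show ?thesis
      using e by (intro exI[of _ "[]"]) auto
  next
    case 2
    then obtain a f b where fab: "q = a @ f # b" "src \<Gamma> f = u"
      by (metis imageE split_list)
    have "tgt \<Gamma> e \<in> verts \<Gamma>"
      using e assms(2) by (auto simp: serre_graph_def)
    then have "walk \<Gamma> u (f # b) v"
      using q(1) fab by (auto simp: walk_append[OF _ assms(2)])
    then show ?thesis
      using q fab by (intro exI[of _ "f # b"]) auto
  next
    case 3
    then show ?thesis
      using q e by (intro exI[of _ "e # q"]) auto
  qed
qed

text \<open>Backtracking at one position makes the walk return to an earlier source two steps later.
  Distinct sources permit this only if the walk has length two, which \<open>two\<close> takes care
  of.\<close>

lemma circuitI:
  assumes p: "walk \<Gamma> v p v" "p \<noteq> []" "distinct (map (src \<Gamma>) p)" and g: "serre_graph \<Gamma>"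
    and two: "\<And>a b. p = [a, b] \<Longrightarrow> b \<noteq> opp \<Gamma> a"
  shows "circuit \<Gamma> p"
  unfolding circuit_def
proof (intro conjI allI impI)
  fix i assume i: "Suc i < length p"
  show "p ! Suc i \<noteq> opp \<Gamma> (p ! i)"
  proof
    assume eq: "p ! Suc i = opp \<Gamma> (p ! i)"
    have "p ! i \<in> edges \<Gamma>"
      using walk_edges[OF p(1)] i by (meson Suc_lessD nth_mem subsetD)
    then have "tgt \<Gamma> (p ! Suc i) = src \<Gamma> (p ! i)"
      using g unfolding eq serre_graph_def by metis
    then have 1: "(map (src \<Gamma>) p @ [v]) ! Suc (Suc i) = src \<Gamma> (p ! i)"
      using walk_tgt_nth[OF p(1) i] by simp
    show False
    proof (cases "Suc (Suc i) < length p")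
      case True
      then have "map (src \<Gamma>) p ! Suc (Suc i) = map (src \<Gamma>) p ! i"
        using 1 by (simp add: nth_append)
      then show False
        using p(3) True by (simp add: distinct_conv_nth)
    next
      case False
      then have len: "length p = Suc (Suc i)"
        using i by simp
      have "src \<Gamma> (p ! 0) = v"
        using p(1,2) by (cases p) auto
      then have "map (src \<Gamma>) p ! 0 = map (src \<Gamma>) p ! i"
        using 1 len by (simp add: nth_append)
      then have "i = 0"
        using p(3) len nth_eq_iff_index_eq[OF p(3), of 0 i] by simp
      then obtain a b where ab: "p = [a, b]"
        using len by (auto simp: length_Suc_conv)
      then show False
        using two[OF ab] eq \<open>i = 0\<close> by simp
    qed
  qed
qed (use p in auto)

text \<open>A solution on a connected set of vertices extends across an outgoing edge. A second edge
  from the new vertex to the old set would close a circuit, so no further equation has to agree. The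
  values are bijections in one application and sets of lifted edges in the other.\<close>

lemma tree_potential:
  fixes D :: "'v \<Rightarrow> 'd set" and F :: "'e \<Rightarrow> 'd \<Rightarrow> 'd"
  assumes tree: "tree \<Gamma>" and fin: "finite (verts \<Gamma>)" and v0: "v0 \<in> verts \<Gamma>" and x0: "x0 \<in> D v0"
    and F_closed: "\<And>e x. e \<in> edges \<Gamma> \<Longrightarrow> x \<in> D (src \<Gamma> e) \<Longrightarrow> F e x \<in> D (tgt \<Gamma> e)"
    and F_opp: "\<And>e x. e \<in> edges \<Gamma> \<Longrightarrow> x \<in> D (src \<Gamma> e) \<Longrightarrow> F (opp \<Gamma> e) (F e x) = x"
  shows "\<exists>c. (\<forall>v\<in>verts \<Gamma>. c v \<in> D v) \<and> (\<forall>e\<in>edges \<Gamma>. c (tgt \<Gamma> e) = F e (c (src \<Gamma> e)))"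
proof -
  have g: "serre_graph \<Gamma>" and conn: "connected_graph \<Gamma>" and no_circuit: "\<And>p. \<not> circuit \<Gamma> p"
    using tree by (auto simp: tree_def)
  have gr: "src \<Gamma> e \<in> verts \<Gamma>" "tgt \<Gamma> e \<in> verts \<Gamma>" "opp \<Gamma> e \<in> edges \<Gamma>" "opp \<Gamma> (opp \<Gamma> e) = e"
    "src \<Gamma> (opp \<Gamma> e) = tgt \<Gamma> e" "tgt \<Gamma> (opp \<Gamma> e) = src \<Gamma> e" if "e \<in> edges \<Gamma>" for e
    using g that unfolding serre_graph_def by metis+
  \<comment> \<open>Connectedness of \<open>U\<close> is expressed by walks whose sources stay in
    \<open>U\<close>, so that a circuit through a new vertex \<open>w\<close> meets \<open>w\<close>
    only once.\<close>
  define good where "good U c \<longleftrightarrow> v0 \<in> U \<and> U \<subseteq> verts \<Gamma> \<and> (\<forall>v\<in>U. c v \<in> D v) \<and>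
    (\<forall>e\<in>edges \<Gamma>. src \<Gamma> e \<in> U \<longrightarrow> tgt \<Gamma> e \<in> U \<longrightarrow> c (tgt \<Gamma> e) = F e (c (src \<Gamma> e))) \<and>
    (\<forall>u\<in>U. \<forall>v\<in>U. \<exists>p. walk \<Gamma> u p v \<and> src \<Gamma> ` set p \<subseteq> U)" for U c
  have no_loop: "src \<Gamma> e \<noteq> tgt \<Gamma> e" if e: "e \<in> edges \<Gamma>" for e
  proof
    assume "src \<Gamma> e = tgt \<Gamma> e"
    then have "circuit \<Gamma> [e]"
      using gr[OF e] e by (intro circuitI[where v = "src \<Gamma> e"] g) auto
    then show False
      using no_circuit by blast
  qed
  have extend: "\<exists>U' c'. good U' c' \<and> card U < card U'" if good: "good U c" and ne: "U \<noteq> verts \<Gamma>" for U c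
  proof -
    have U: "v0 \<in> U" "U \<subseteq> verts \<Gamma>" "\<And>v. v \<in> U \<Longrightarrow> c v \<in> D v"
      "\<And>e. e \<in> edges \<Gamma> \<Longrightarrow> src \<Gamma> e \<in> U \<Longrightarrow> tgt \<Gamma> e \<in> U \<Longrightarrow> c (tgt \<Gamma> e) = F e (c (src \<Gamma> e))"
      "\<And>u v. u \<in> U \<Longrightarrow> v \<in> U \<Longrightarrow> \<exists>p. walk \<Gamma> u p v \<and> src \<Gamma> ` set p \<subseteq> U"
      using good by (auto simp: good_def)
    obtain z where z: "z \<in> verts \<Gamma>" "z \<notin> U"
      using ne U(2) by blast
    obtain p where p: "walk \<Gamma> v0 p z"
      using conn v0 z(1) by (auto simp: connected_graph_def)
    have "\<exists>e\<in>edges \<Gamma>. src \<Gamma> e \<in> U \<and> tgt \<Gamma> e \<notin> U" if "walk \<Gamma> u p z" "u \<in> U" for u p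
      using that
    proof (induction p arbitrary: u)
      case (Cons e p)
      then show ?case
        by (cases "tgt \<Gamma> e \<in> U") auto
    qed (use z in auto)
    from this[OF p U(1)] obtain e where e: "e \<in> edges \<Gamma>" "src \<Gamma> e \<in> U" "tgt \<Gamma> e \<notin> U"
      by blast
    define w where "w = tgt \<Gamma> e"
    have w: "w \<in> verts \<Gamma>" "w \<notin> U"
      using gr e by (auto simp: w_def)
    have e_unique: "f = e" if f: "f \<in> edges \<Gamma>" "src \<Gamma> f \<in> U" "tgt \<Gamma> f = w" for f
    proof (rule ccontr)
      assume "f \<noteq> e"
      obtain p where p: "walk \<Gamma> (src \<Gamma> f) p (src \<Gamma> e)" "src \<Gamma> ` set p \<subseteq> U"
        using U(5) f e by blast
      from ex_simple_walk[OF p(1) g] obtain q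
        where q: "walk \<Gamma> (src \<Gamma> f) q (src \<Gamma> e)" "distinct (map (src \<Gamma>) q @ [src \<Gamma> e])"
          and sub: "src \<Gamma> ` set q \<subseteq> src \<Gamma> ` set p"
        by (elim exE conjE)
      have "src \<Gamma> ` set q \<subseteq> U"
        using sub p(2) by (rule order_trans)
      note q = q this
      \<comment> \<open>From \<open>w\<close> backwards along \<open>f\<close>, through
        \<open>U\<close>, and back to \<open>w\<close> along \<open>e\<close>.\<close>
      have "circuit \<Gamma> (opp \<Gamma> f # q @ [e])"
      proof (rule circuitI[OF _ _ _ g])
        have "walk \<Gamma> (src \<Gamma> f) (q @ [e]) w"
          using q(1) e w gr[OF f(1)] by (auto simp: walk_append[OF _ g] w_def)
        then show "walk \<Gamma> w (opp \<Gamma> f # q @ [e]) w"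
          using gr[OF f(1)] f(3) by simp
        show "distinct (map (src \<Gamma>) (opp \<Gamma> f # q @ [e]))"
          using q w gr[OF f(1)] f(3) e by auto
        fix a b assume "opp \<Gamma> f # q @ [e] = [a, b]"
        then have "a = opp \<Gamma> f" "b = e"
          by auto
        then show "b \<noteq> opp \<Gamma> a"
          using gr[OF f(1)] \<open>f \<noteq> e\<close> by simp
      qed simp
      then show False
        using no_circuit by blast
    qed
    define c' where "c' = c(w := F e (c (src \<Gamma> e)))"
    have c'_U: "c' v = c v" if "v \<in> U" for v
      using that w(2) by (auto simp: c'_def)
    have c'_w: "c' w = F e (c (src \<Gamma> e))"
      by (simp add: c'_def)
    have "good (insert w U) c'"
      unfolding good_def
    proof (intro conjI ballI impI)
      fix v assume "v \<in> insert w U"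
      then show "c' v \<in> D v"
        using U(3) c'_U c'_w F_closed[OF e(1) U(3)[OF e(2)]] by (auto simp: w_def)
    next
      fix f assume f: "f \<in> edges \<Gamma>" "src \<Gamma> f \<in> insert w U" "tgt \<Gamma> f \<in> insert w U"
      consider "src \<Gamma> f \<in> U" "tgt \<Gamma> f \<in> U" | "src \<Gamma> f \<in> U" "tgt \<Gamma> f = w" | "src \<Gamma> f = w" "tgt \<Gamma> f \<in> U"
        using f no_loop[OF f(1)] by auto
      then show "c' (tgt \<Gamma> f) = F f (c' (src \<Gamma> f))"
      proof cases
        case 1
        then show ?thesis
          using U(4) f(1) c'_U by simp
      next
        case 2
        then show ?thesis
          using e_unique[OF f(1)] c'_w c'_U by simp
      next
        case 3
        then have "opp \<Gamma> f = e"
          using e_unique[of "opp \<Gamma> f"] gr[OF f(1)] by simp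
        then have "f = opp \<Gamma> e" "tgt \<Gamma> f = src \<Gamma> e"
          using gr[OF f(1)] by auto
        then show ?thesis
          using 3 c'_w c'_U[OF e(2)] F_opp[OF e(1) U(3)[OF e(2)]] by simp
      qed
    next
      fix u v assume uv: "u \<in> insert w U" "v \<in> insert w U"
      have to_e: "\<exists>p. walk \<Gamma> u p (src \<Gamma> e) \<and> src \<Gamma> ` set p \<subseteq> insert w U" if "u \<in> insert w U" for u
      proof (cases "u = w")
        case True
        then show ?thesis
          using gr[OF e(1)] by (intro exI[of _ "[opp \<Gamma> e]"]) (auto simp: w_def)
      next
        case False
        then show ?thesis
          using U(5)[of u "src \<Gamma> e"] e(2) that by blast
      qed
      have from_e: "\<exists>p. walk \<Gamma> (src \<Gamma> e) p v \<and> src \<Gamma> ` set p \<subseteq> insert w U" if "v \<in> insert w U" for v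
      proof (cases "v = w")
        case True
        then show ?thesis
          using gr[OF e(1)] e by (intro exI[of _ "[e]"]) (auto simp: w_def)
      next
        case False
        then show ?thesis
          using U(5)[of "src \<Gamma> e" v] e(2) that by blast
      qed
      obtain p q where "walk \<Gamma> u p (src \<Gamma> e)" "src \<Gamma> ` set p \<subseteq> insert w U"
        "walk \<Gamma> (src \<Gamma> e) q v" "src \<Gamma> ` set q \<subseteq> insert w U"
        using to_e[OF uv(1)] from_e[OF uv(2)] by blast
      moreover have "u \<in> verts \<Gamma>"
        using uv w U(2) by auto
      ultimately show "\<exists>p. walk \<Gamma> u p v \<and> src \<Gamma> ` set p \<subseteq> insert w U"
        using walk_append[OF _ g, of u p q v] by (intro exI[of _ "p @ q"]) auto
    qed (use U w in auto)
    moreover have "card U < card (insert w U)"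
      using w U(2) fin finite_subset by (metis card_insert_disjoint lessI)
    ultimately show ?thesis
      by blast
  qed
  have "good {v0} (\<lambda>_. x0)"
    using v0 x0 no_loop[symmetric] by (auto simp: good_def intro!: exI[of _ "[]"])
  then have ex: "\<exists>c. good {v0} c"
    by blast
  have bound: "\<forall>U. (\<exists>c. good U c) \<longrightarrow> card U < Suc (card (verts \<Gamma>))"
    using fin by (auto simp: good_def less_Suc_eq_le intro: card_mono)
  obtain U where "\<exists>c. good U c" and max: "\<forall>U'. (\<exists>c. good U' c) \<longrightarrow> card U' \<le> card U"
    using ex_has_greatest_nat[of "\<lambda>U. \<exists>c. good U c", OF ex bound] by blast
  then obtain c where Uc: "good U c"
    by blast
  have "U = verts \<Gamma>"
    using extend[OF Uc] max linorder_not_le by blast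
  then show ?thesis
    using Uc gr by (intro exI[of _ c]) (auto simp: good_def)
qed

subsection \<open>Vertex groups embed in the fundamental group\<close>

text \<open>Left multiplication through \<alpha> makes A x nat a free E-set. Without the factor nat
  the number of orbits would be the index of the image, which can differ at the two ends of an edge;
  with it there are always countably infinitely many.\<close>

lemma free_orbit_coordinates:
  assumes E: "group E" and A: "group A" and \<alpha>: "\<alpha> \<in> mon E A" and count: "countable (carrier A)"
  shows "\<exists>\<psi>. bij_betw \<psi> (carrier E \<times> (UNIV :: nat set)) (carrier A \<times> (UNIV :: nat set)) \<and>
    (\<forall>a\<in>carrier E. \<forall>b\<in>carrier E. \<forall>k.
      \<psi> (a \<otimes>\<^bsub>E\<^esub> b, k) = (\<alpha> a \<otimes>\<^bsub>A\<^esub> fst (\<psi> (b, k)), snd (\<psi> (b, k))))"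
proof -
  interpret E: group E by fact
  interpret A: group A by fact
  interpret \<alpha>: group_hom E A \<alpha>
    using \<alpha> by unfold_locales (simp add: mon_def)
  have inj: "inj_on \<alpha> (carrier E)"
    using \<alpha> by (simp add: mon_def)
  let ?H = "\<alpha> ` carrier E"
  have H: "subgroup ?H A"
    by (rule \<alpha>.img_is_subgroup)
  define r where "r C = (SOME x. x \<in> carrier A \<and> C = ?H #>\<^bsub>A\<^esub> x)" for C
  have r: "r (?H #>\<^bsub>A\<^esub> x) \<in> carrier A \<and> ?H #>\<^bsub>A\<^esub> x = ?H #>\<^bsub>A\<^esub> r (?H #>\<^bsub>A\<^esub> x)" if "x \<in> carrier A" for x
    unfolding r_def by (rule someI[of _ x]) (use that in simp)
  define U where "U = (\<lambda>x. r (?H #>\<^bsub>A\<^esub> x)) ` carrier A"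
  have U_carr: "U \<subseteq> carrier A"
    using r by (auto simp: U_def)
  have U_eq: "u = r (?H #>\<^bsub>A\<^esub> u)" if u: "u \<in> U" for u
  proof -
    obtain x where x: "x \<in> carrier A" "u = r (?H #>\<^bsub>A\<^esub> x)"
      using u by (auto simp: U_def)
    have e: "?H #>\<^bsub>A\<^esub> x = ?H #>\<^bsub>A\<^esub> u"
      using r[OF x(1)] unfolding x(2) by (rule conjunct2)
    show ?thesis
      unfolding e[symmetric] by (rule x(2))
  qed
  have "countable (U \<times> (UNIV :: nat set))"
    using countable_subset[OF U_carr count] by simp
  moreover have "infinite (U \<times> (UNIV :: nat set))"
    using A.one_closed by (auto simp: U_def finite_cartesian_product_iff)
  \<comment> \<open>\<open>m\<close> enumerates the orbits, each given by a coset representative and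
    a natural number.\<close>
  ultimately obtain m where m: "bij_betw m (UNIV :: nat set) (U \<times> (UNIV :: nat set))"
    using bij_betw_from_nat_into by blast
  have m_U: "fst (m k) \<in> U" for k
    using m by (auto simp: bij_betw_def) (metis UNIV_I mem_Times_iff rangeI)
  have m_A: "fst (m k) \<in> carrier A" for k
    using m_U U_carr by blast
  define \<psi> where "\<psi> = (\<lambda>(b, k). (\<alpha> b \<otimes>\<^bsub>A\<^esub> fst (m k), snd (m k)))"
  have "bij_betw \<psi> (carrier E \<times> UNIV) (carrier A \<times> UNIV)"
    unfolding bij_betw_def
  proof (intro conjI inj_onI equalityI subsetI)
    fix p q assume p: "p \<in> carrier E \<times> (UNIV :: nat set)" and q: "q \<in> carrier E \<times> (UNIV :: nat set)"
      and eq: "\<psi> p = \<psi> q"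
    obtain b k where p': "p = (b, k)" "b \<in> carrier E"
      using p by auto
    obtain b' k' where q': "q = (b', k')" "b' \<in> carrier E"
      using q by auto
    have u: "fst (m k) \<in> carrier A" "fst (m k') \<in> carrier A"
      using m_U U_carr by auto
    have e: "\<alpha> b \<otimes>\<^bsub>A\<^esub> fst (m k) = \<alpha> b' \<otimes>\<^bsub>A\<^esub> fst (m k')" "snd (m k) = snd (m k')"
      using eq by (auto simp: \<psi>_def p' q')
    have "?H #>\<^bsub>A\<^esub> fst (m k) = ?H #>\<^bsub>A\<^esub> (\<alpha> b \<otimes>\<^bsub>A\<^esub> fst (m k))"
      "?H #>\<^bsub>A\<^esub> fst (m k') = ?H #>\<^bsub>A\<^esub> (\<alpha> b' \<otimes>\<^bsub>A\<^esub> fst (m k'))"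
      using u p' q' by (auto intro!: A.repr_independence[OF _ _ H] A.rcosI subgroup.subset[OF H])
    then have "?H #>\<^bsub>A\<^esub> fst (m k) = ?H #>\<^bsub>A\<^esub> fst (m k')"
      using e by simp
    then have f: "fst (m k) = fst (m k')"
      using U_eq[OF m_U] by metis
    then have "m k = m k'"
      using e by (simp add: prod_eq_iff)
    then have "k = k'"
      using m by (auto simp: bij_betw_def dest: injD)
    moreover have "b = b'"
      using e f u p' q' inj by (auto dest: inj_onD)
    ultimately show "p = q"
      by (simp add: p' q')
  next
    fix y assume "y \<in> \<psi> ` (carrier E \<times> (UNIV :: nat set))"
    then show "y \<in> carrier A \<times> UNIV"
      using m_A by (auto simp: \<psi>_def)
  next
    fix y assume "y \<in> carrier A \<times> (UNIV :: nat set)"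
    then obtain x l where y: "y = (x, l)" "x \<in> carrier A"
      by auto
    let ?u = "r (?H #>\<^bsub>A\<^esub> x)"
    have u: "?u \<in> U" "?u \<in> carrier A" "?H #>\<^bsub>A\<^esub> x = ?H #>\<^bsub>A\<^esub> ?u"
      using r[OF y(2)] y(2) by (auto simp: U_def)
    have "(?u, l) \<in> range m"
      using m u(1) by (auto simp: bij_betw_def)
    then obtain k where k: "m k = (?u, l)"
      by (metis imageE)
    have "x \<in> ?H #>\<^bsub>A\<^esub> ?u"
      using A.rcos_self[OF y(2) H] u(3) by simp
    then obtain b where "b \<in> carrier E" "x = \<alpha> b \<otimes>\<^bsub>A\<^esub> ?u"
      by (auto simp: r_coset_def)
    then show "y \<in> \<psi> ` (carrier E \<times> UNIV)"
      using k y by (intro image_eqI[of _ _ "(b, k)"]) (auto simp: \<psi>_def)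
  qed
  moreover have "\<forall>a\<in>carrier E. \<forall>b\<in>carrier E. \<forall>k.
      \<psi> (a \<otimes>\<^bsub>E\<^esub> b, k) = (\<alpha> a \<otimes>\<^bsub>A\<^esub> fst (\<psi> (b, k)), snd (\<psi> (b, k)))"
    using m_A by (auto simp: \<psi>_def A.m_assoc)
  ultimately show ?thesis
    by blast
qed

locale spanned_gog =
  fixes \<G> :: "('v, 'e, 'g, 'h) gog" and T :: "'e set"
  assumes gog: "graph_of_groups \<G>" and finite_verts: "finite (verts \<G>)" and max_tree: "maximal_tree \<G> T"
    and countable_vgrp: "v \<in> verts \<G> \<Longrightarrow> countable (carrier (vgrp \<G> v))"
begin

abbreviation "X \<equiv> gog_gens \<G>"
abbreviation "R \<equiv> gog_rels \<G> T"
abbreviation "P \<equiv> fundamental_group \<G> T"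

sublocale P: group P
  unfolding fundamental_group_def by (rule group_presented_group)

lemma edge_simps [simp]:
  assumes "e \<in> edges \<G>"
  shows "src \<G> e \<in> verts \<G>" "tgt \<G> e \<in> verts \<G>" "opp \<G> e \<in> edges \<G>" "opp \<G> (opp \<G> e) = e"
    "src \<G> (opp \<G> e) = tgt \<G> e" "tgt \<G> (opp \<G> e) = src \<G> e" "opp \<G> e \<noteq> e"
    "egrp \<G> (opp \<G> e) = egrp \<G> e"
  using gog assms unfolding graph_of_groups_def serre_graph_def by metis+

lemma group_vgrp [simp]: "v \<in> verts \<G> \<Longrightarrow> group (vgrp \<G> v)"
  using gog by (simp add: graph_of_groups_def)

lemma group_egrp [simp]: "e \<in> edges \<G> \<Longrightarrow> group (egrp \<G> e)"
  using gog by (simp add: graph_of_groups_def)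

lemma emb_mon: "e \<in> edges \<G> \<Longrightarrow> emb \<G> e \<in> mon (egrp \<G> e) (vgrp \<G> (tgt \<G> e))"
  using gog by (simp add: graph_of_groups_def)

lemma emb_opp_mon: "e \<in> edges \<G> \<Longrightarrow> emb \<G> (opp \<G> e) \<in> mon (egrp \<G> e) (vgrp \<G> (src \<G> e))"
  using emb_mon[of "opp \<G> e"] by simp

lemma emb_closed [simp]:
  "e \<in> edges \<G> \<Longrightarrow> a \<in> carrier (egrp \<G> e) \<Longrightarrow> emb \<G> e a \<in> carrier (vgrp \<G> (tgt \<G> e))"
  "e \<in> edges \<G> \<Longrightarrow> a \<in> carrier (egrp \<G> e) \<Longrightarrow> emb \<G> (opp \<G> e) a \<in> carrier (vgrp \<G> (src \<G> e))"
  using emb_mon[of e] emb_opp_mon[of e] by (auto simp: mon_def hom_def)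

lemma T_edges: "e \<in> T \<Longrightarrow> e \<in> edges \<G>"
  using max_tree by (auto simp: maximal_tree_def)

lemma VElt_gens [simp]: "VElt v g \<in> X \<longleftrightarrow> v \<in> verts \<G> \<and> g \<in> carrier (vgrp \<G> v)"
  by (auto simp: gog_gens_def)

lemma Edge_gens [simp]: "Edge e \<in> X \<longleftrightarrow> e \<in> edges \<G>"
  by (auto simp: gog_gens_def)

lemma verts_nonempty: "verts \<G> \<noteq> {}"
  using gog by (simp add: graph_of_groups_def connected_graph_def)

lemma spanning_potential:
  fixes D :: "'v \<Rightarrow> 'd set" and F :: "'e \<Rightarrow> 'd \<Rightarrow> 'd"
  assumes "v0 \<in> verts \<G>" "x0 \<in> D v0"
    and "\<And>e x. e \<in> T \<Longrightarrow> x \<in> D (src \<G> e) \<Longrightarrow> F e x \<in> D (tgt \<G> e)"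
    and "\<And>e x. e \<in> T \<Longrightarrow> x \<in> D (src \<G> e) \<Longrightarrow> F (opp \<G> e) (F e x) = x"
  shows "\<exists>c. (\<forall>v\<in>verts \<G>. c v \<in> D v) \<and> (\<forall>e\<in>T. c (tgt \<G> e) = F e (c (src \<G> e)))"
  using tree_potential[of "\<G>\<lparr>edges := T\<rparr>" v0 x0 D F] assms max_tree finite_verts
  by (simp add: maximal_tree_def)

definition \<iota> :: "'v \<Rightarrow> 'g \<Rightarrow> ('v, 'e, 'g) gog_gen word set"
  where "\<iota> v g = wclass X R [(VElt v g, True)]"

definition \<tau> :: "'e \<Rightarrow> ('v, 'e, 'g) gog_gen word set"
  where "\<tau> e = wclass X R [(Edge e, True)]"

lemma \<iota>_closed [simp]: "v \<in> verts \<G> \<Longrightarrow> g \<in> carrier (vgrp \<G> v) \<Longrightarrow> \<iota> v g \<in> carrier P"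
  by (simp add: \<iota>_def fundamental_group_def wclass_closed)

lemma \<tau>_closed [simp]: "e \<in> edges \<G> \<Longrightarrow> \<tau> e \<in> carrier P"
  by (simp add: \<tau>_def fundamental_group_def wclass_closed)

lemma \<iota>_hom: 
  assumes "v \<in> verts \<G>"
  shows "group_hom (vgrp \<G> v) P (\<iota> v)"
proof -
  have "\<iota> v (g \<otimes>\<^bsub>vgrp \<G> v\<^esub> h) = \<iota> v g \<otimes>\<^bsub>P\<^esub> \<iota> v h"
    if "g \<in> carrier (vgrp \<G> v)" "h \<in> carrier (vgrp \<G> v)" for g h
  proof -
    have c: "g \<otimes>\<^bsub>vgrp \<G> v\<^esub> h \<in> carrier (vgrp \<G> v)"
      using that assms by (simp add: group.is_monoid monoid.m_closed)
    have "([(VElt v g, True), (VElt v h, True)], [(VElt v (g \<otimes>\<^bsub>vgrp \<G> v\<^esub> h), True)]) \<in> R"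
      using that assms by (auto simp: gog_rels_def)
    from wclass_relation[OF this, of X] that assms c show ?thesis
      by (simp add: \<iota>_def fundamental_group_def wclass_append)
  qed
  then show ?thesis
    using assms by (auto simp: group_hom_def group_hom_axioms_def hom_def)
qed

lemma \<tau>_opp:
  assumes "e \<in> edges \<G>"
  shows "\<tau> (opp \<G> e) = inv\<^bsub>P\<^esub> \<tau> e"
proof -
  have "([(Edge (opp \<G> e), True)], [(Edge e, False)]) \<in> R"
    using assms by (auto simp: gog_rels_def)
  from wclass_relation[OF this, of X] assms show ?thesis
    by (simp add: \<tau>_def fundamental_group_def inv_wclass)
qed

lemma \<tau>_conj:
  assumes "e \<in> edges \<G>" "a \<in> carrier (egrp \<G> e)"
  shows "\<tau> e \<otimes>\<^bsub>P\<^esub> \<iota> (tgt \<G> e) (emb \<G> e a) \<otimes>\<^bsub>P\<^esub> inv\<^bsub>P\<^esub> \<tau> e = \<iota> (src \<G> e) (emb \<G> (opp \<G> e) a)"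
proof -
  have "([(Edge e, True), (VElt (tgt \<G> e) (emb \<G> e a), True), (Edge e, False)],
      [(VElt (src \<G> e) (emb \<G> (opp \<G> e) a), True)]) \<in> R"
    unfolding gog_rels_def using assms by blast
  from wclass_relation[OF this, of X] assms show ?thesis
    by (simp add: \<tau>_def \<iota>_def fundamental_group_def inv_wclass wclass_append)
qed

lemma \<tau>_tree:
  assumes "e \<in> T"
  shows "\<tau> e = \<one>\<^bsub>P\<^esub>"
proof -
  have "([(Edge e, True)], []) \<in> R"
    using assms by (auto simp: gog_rels_def)
  from wclass_relation[OF this, of X] T_edges[OF assms] show ?thesis
    by (simp add: \<tau>_def fundamental_group_def one_presented_group)
qed

text \<open>Make every vertex group act freely on \<open>vgrp v \<times> nat\<close>.  For an edge \<open>e\<close> both ends become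
  isomorphic free actions of \<open>egrp e\<close> with countably many orbits, so the vertex actions can be
  glued to an action of \<open>P\<close> on one set.\<close>

lemma \<iota>_inj:
  assumes v: "v \<in> verts \<G>"
  shows "inj_on (\<iota> v) (carrier (vgrp \<G> v))"
proof -
  define \<Omega> where "\<Omega> u = carrier (vgrp \<G> u) \<times> (UNIV :: nat set)" for u
  define mul where "mul u g s = (g \<otimes>\<^bsub>vgrp \<G> u\<^esub> fst s, snd s)" for u and g :: 'g and s :: "'g \<times> nat"
  have mul_closed: "mul u g s \<in> \<Omega> u" if "u \<in> verts \<G>" "g \<in> carrier (vgrp \<G> u)" "s \<in> \<Omega> u" for u g s
    using that by (auto simp: mul_def \<Omega>_def group.is_monoid monoid.m_closed)
  have mul_mult: "mul u (g \<otimes>\<^bsub>vgrp \<G> u\<^esub> h) s = mul u g (mul u h s)"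
    if "u \<in> verts \<G>" "g \<in> carrier (vgrp \<G> u)" "h \<in> carrier (vgrp \<G> u)" "s \<in> \<Omega> u" for u g h s
    using that by (auto simp: mul_def \<Omega>_def group.is_monoid monoid.m_assoc)
  have mul_one: "mul u \<one>\<^bsub>vgrp \<G> u\<^esub> s = s" if "u \<in> verts \<G>" "s \<in> \<Omega> u" for u s
    using that by (auto simp: mul_def \<Omega>_def group.is_monoid monoid.l_one)
  let ?E = "\<lambda>e. carrier (egrp \<G> e) \<times> (UNIV :: nat set)"
  have "\<exists>\<psi>. bij_betw \<psi> (?E e) (\<Omega> (tgt \<G> e)) \<and>
      (\<forall>a\<in>carrier (egrp \<G> e). \<forall>b\<in>carrier (egrp \<G> e). \<forall>k.
        \<psi> (a \<otimes>\<^bsub>egrp \<G> e\<^esub> b, k) = mul (tgt \<G> e) (emb \<G> e a) (\<psi> (b, k)))" if e: "e \<in> edges \<G>" for e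
    using free_orbit_coordinates[OF group_egrp[OF e] group_vgrp emb_mon[OF e]] e countable_vgrp
    by (simp add: \<Omega>_def mul_def)
  then obtain \<psi> where \<psi>: "\<And>e. e \<in> edges \<G> \<Longrightarrow> bij_betw (\<psi> e) (?E e) (\<Omega> (tgt \<G> e))"
    and \<psi>_mul: "\<And>e a b k. e \<in> edges \<G> \<Longrightarrow> a \<in> carrier (egrp \<G> e) \<Longrightarrow> b \<in> carrier (egrp \<G> e) \<Longrightarrow>
        \<psi> e (a \<otimes>\<^bsub>egrp \<G> e\<^esub> b, k) = mul (tgt \<G> e) (emb \<G> e a) (\<psi> e (b, k))"
    by metis
  \<comment> \<open>\<open>tr e\<close> carries the action of the edge group at the target of
    \<open>e\<close> to its action at the source.\<close>
  define tr where "tr e s = \<psi> (opp \<G> e) (inv_into (?E e) (\<psi> e) s)" for e s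
  have tr_\<psi>: "tr e (\<psi> e p) = \<psi> (opp \<G> e) p" if "e \<in> edges \<G>" "p \<in> ?E e" for e p
    using \<psi>[OF that(1)] that(2) by (simp add: tr_def bij_betw_inv_into_left)
  have \<psi>_opp: "bij_betw (\<psi> (opp \<G> e)) (?E e) (\<Omega> (src \<G> e))" if "e \<in> edges \<G>" for e
    using \<psi>[of "opp \<G> e"] that by simp
  have \<psi>_ex: "\<exists>p\<in>?E e. s = \<psi> e p" if "e \<in> edges \<G>" "s \<in> \<Omega> (tgt \<G> e)" for e s
  proof -
    have "s \<in> \<psi> e ` ?E e"
      using \<psi>[OF that(1)] that(2) by (simp add: bij_betw_def)
    then show ?thesis
      by blast
  qed
  have tr_closed: "tr e s \<in> \<Omega> (src \<G> e)" if e: "e \<in> edges \<G>" and s: "s \<in> \<Omega> (tgt \<G> e)" for e s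
  proof -
    obtain p where p: "p \<in> ?E e" "s = \<psi> e p"
      using \<psi>_ex[OF e s] by blast
    then show ?thesis
      using tr_\<psi>[OF e p(1)] bij_betw_apply[OF \<psi>_opp[OF e] p(1)] by simp
  qed
  have tr_opp: "tr (opp \<G> e) (tr e s) = s" if e: "e \<in> edges \<G>" and s: "s \<in> \<Omega> (tgt \<G> e)" for e s
  proof -
    obtain p where p: "p \<in> ?E e" "s = \<psi> e p"
      using \<psi>_ex[OF e s] by blast
    then show ?thesis
      using tr_\<psi>[OF e] tr_\<psi>[of "opp \<G> e" p] e by simp
  qed
  have tr_mul: "tr e (mul (tgt \<G> e) (emb \<G> e a) s) = mul (src \<G> e) (emb \<G> (opp \<G> e) a) (tr e s)"
    if e: "e \<in> edges \<G>" and a: "a \<in> carrier (egrp \<G> e)" and s: "s \<in> \<Omega> (tgt \<G> e)" for e a s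
  proof -
    obtain p where p: "p \<in> ?E e" "s = \<psi> e p"
      using \<psi>_ex[OF e s] by blast
    then obtain b k where bk: "p = (b, k)" "b \<in> carrier (egrp \<G> e)"
      by auto
    have c: "a \<otimes>\<^bsub>egrp \<G> e\<^esub> b \<in> carrier (egrp \<G> e)"
      using e a bk by (simp add: group.is_monoid monoid.m_closed)
    have "mul (tgt \<G> e) (emb \<G> e a) s = \<psi> e (a \<otimes>\<^bsub>egrp \<G> e\<^esub> b, k)"
      using \<psi>_mul[OF e a bk(2)] p bk by simp
    then have "tr e (mul (tgt \<G> e) (emb \<G> e a) s) = \<psi> (opp \<G> e) (a \<otimes>\<^bsub>egrp \<G> e\<^esub> b, k)"
      using tr_\<psi>[OF e, of "(a \<otimes>\<^bsub>egrp \<G> e\<^esub> b, k)"] c by simp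
    also have "\<dots> = mul (src \<G> e) (emb \<G> (opp \<G> e) a) (\<psi> (opp \<G> e) (b, k))"
      using \<psi>_mul[of "opp \<G> e" a b k] e a bk by simp
    also have "\<psi> (opp \<G> e) (b, k) = tr e s"
      using tr_\<psi>[OF e p(1)] p bk by simp
    finally show ?thesis .
  qed
  have tr_bij: "bij_betw (tr e) (\<Omega> (tgt \<G> e)) (\<Omega> (src \<G> e))" if e: "e \<in> edges \<G>" for e
    by (rule bij_betw_byWitness[where f' = "tr (opp \<G> e)"])
      (use e tr_opp tr_opp[of "opp \<G> e"] tr_closed tr_closed[of "opp \<G> e"] in auto)
  define D where "D u = {f. bij_betw f (\<Omega> u) (\<Omega> v) \<and> f \<in> extensional (\<Omega> u)}" for u
  have "\<exists>c. (\<forall>u\<in>verts \<G>. c u \<in> D u) \<and>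
      (\<forall>e\<in>T. c (tgt \<G> e) = restrict (c (src \<G> e) \<circ> tr e) (\<Omega> (tgt \<G> e)))"
  proof (rule spanning_potential[OF v])
    have "bij_betw (\<lambda>x. x) (\<Omega> v) (\<Omega> v)"
      using bij_betw_id[of "\<Omega> v"] by (simp add: id_def)
    then have "bij_betw (restrict (\<lambda>x. x) (\<Omega> v)) (\<Omega> v) (\<Omega> v)"
      by (subst bij_betw_cong[where g = "\<lambda>x. x"]) auto
    then show "restrict (\<lambda>x. x) (\<Omega> v) \<in> D v"
      by (simp add: D_def)
  next
    fix e f assume e: "e \<in> T" and f: "f \<in> D (src \<G> e)"
    note eE = T_edges[OF e]
    have "bij_betw (f \<circ> tr e) (\<Omega> (tgt \<G> e)) (\<Omega> v)"
      by (rule bij_betw_trans[OF tr_bij[OF eE]]) (use f in \<open>simp add: D_def\<close>)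
    then have "bij_betw (restrict (f \<circ> tr e) (\<Omega> (tgt \<G> e))) (\<Omega> (tgt \<G> e)) (\<Omega> v)"
      by (subst bij_betw_cong[where g = "f \<circ> tr e"]) auto
    then show "restrict (f \<circ> tr e) (\<Omega> (tgt \<G> e)) \<in> D (tgt \<G> e)"
      by (simp add: D_def)
    show "restrict (restrict (f \<circ> tr e) (\<Omega> (tgt \<G> e)) \<circ> tr (opp \<G> e)) (\<Omega> (tgt \<G> (opp \<G> e))) = f"
    proof (rule extensionalityI[where A = "\<Omega> (src \<G> e)"])
      fix s assume s: "s \<in> \<Omega> (src \<G> e)"
      then show "restrict (restrict (f \<circ> tr e) (\<Omega> (tgt \<G> e)) \<circ> tr (opp \<G> e)) (\<Omega> (tgt \<G> (opp \<G> e))) s = f s"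
        using eE tr_closed[of "opp \<G> e" s] tr_opp[of "opp \<G> e" s] by simp
    qed (use f eE in \<open>auto simp: D_def\<close>)
  qed
  then obtain c where c_D: "\<And>u. u \<in> verts \<G> \<Longrightarrow> c u \<in> D u"
    and c_eq: "\<And>e. e \<in> T \<Longrightarrow> c (tgt \<G> e) = restrict (c (src \<G> e) \<circ> tr e) (\<Omega> (tgt \<G> e))"
    by blast
  have c: "bij_betw (c u) (\<Omega> u) (\<Omega> v)" if "u \<in> verts \<G>" for u
    using c_D[OF that] by (simp add: D_def)
  have c_T: "c (tgt \<G> e) s = c (src \<G> e) (tr e s)" if "e \<in> T" "s \<in> \<Omega> (tgt \<G> e)" for e s
    using fun_cong[OF c_eq[OF that(1)], of s] that(2) by simp
  define ci where "ci u = inv_into (\<Omega> u) (c u)" for u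
  have c_closed: "c u s \<in> \<Omega> v" if "u \<in> verts \<G>" "s \<in> \<Omega> u" for u s
    using bij_betwE[OF c[OF that(1)]] that(2) by simp
  have ci_closed: "ci u s \<in> \<Omega> u" if "u \<in> verts \<G>" "s \<in> \<Omega> v" for u s
    using bij_betwE[OF bij_betw_inv_into[OF c[OF that(1)]]] that(2) by (simp add: ci_def)
  have ci_c: "ci u (c u s) = s" if "u \<in> verts \<G>" "s \<in> \<Omega> u" for u s
    using bij_betw_inv_into_left[OF c[OF that(1)] that(2)] by (simp add: ci_def)
  have c_ci: "c u (ci u s) = s" if "u \<in> verts \<G>" "s \<in> \<Omega> v" for u s
    using bij_betw_inv_into_right[OF c[OF that(1)] that(2)] by (simp add: ci_def)
  \<comment> \<open>Every letter acts on the set at \<open>v\<close> through the coordinates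
    \<open>c\<close>. These are compatible with \<open>tr\<close> along \<open>T\<close>, so the
    edges of the maximal tree act trivially.\<close>
  define F where "F x b s = (case x of
      VElt u g \<Rightarrow> c u (mul u (if b then g else inv\<^bsub>vgrp \<G> u\<^esub> g) (ci u s))
    | Edge e \<Rightarrow> if b then c (src \<G> e) (tr e (ci (tgt \<G> e) s)) else c (tgt \<G> e) (tr (opp \<G> e) (ci (src \<G> e) s)))"
    for x b s
  have tr_closed': "tr (opp \<G> e) s \<in> \<Omega> (tgt \<G> e)" if "e \<in> edges \<G>" "s \<in> \<Omega> (src \<G> e)" for e s
    using tr_closed[of "opp \<G> e" s] that by simp
  have tr_opp': "tr e (tr (opp \<G> e) s) = s" if "e \<in> edges \<G>" "s \<in> \<Omega> (src \<G> e)" for e s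
    using tr_opp[of "opp \<G> e" s] that by simp
  interpret B0: presented_act X R "\<Omega> v" F
  proof
    fix x b s assume x: "x \<in> X" and s: "s \<in> \<Omega> v"
    show "F x b s \<in> \<Omega> v"
    proof (cases x)
      case (VElt u g)
      then show ?thesis
        using x s by (auto simp: F_def intro!: c_closed mul_closed ci_closed)
    next
      case (Edge e)
      then show ?thesis
        using x s by (auto simp: F_def intro!: c_closed tr_closed tr_closed' ci_closed)
    qed
    show "F x b (F x (\<not> b) s) = s"
    proof (cases x)
      case (VElt u g)
      then have u: "u \<in> verts \<G>" "g \<in> carrier (vgrp \<G> u)" "inv\<^bsub>vgrp \<G> u\<^esub> g \<in> carrier (vgrp \<G> u)"
        using x by auto
      then have "mul u g (mul u (inv\<^bsub>vgrp \<G> u\<^esub> g) (ci u s)) = ci u s"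
        "mul u (inv\<^bsub>vgrp \<G> u\<^esub> g) (mul u g (ci u s)) = ci u s"
        using s ci_closed by (simp_all add: mul_mult[symmetric] mul_one group.r_inv group.l_inv)
      then show ?thesis
        using VElt u s by (simp add: F_def ci_c mul_closed ci_closed c_ci)
    next
      case (Edge e)
      then show ?thesis
        using x s by (simp add: F_def ci_c tr_closed tr_closed' ci_closed tr_opp tr_opp' c_ci)
    qed
  next
    fix l r s assume lr: "(l, r) \<in> R" and s: "s \<in> \<Omega> v"
    from lr show "run F l s = run F r s"
      unfolding gog_rels_def
    proof (elim UnE CollectE exE conjE)
      fix u g h
      assume "(l, r) = ([(VElt u g, True), (VElt u h, True)], [(VElt u (g \<otimes>\<^bsub>vgrp \<G> u\<^esub> h), True)])"
        and "u \<in> verts \<G>" "g \<in> carrier (vgrp \<G> u)" "h \<in> carrier (vgrp \<G> u)"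
      then show ?thesis
        using s by (simp add: F_def ci_c mul_closed ci_closed mul_mult)
    next
      fix e
      assume "(l, r) = ([(Edge (opp \<G> e), True)], [(Edge e, False)])" "e \<in> edges \<G>"
      then show ?thesis
        by (simp add: F_def)
    next
      fix e a
      assume "(l, r) = ([(Edge e, True), (VElt (tgt \<G> e) (emb \<G> e a), True), (Edge e, False)],
          [(VElt (src \<G> e) (emb \<G> (opp \<G> e) a), True)])"
        and "e \<in> edges \<G>" "a \<in> carrier (egrp \<G> e)"
      then show ?thesis
        using s by (simp add: F_def ci_c mul_closed ci_closed tr_closed' tr_mul tr_opp')
    next
      fix e
      assume "(l, r) = ([(Edge e, True)], [])" "e \<in> T"
      then show ?thesis
        using s T_edges[of e] c_T[of e "ci (tgt \<G> e) s"] by (simp add: F_def ci_closed c_ci)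
    qed
  qed
  interpret \<iota>: group_hom "vgrp \<G> v" P "\<iota> v"
    by (rule \<iota>_hom[OF v])
  have "g = \<one>\<^bsub>vgrp \<G> v\<^esub>" if g: "g \<in> carrier (vgrp \<G> v)" and eq: "\<iota> v g = \<one>\<^bsub>P\<^esub>" for g
  proof -
    \<comment> \<open>Left multiplication by \<open>g\<close> fixes this point only if
      \<open>g\<close> is the identity.\<close>
    let ?s = "(\<one>\<^bsub>vgrp \<G> v\<^esub>, 0)"
    have s: "?s \<in> \<Omega> v"
      by (simp add: \<Omega>_def)
    have "pres_lift F (\<iota> v g) (c v ?s) = c v ?s"
      using eq c_closed[OF v s] B0.act_one by (simp add: fundamental_group_def)
    then have "c v (mul v g ?s) = c v ?s"
      using v g s c_closed[OF v s] by (simp add: \<iota>_def B0.pres_lift_gen F_def ci_c)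
    then have "mul v g ?s = ?s"
      using ci_c[OF v s] ci_c[OF v mul_closed[OF v g s]] by simp
    then show ?thesis
      using g by (simp add: mul_def)
  qed
  then show ?thesis
    using \<iota>.inj_on_one_iff by blast
qed

end

subsection \<open>The Bass--Serre tree\<close>

text \<open>A function \<open>\<chi>\<close> on pairs \<open>(e, g)\<close> is a set of lifts of oriented edges, and \<open>xr\<close> is symmetric
  difference.\<close>

definition xr :: "('e \<Rightarrow> 'p \<Rightarrow> bool) \<Rightarrow> ('e \<Rightarrow> 'p \<Rightarrow> bool) \<Rightarrow> 'e \<Rightarrow> 'p \<Rightarrow> bool"
  where "xr \<chi> \<chi>' = (\<lambda>e g. \<chi> e g \<noteq> \<chi>' e g)"

definition xr_zero :: "'e \<Rightarrow> 'p \<Rightarrow> bool"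
  where "xr_zero = (\<lambda>_ _. False)"

lemma xr_assoc: "xr (xr a b) c = xr a (xr b c)"
  by (auto simp: xr_def)

lemma xr_commute: "xr a b = xr b a"
  by (auto simp: xr_def)

lemma xr_left_commute: "xr a (xr b c) = xr b (xr a c)"
  by (auto simp: xr_def)

lemma xr_cancel [simp]:
  "xr a a = xr_zero" "xr a (xr a b) = b" "xr xr_zero a = a" "xr a xr_zero = a"
  by (auto simp: xr_def xr_zero_def)

lemmas xr_ac = xr_assoc xr_commute xr_left_commute

context group
begin

definition supported :: "('e \<Rightarrow> 'a \<Rightarrow> bool) set"
  where "supported = {\<chi>. \<forall>e g. \<chi> e g \<longrightarrow> g \<in> carrier G}"

definition shift :: "'a \<Rightarrow> ('e \<Rightarrow> 'a \<Rightarrow> bool) \<Rightarrow> 'e \<Rightarrow> 'a \<Rightarrow> bool"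
  where "shift h \<chi> = (\<lambda>e g. g \<in> carrier G \<and> \<chi> e (inv h \<otimes> g))"

lemma supported_xr [simp, intro]: "\<chi> \<in> supported \<Longrightarrow> \<chi>' \<in> supported \<Longrightarrow> xr \<chi> \<chi>' \<in> supported"
  by (auto simp: supported_def xr_def)

lemma supported_zero [simp]: "xr_zero \<in> supported"
  by (simp add: supported_def xr_zero_def)

lemma supported_shift [simp, intro]: "shift h \<chi> \<in> supported"
  by (simp add: supported_def shift_def)

lemma shift_xr [simp]: "shift h (xr \<chi> \<chi>') = xr (shift h \<chi>) (shift h \<chi>')"
  by (auto simp: shift_def xr_def)

lemma shift_zero [simp]: "shift h xr_zero = xr_zero"
  by (simp add: shift_def xr_zero_def)

lemma shift_one: "\<chi> \<in> supported \<Longrightarrow> shift \<one> \<chi> = \<chi>"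
  by (fastforce simp: shift_def supported_def)

lemma shift_shift: "h \<in> carrier G \<Longrightarrow> k \<in> carrier G \<Longrightarrow> shift h (shift k \<chi>) = shift (h \<otimes> k) \<chi>"
  by (auto simp: shift_def inv_mult_group m_assoc fun_eq_iff)

end

text \<open>For each of the finitely many images of \<open>y\<close> under \<open>fixer x\<close>
  one translate of the orbit of \<open>z\<close> under \<open>fixer y\<close> suffices to cover the
  orbit of \<open>z\<close> under \<open>fixer x\<close>.\<close>

lemma (in group_act) finite_fixer_orbit_trans:
  assumes "x \<in> \<Omega>" "y \<in> \<Omega>" "z \<in> \<Omega>"
    and "finite ((\<lambda>g. act g y) ` fixer x)" "finite ((\<lambda>g. act g z) ` fixer y)"
  shows "finite ((\<lambda>g. act g z) ` fixer x)"
proof -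
  define r where "r p = (SOME h. h \<in> fixer x \<and> act h y = p)" for p
  have "(\<lambda>g. act g z) ` fixer x \<subseteq> (\<Union>p\<in>(\<lambda>g. act g y) ` fixer x. act (r p) ` (\<lambda>g. act g z) ` fixer y)"
  proof clarify
    fix g assume g: "g \<in> fixer x"
    let ?h = "r (act g y)"
    have h: "?h \<in> fixer x \<and> act ?h y = act g y"
      unfolding r_def by (rule someI[of _ g]) (use g in simp)
    then have "inv ?h \<otimes> g \<in> fixer y"
      using g assms(1-3) by (auto simp: fixer_def act_mult act_inv_eq_iff)
    moreover have "act g z = act ?h (act (inv ?h \<otimes> g) z)"
      using g h assms(1-3) by (simp add: fixer_def act_mult)
    ultimately show "act g z \<in> (\<Union>p\<in>(\<lambda>g. act g y) ` fixer x. act (r p) ` (\<lambda>g. act g z) ` fixer y)"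
      using g by blast
  qed
  moreover have "finite (\<Union>p\<in>(\<lambda>g. act g y) ` fixer x. act (r p) ` (\<lambda>g. act g z) ` fixer y)"
    by (intro finite_UN_I assms(4) finite_imageI[OF assms(5)])
  ultimately show ?thesis
    by (rule finite_subset)
qed

section \<open>Cosets of the vertex groups and names of lifted edges\<close>

context spanned_gog
begin

definition B :: "'v \<Rightarrow> ('v, 'e, 'g) gog_gen word set set"
  where "B v = \<iota> v ` carrier (vgrp \<G> v)"

text \<open>The image of the edge group on the source side, where \<open>emb\<close> of the opposite
  edge lands; it stabilizes the base lift of \<open>e\<close>.\<close>

definition A :: "'e \<Rightarrow> ('v, 'e, 'g) gog_gen word set set"
  where "A e = (\<lambda>a. \<iota> (src \<G> e) (emb \<G> (opp \<G> e) a)) ` carrier (egrp \<G> e)"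

lemma subgroup_B: "v \<in> verts \<G> \<Longrightarrow> subgroup (B v) P"
  using group_hom.img_is_subgroup[OF \<iota>_hom] by (simp add: B_def)

lemma subgroup_A: 
  assumes e: "e \<in> edges \<G>"
  shows "subgroup (A e) P"
proof -
  interpret \<iota>: group_hom "vgrp \<G> (src \<G> e)" P "\<iota> (src \<G> e)"
    using e by (simp add: \<iota>_hom)
  have "\<iota> (src \<G> e) \<circ> emb \<G> (opp \<G> e) \<in> hom (egrp \<G> e) P"
    using emb_opp_mon[OF e] \<iota>.homh by (auto simp: mon_def intro: hom_compose)
  then have "group_hom (egrp \<G> e) P (\<iota> (src \<G> e) \<circ> emb \<G> (opp \<G> e))"
    using e by (simp add: group_hom_def group_hom_axioms_def)
  then show ?thesis
    using group_hom.img_is_subgroup by (fastforce simp: A_def)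
qed

lemma A_B: "e \<in> edges \<G> \<Longrightarrow> A e \<subseteq> B (src \<G> e)"
  by (auto simp: A_def B_def)

lemma A_conj:
  assumes e: "e \<in> edges \<G>" and a: "a \<in> A e"
  shows "inv\<^bsub>P\<^esub> \<tau> e \<otimes>\<^bsub>P\<^esub> a \<otimes>\<^bsub>P\<^esub> \<tau> e \<in> A (opp \<G> e)"
proof -
  obtain b where b: "b \<in> carrier (egrp \<G> e)" "a = \<iota> (src \<G> e) (emb \<G> (opp \<G> e) b)"
    using a by (auto simp: A_def)
  have "inv\<^bsub>P\<^esub> \<tau> e \<otimes>\<^bsub>P\<^esub> a \<otimes>\<^bsub>P\<^esub> \<tau> e = \<iota> (tgt \<G> e) (emb \<G> e b)"
    using e b by (simp add: \<tau>_conj[symmetric] P.m_assoc) (simp add: P.m_assoc[symmetric])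
  then show ?thesis
    using e b by (auto simp: A_def)
qed

text \<open>A pair \<open>(f, g)\<close> names the translate by \<open>g\<close> of the base lift of
  \<open>f\<close>. This is the set of all names of the base lift of \<open>e\<close> and of its
  reverse.\<close>

definition \<delta> :: "'e \<Rightarrow> 'e \<Rightarrow> ('v, 'e, 'g) gog_gen word set \<Rightarrow> bool"
  where "\<delta> e f g \<longleftrightarrow> g \<in> carrier P \<and> (f = e \<and> g \<in> A e \<or> f = opp \<G> e \<and> inv\<^bsub>P\<^esub> \<tau> e \<otimes>\<^bsub>P\<^esub> g \<in> A (opp \<G> e))"

lemma supported_\<delta> [simp]: "\<delta> e \<in> P.supported"
  by (simp add: P.supported_def \<delta>_def)

text \<open>Translation by \<open>\<tau> e\<close> carries the base lift of the opposite edge to the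
  reversed base lift of \<open>e\<close>, and \<open>\<delta>\<close> disregards
  orientation.\<close>

lemma shift_\<delta>_opp:
  assumes e: "e \<in> edges \<G>"
  shows "P.shift (\<tau> e) (\<delta> (opp \<G> e)) = \<delta> e"
  using e by (auto simp: P.shift_def \<delta>_def fun_eq_iff \<tau>_opp P.m_assoc[symmetric])

lemma shift_\<delta>_stab:
  assumes e: "e \<in> edges \<G>" and a: "a \<in> A e"
  shows "P.shift a (\<delta> e) = \<delta> e"
proof (intro ext)
  fix f g
  have ac: "a \<in> carrier P"
    using subgroup.mem_carrier[OF subgroup_A[OF e] a] .
  have mem_iff: "h \<otimes>\<^bsub>P\<^esub> g \<in> H \<longleftrightarrow> g \<in> H" if "subgroup H P" "h \<in> H" "g \<in> carrier P" for h g H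
  proof
    assume "h \<otimes>\<^bsub>P\<^esub> g \<in> H"
    then have "inv\<^bsub>P\<^esub> h \<otimes>\<^bsub>P\<^esub> (h \<otimes>\<^bsub>P\<^esub> g) \<in> H"
      using that subgroup.m_closed subgroup.m_inv_closed by metis
    then show "g \<in> H"
      using that subgroup.mem_carrier[OF that(1,2)] by (simp add: P.m_assoc[symmetric])
  qed (use that subgroup.m_closed in metis)
  have inv_a: "inv\<^bsub>P\<^esub> a \<in> A e"
    using subgroup.m_inv_closed[OF subgroup_A[OF e] a] .
  show "P.shift a (\<delta> e) f g = \<delta> e f g"
  proof (cases "g \<in> carrier P")
    case True
    have "inv\<^bsub>P\<^esub> \<tau> e \<otimes>\<^bsub>P\<^esub> (inv\<^bsub>P\<^esub> a \<otimes>\<^bsub>P\<^esub> g)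
      = (inv\<^bsub>P\<^esub> \<tau> e \<otimes>\<^bsub>P\<^esub> inv\<^bsub>P\<^esub> a \<otimes>\<^bsub>P\<^esub> \<tau> e) \<otimes>\<^bsub>P\<^esub> (inv\<^bsub>P\<^esub> \<tau> e \<otimes>\<^bsub>P\<^esub> g)"
      using e ac True by (simp add: P.m_assoc) (simp add: P.m_assoc[symmetric])
    then show ?thesis
      using mem_iff[OF subgroup_A[OF e] inv_a True] ac True e
        mem_iff[OF subgroup_A A_conj[OF e inv_a], of "inv\<^bsub>P\<^esub> \<tau> e \<otimes>\<^bsub>P\<^esub> g"]
      by (simp add: P.shift_def \<delta>_def)
  qed (simp add: P.shift_def \<delta>_def)
qed

text \<open>The label \<open>v\<close> keeps cosets of different vertex groups apart even when they
  coincide as sets.\<close>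

definition vx :: "'v \<Rightarrow> ('v, 'e, 'g) gog_gen word set \<Rightarrow> 'v \<times> ('v, 'e, 'g) gog_gen word set set"
  where "vx v g = (v, g <#\<^bsub>P\<^esub> B v)"

definition Vt :: "('v \<times> ('v, 'e, 'g) gog_gen word set set) set"
  where "Vt = {vx v g | v g. v \<in> verts \<G> \<and> g \<in> carrier P}"

definition actt :: "('v, 'e, 'g) gog_gen word set \<Rightarrow> 'v \<times> ('v, 'e, 'g) gog_gen word set set
    \<Rightarrow> 'v \<times> ('v, 'e, 'g) gog_gen word set set"
  where "actt h x = (fst x, h <#\<^bsub>P\<^esub> snd x)"

definition adjt :: "'v \<times> ('v, 'e, 'g) gog_gen word set set \<Rightarrow> 'v \<times> ('v, 'e, 'g) gog_gen word set set \<Rightarrow> bool"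
  where "adjt x y \<longleftrightarrow> (\<exists>e\<in>edges \<G>. \<exists>g\<in>carrier P. x = vx (src \<G> e) g \<and> y = vx (tgt \<G> e) (g \<otimes>\<^bsub>P\<^esub> \<tau> e))"

lemma B_carr: "v \<in> verts \<G> \<Longrightarrow> B v \<subseteq> carrier P"
  using subgroup_B subgroup.subset by blast

lemma vx_eq_iff:
  assumes "v \<in> verts \<G>" "g \<in> carrier P" "h \<in> carrier P"
  shows "vx v g = vx v h \<longleftrightarrow> inv\<^bsub>P\<^esub> g \<otimes>\<^bsub>P\<^esub> h \<in> B v"
proof
  assume "vx v g = vx v h"
  then have "g <#\<^bsub>P\<^esub> B v = h <#\<^bsub>P\<^esub> B v"
    by (simp add: vx_def)
  moreover have "h \<otimes>\<^bsub>P\<^esub> \<one>\<^bsub>P\<^esub> \<in> h <#\<^bsub>P\<^esub> B v"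
    using subgroup.one_closed[OF subgroup_B[OF assms(1)]] unfolding l_coset_def by blast
  ultimately have "h \<in> g <#\<^bsub>P\<^esub> B v"
    using assms by simp
  then obtain b where "b \<in> B v" "h = g \<otimes>\<^bsub>P\<^esub> b"
    by (auto simp: l_coset_def)
  then show "inv\<^bsub>P\<^esub> g \<otimes>\<^bsub>P\<^esub> h \<in> B v"
    using assms B_carr[OF assms(1)] by (auto simp: P.m_assoc[symmetric])
next
  assume "inv\<^bsub>P\<^esub> g \<otimes>\<^bsub>P\<^esub> h \<in> B v"
  then have "h \<in> g <#\<^bsub>P\<^esub> B v"
    using subgroup.lcos_module_rev[OF subgroup_B[OF assms(1)] P.is_group assms(2,3)] by blast
  then show "vx v g = vx v h"
    using P.l_repr_independence[OF _ assms(2) subgroup_B[OF assms(1)]] by (simp add: vx_def)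
qed

lemma vx_mult_B: "v \<in> verts \<G> \<Longrightarrow> g \<in> carrier P \<Longrightarrow> b \<in> B v \<Longrightarrow> vx v (g \<otimes>\<^bsub>P\<^esub> b) = vx v g"
  using vx_eq_iff[of v g "g \<otimes>\<^bsub>P\<^esub> b"] B_carr by (auto simp: P.m_assoc[symmetric] subset_iff)

lemma vx_edge_A:
  assumes e: "e \<in> edges \<G>" and g: "g \<in> carrier P" and a: "a \<in> A e"
  shows "vx (src \<G> e) (g \<otimes>\<^bsub>P\<^esub> a) = vx (src \<G> e) g"
    and "vx (tgt \<G> e) (g \<otimes>\<^bsub>P\<^esub> a \<otimes>\<^bsub>P\<^esub> \<tau> e) = vx (tgt \<G> e) (g \<otimes>\<^bsub>P\<^esub> \<tau> e)"
proof -
  have ac: "a \<in> carrier P"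
    using subgroup.mem_carrier[OF subgroup_A[OF e] a] .
  show "vx (src \<G> e) (g \<otimes>\<^bsub>P\<^esub> a) = vx (src \<G> e) g"
    using vx_mult_B[of "src \<G> e" g a] e g a A_B[OF e] by auto
  have "inv\<^bsub>P\<^esub> \<tau> e \<otimes>\<^bsub>P\<^esub> a \<otimes>\<^bsub>P\<^esub> \<tau> e \<in> B (tgt \<G> e)"
    using A_conj[OF e a] A_B[of "opp \<G> e"] e by auto
  moreover have "g \<otimes>\<^bsub>P\<^esub> \<tau> e \<otimes>\<^bsub>P\<^esub> (inv\<^bsub>P\<^esub> \<tau> e \<otimes>\<^bsub>P\<^esub> a \<otimes>\<^bsub>P\<^esub> \<tau> e) = g \<otimes>\<^bsub>P\<^esub> a \<otimes>\<^bsub>P\<^esub> \<tau> e"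
    using e g ac by (simp add: P.m_assoc) (simp add: P.m_assoc[symmetric])
  ultimately show "vx (tgt \<G> e) (g \<otimes>\<^bsub>P\<^esub> a \<otimes>\<^bsub>P\<^esub> \<tau> e) = vx (tgt \<G> e) (g \<otimes>\<^bsub>P\<^esub> \<tau> e)"
    using vx_mult_B[of "tgt \<G> e" "g \<otimes>\<^bsub>P\<^esub> \<tau> e"] e g by force
qed

lemma actt_vx: "v \<in> verts \<G> \<Longrightarrow> g \<in> carrier P \<Longrightarrow> h \<in> carrier P \<Longrightarrow> actt h (vx v g) = vx v (h \<otimes>\<^bsub>P\<^esub> g)"
  by (simp add: actt_def vx_def P.lcos_m_assoc B_carr)

lemma vx_Vt [simp]: "v \<in> verts \<G> \<Longrightarrow> g \<in> carrier P \<Longrightarrow> vx v g \<in> Vt"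
  by (auto simp: Vt_def)

sublocale t: group_act P Vt actt
proof unfold_locales
  fix g s assume "g \<in> carrier P" "s \<in> Vt"
  then show "actt g s \<in> Vt"
    by (auto simp: Vt_def actt_vx) (metis P.m_closed)
next
  fix s assume "s \<in> Vt"
  then show "actt \<one>\<^bsub>P\<^esub> s = s"
    by (auto simp: Vt_def actt_vx)
next
  fix g h s assume "g \<in> carrier P" "h \<in> carrier P" "s \<in> Vt"
  then show "actt (g \<otimes>\<^bsub>P\<^esub> h) s = actt g (actt h s)"
    by (auto simp: Vt_def actt_vx P.m_assoc)
qed

text \<open>The letters of the presentation act on sets of lifted edges by affine maps whose linear part
  is translation.  The orbit map of this action is a function \<open>ht\<close> on the vertices of the Bass--Serre
  tree that changes along an edge by exactly this edge, in both orientations; hence every edge is a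
  bridge.\<close>

lemma ex_height:
  "\<exists>ht :: 'v \<times> ('v, 'e, 'g) gog_gen word set set \<Rightarrow> 'e \<Rightarrow> ('v, 'e, 'g) gog_gen word set \<Rightarrow> bool.
    \<forall>e\<in>edges \<G>. \<forall>g\<in>carrier P.
      xr (ht (vx (src \<G> e) g)) (ht (vx (tgt \<G> e) (g \<otimes>\<^bsub>P\<^esub> \<tau> e))) = P.shift g (\<delta> e)"
proof -
  obtain v0 where v0: "v0 \<in> verts \<G>"
    using verts_nonempty by blast
  \<comment> \<open>\<open>c v\<close> is going to be the height of the base lift of
    \<open>v\<close>. Base lifts joined by an edge of \<open>T\<close> are adjacent, so their
    heights must differ by \<open>\<delta>\<close>.\<close>
  have "\<exists>c. (\<forall>v\<in>verts \<G>. c v \<in> (P.supported :: ('e \<Rightarrow> _ \<Rightarrow> bool) set)) \<and>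
      (\<forall>e\<in>T. c (tgt \<G> e) = xr (c (src \<G> e)) (\<delta> e))"
  proof (rule spanning_potential[of v0 xr_zero, OF v0])
    fix e and \<chi> :: "'e \<Rightarrow> ('v, 'e, 'g) gog_gen word set \<Rightarrow> bool"
    assume e: "e \<in> T"
    have "\<delta> (opp \<G> e) = \<delta> e"
      using shift_\<delta>_opp[OF T_edges[OF e]] \<tau>_tree[OF e] by (simp add: P.shift_one)
    then show "xr (xr \<chi> (\<delta> e)) (\<delta> (opp \<G> e)) = \<chi>"
      by (simp add: xr_assoc)
  qed auto
  then obtain c :: "'v \<Rightarrow> 'e \<Rightarrow> ('v, 'e, 'g) gog_gen word set \<Rightarrow> bool"
    where c [simp]: "\<And>v. v \<in> verts \<G> \<Longrightarrow> c v \<in> P.supported"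
      and c_T: "\<And>e. e \<in> T \<Longrightarrow> c (tgt \<G> e) = xr (c (src \<G> e)) (\<delta> e)"
    by blast
  \<comment> \<open>The affine map with translation by \<open>\<tau> e\<close> as linear part that
    sends \<open>c (tgt e)\<close> to \<open>c (src e)\<close> changed by
    \<open>\<delta> e\<close>.\<close>
  define edge where "edge e \<chi> = xr (P.shift (\<tau> e) (xr \<chi> (c (tgt \<G> e)))) (xr (\<delta> e) (c (src \<G> e)))" for e \<chi>
  \<comment> \<open>Letters of a vertex group are affine maps fixing \<open>c v\<close>; this will
    make the height well defined on cosets.\<close>
  define F where "F x b \<chi> = (case x of
      VElt v g \<Rightarrow> xr (P.shift (\<iota> v (if b then g else inv\<^bsub>vgrp \<G> v\<^esub> g)) (xr \<chi> (c v))) (c v)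
    | Edge e \<Rightarrow> if b then edge e \<chi> else edge (opp \<G> e) \<chi>)" for x b \<chi>
  have edge_opp: "edge e (edge (opp \<G> e) \<chi>) = \<chi>" if e: "e \<in> edges \<G>" and \<chi>: "\<chi> \<in> P.supported" for e \<chi>
    using e \<chi> shift_\<delta>_opp[OF e]
    by (simp add: edge_def P.shift_shift \<tau>_opp P.shift_one xr_ac)
  interpret B0: presented_act X R "P.supported :: ('e \<Rightarrow> _ \<Rightarrow> bool) set" F
  proof
    fix x b and \<chi> :: "'e \<Rightarrow> ('v, 'e, 'g) gog_gen word set \<Rightarrow> bool"
    assume x: "x \<in> X" and \<chi>: "\<chi> \<in> P.supported"
    show "F x b \<chi> \<in> P.supported"
      using x by (cases x) (auto simp: F_def edge_def)
    show "F x b (F x (\<not> b) \<chi>) = \<chi>"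
    proof (cases x)
      case (VElt v g)
      then have v: "v \<in> verts \<G>" "g \<in> carrier (vgrp \<G> v)"
        using x by auto
      interpret \<iota>: group_hom "vgrp \<G> v" P "\<iota> v"
        by (rule \<iota>_hom[OF v(1)])
      show ?thesis
        using VElt v \<chi> by (simp add: F_def P.shift_shift P.shift_one xr_ac)
    next
      case (Edge e)
      then show ?thesis
        using x \<chi> edge_opp[of e] edge_opp[of "opp \<G> e"] by (simp add: F_def)
    qed
  next
    fix l r and \<chi> :: "'e \<Rightarrow> ('v, 'e, 'g) gog_gen word set \<Rightarrow> bool"
    assume lr: "(l, r) \<in> R" and \<chi>: "\<chi> \<in> P.supported"
    from lr show "run F l \<chi> = run F r \<chi>"
      unfolding gog_rels_def
    proof (elim UnE CollectE exE conjE)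
      fix u g h
      assume u: "(l, r) = ([(VElt u g, True), (VElt u h, True)], [(VElt u (g \<otimes>\<^bsub>vgrp \<G> u\<^esub> h), True)])"
        "u \<in> verts \<G>" "g \<in> carrier (vgrp \<G> u)" "h \<in> carrier (vgrp \<G> u)"
      interpret \<iota>: group_hom "vgrp \<G> u" P "\<iota> u"
        by (rule \<iota>_hom[OF u(2)])
      show ?thesis
        using u by (simp add: F_def P.shift_shift xr_ac)
    next
      fix e
      assume "(l, r) = ([(Edge (opp \<G> e), True)], [(Edge e, False)])" "e \<in> edges \<G>"
      then show ?thesis
        by (simp add: F_def)
    next
      fix e a
      assume lr: "(l, r) = ([(Edge e, True), (VElt (tgt \<G> e) (emb \<G> e a), True), (Edge e, False)],
          [(VElt (src \<G> e) (emb \<G> (opp \<G> e) a), True)])"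
        and e: "e \<in> edges \<G>" and a: "a \<in> carrier (egrp \<G> e)"
      let ?b = "\<iota> (tgt \<G> e) (emb \<G> e a)"
      have "?b \<in> A (opp \<G> e)"
        using e a by (auto simp: A_def)
      then have fix_b: "P.shift ?b (\<delta> (opp \<G> e)) = \<delta> (opp \<G> e)"
        using shift_\<delta>_stab[of "opp \<G> e"] e by simp
      have b: "?b \<in> carrier P"
        using e a by simp
      have shift3: "P.shift (\<tau> e) (P.shift ?b (P.shift (\<tau> (opp \<G> e)) \<chi>'))
          = P.shift (\<iota> (src \<G> e) (emb \<G> (opp \<G> e) a)) \<chi>'" for \<chi>' :: "'e \<Rightarrow> _ \<Rightarrow> bool"
        using e a b by (simp add: P.shift_shift \<tau>_opp \<tau>_conj[symmetric] P.m_assoc)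
      show ?thesis
        using lr e shift_\<delta>_opp[OF e] fix_b shift3
        by (simp add: F_def edge_def xr_ac)
    next
      fix e
      assume "(l, r) = ([(Edge e, True)], [])" "e \<in> T"
      then show ?thesis
        using \<chi> T_edges[of e] c_T[of e] \<tau>_tree[of e] by (simp add: F_def edge_def P.shift_one xr_ac)
    qed
  qed
  interpret act: group_act P "P.supported :: ('e \<Rightarrow> _ \<Rightarrow> bool) set" "pres_lift F"
    by (rule B0.group_act_axioms[folded fundamental_group_def])
  have letter: "F x b (xr \<chi> \<chi>') = xr (F x b \<chi>) (P.shift (wclass X R [(x, b)]) \<chi>')" if x: "x \<in> X" for x b \<chi> \<chi>'
  proof (cases x)
    case (VElt v g)
    then have v: "v \<in> verts \<G>" "g \<in> carrier (vgrp \<G> v)"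
      using x by auto
    interpret \<iota>: group_hom "vgrp \<G> v" P "\<iota> v"
      by (rule \<iota>_hom[OF v(1)])
    have "wclass X R [(x, b)] = \<iota> v (if b then g else inv\<^bsub>vgrp \<G> v\<^esub> g)"
      using VElt v inv_wclass[OF x, of R True] by (cases b) (simp_all add: \<iota>_def[of v g] fundamental_group_def)
    then show ?thesis
      using VElt by (simp add: F_def xr_ac)
  next
    case (Edge e)
    then have "wclass X R [(x, b)] = \<tau> (if b then e else opp \<G> e)"
      using x inv_wclass[OF x, of R True] by (cases b) (simp_all add: \<tau>_opp \<tau>_def[of e] fundamental_group_def)
    then show ?thesis
      using Edge by (simp add: F_def edge_def xr_ac)
  qed
  \<comment> \<open>The equation for the base lift of an edge is thereby transported to all its
    translates.\<close>
  have affine: "pres_lift F g (xr \<chi> \<chi>') = xr (pres_lift F g \<chi>) (P.shift g \<chi>')"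
    if "g \<in> carrier P" and \<chi>: "\<chi> \<in> P.supported" "\<chi>' \<in> P.supported" for g \<chi> \<chi>'
    using that(1) unfolding fundamental_group_def
  proof (induction rule: presented_group_induct)
    case one
    have "pres_lift F \<one>\<^bsub>P\<^esub> (xr \<chi> \<chi>') = xr (pres_lift F \<one>\<^bsub>P\<^esub> \<chi>) (P.shift \<one>\<^bsub>P\<^esub> \<chi>')"
      using \<chi> by (simp add: P.shift_one)
    then show ?case
      by (simp add: fundamental_group_def)
  next
    case (gen x b g)
    let ?s = "wclass X R [(x, b)]"
    have s: "?s \<in> carrier P" "g \<in> carrier P"
      using gen(1,2) by (simp_all add: fundamental_group_def wclass_closed)
    have IH: "pres_lift F g (xr \<chi> \<chi>') = xr (pres_lift F g \<chi>) (P.shift g \<chi>')"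
      using gen(3) by (simp add: fundamental_group_def)
    have "pres_lift F (?s \<otimes>\<^bsub>P\<^esub> g) (xr \<chi> \<chi>') = xr (pres_lift F (?s \<otimes>\<^bsub>P\<^esub> g) \<chi>) (P.shift (?s \<otimes>\<^bsub>P\<^esub> g) \<chi>')"
      using s \<chi> IH gen(1) by (simp add: act.act_mult B0.pres_lift_gen letter P.shift_shift)
    then show ?case
      by (simp add: fundamental_group_def)
  qed
  have act_\<iota>: "pres_lift F (\<iota> v a) (c v) = c v" if "v \<in> verts \<G>" "a \<in> carrier (vgrp \<G> v)" for v a
    using that by (simp add: \<iota>_def B0.pres_lift_gen) (simp add: F_def)
  have act_\<tau>: "pres_lift F (\<tau> e) (c (tgt \<G> e)) = xr (c (src \<G> e)) (\<delta> e)" if "e \<in> edges \<G>" for e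
    using that by (simp add: \<tau>_def B0.pres_lift_gen) (simp add: F_def edge_def xr_ac)
  define ht where "ht x = pres_lift F (SOME g. g \<in> snd x) (c (fst x))" for x :: "'v \<times> ('v, 'e, 'g) gog_gen word set set"
  have ht_vx: "ht (vx v g) = pres_lift F g (c v)" if v: "v \<in> verts \<G>" and g: "g \<in> carrier P" for v g
  proof -
    let ?h = "SOME h. h \<in> g <#\<^bsub>P\<^esub> B v"
    have "g \<otimes>\<^bsub>P\<^esub> \<one>\<^bsub>P\<^esub> \<in> g <#\<^bsub>P\<^esub> B v"
      using subgroup.one_closed[OF subgroup_B[OF v]] unfolding l_coset_def by blast
    then have "?h \<in> g <#\<^bsub>P\<^esub> B v"
      by (rule someI)
    then obtain a where a: "a \<in> carrier (vgrp \<G> v)" "?h = g \<otimes>\<^bsub>P\<^esub> \<iota> v a"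
      by (auto simp: l_coset_def B_def)
    have "ht (vx v g) = pres_lift F (g \<otimes>\<^bsub>P\<^esub> \<iota> v a) (c v)"
      unfolding ht_def vx_def by (simp add: a(2))
    then show ?thesis
      using v g a(1) by (simp add: act.act_mult act_\<iota>)
  qed
  have "xr (ht (vx (src \<G> e) g)) (ht (vx (tgt \<G> e) (g \<otimes>\<^bsub>P\<^esub> \<tau> e))) = P.shift g (\<delta> e)"
    if "e \<in> edges \<G>" "g \<in> carrier P" for e g
    using that by (simp add: ht_vx act.act_mult act_\<tau> affine)
  then show ?thesis
    by blast
qed

section \<open>The coset graph is a tree\<close>

lemma adjt_Vt: "adjt x y \<Longrightarrow> x \<in> Vt \<and> y \<in> Vt"
  by (auto simp: adjt_def)

lemma adjt_sym:
  assumes "adjt x y"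
  shows "adjt y x"
proof -
  obtain e g where e: "e \<in> edges \<G>" "g \<in> carrier P" "x = vx (src \<G> e) g" "y = vx (tgt \<G> e) (g \<otimes>\<^bsub>P\<^esub> \<tau> e)"
    using assms by (auto simp: adjt_def)
  have "x = vx (tgt \<G> (opp \<G> e)) (g \<otimes>\<^bsub>P\<^esub> \<tau> e \<otimes>\<^bsub>P\<^esub> \<tau> (opp \<G> e))"
    using e by (simp add: \<tau>_opp P.m_assoc)
  moreover have "y = vx (src \<G> (opp \<G> e)) (g \<otimes>\<^bsub>P\<^esub> \<tau> e)"
    using e by simp
  ultimately show ?thesis
    unfolding adjt_def using e(1,2) by (intro bexI[of _ "opp \<G> e"] bexI[of _ "g \<otimes>\<^bsub>P\<^esub> \<tau> e"]) auto
qed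

lemma adjt_act:
  assumes "h \<in> carrier P" "adjt x y"
  shows "adjt (actt h x) (actt h y)"
proof -
  obtain e g where e: "e \<in> edges \<G>" "g \<in> carrier P" "x = vx (src \<G> e) g" "y = vx (tgt \<G> e) (g \<otimes>\<^bsub>P\<^esub> \<tau> e)"
    using assms by (auto simp: adjt_def)
  then show ?thesis
    unfolding adjt_def using assms(1)
    by (intro bexI[of _ e] bexI[of _ "h \<otimes>\<^bsub>P\<^esub> g"]) (auto simp: actt_vx P.m_assoc)
qed

lemma adjt_act_rtranclp:
  assumes "adjt\<^sup>*\<^sup>* x y" "h \<in> carrier P"
  shows "adjt\<^sup>*\<^sup>* (actt h x) (actt h y)"
  using assms(1)
proof (induction rule: rtranclp_induct)
  case (step y z)
  then show ?case
    using adjt_act[OF assms(2)] by (meson rtranclp.rtrancl_into_rtrancl)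
qed simp

lemma adjt_rtranclp_sym: "adjt\<^sup>*\<^sup>* x y \<Longrightarrow> adjt\<^sup>*\<^sup>* y x"
proof (induction rule: rtranclp_induct)
  case (step y z)
  then show ?case
    using adjt_sym by (meson converse_rtranclp_into_rtranclp)
qed simp

lemma adjt_tree:
  assumes "u \<in> verts \<G>" "v \<in> verts \<G>"
  shows "adjt\<^sup>*\<^sup>* (vx u \<one>\<^bsub>P\<^esub>) (vx v \<one>\<^bsub>P\<^esub>)"
proof -
  obtain p where "walk (\<G>\<lparr>edges := T\<rparr>) u p v"
  proof -
    have "connected_graph (\<G>\<lparr>edges := T\<rparr>)"
      using max_tree by (simp add: maximal_tree_def tree_def)
    then show ?thesis
      using that assms unfolding connected_graph_def by simp blast
  qed
  then show ?thesis
  proof (induction p arbitrary: u)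
    case (Cons e p)
    then have e: "e \<in> T" "src \<G> e = u" "walk (\<G>\<lparr>edges := T\<rparr>) (tgt \<G> e) p v"
      by auto
    have "adjt (vx u \<one>\<^bsub>P\<^esub>) (vx (tgt \<G> e) \<one>\<^bsub>P\<^esub>)"
      unfolding adjt_def using e T_edges[OF e(1)] \<tau>_tree[OF e(1)]
      by (intro bexI[of _ e] bexI[of _ "\<one>\<^bsub>P\<^esub>"]) auto
    then show ?case
      using Cons.IH[OF e(3)] by (rule converse_rtranclp_into_rtranclp)
  qed simp
qed

text \<open>Elements that keep the base vertex in its own component are closed under left
  multiplication by letters, since translation preserves paths. Every other vertex is joined to a
  translate of the base vertex by a lift of the maximal tree.\<close>

lemma adjt_connected:
  assumes x: "x \<in> Vt" and y: "y \<in> Vt"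
  shows "adjt\<^sup>*\<^sup>* x y"
proof -
  obtain v0 where v0: "v0 \<in> verts \<G>"
    using verts_nonempty by blast
  let ?x0 = "vx v0 \<one>\<^bsub>P\<^esub>"
  have edge: "adjt\<^sup>*\<^sup>* ?x0 (actt (\<tau> e) ?x0)" if e: "e \<in> edges \<G>" for e
  proof -
    have "adjt\<^sup>*\<^sup>* ?x0 (vx (src \<G> e) \<one>\<^bsub>P\<^esub>)"
      using adjt_tree v0 e by simp
    also have "adjt (vx (src \<G> e) \<one>\<^bsub>P\<^esub>) (vx (tgt \<G> e) (\<one>\<^bsub>P\<^esub> \<otimes>\<^bsub>P\<^esub> \<tau> e))"
      unfolding adjt_def using e by blast
    also have "vx (tgt \<G> e) (\<one>\<^bsub>P\<^esub> \<otimes>\<^bsub>P\<^esub> \<tau> e) = actt (\<tau> e) (vx (tgt \<G> e) \<one>\<^bsub>P\<^esub>)"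
      using e by (simp add: actt_vx)
    also have "adjt\<^sup>*\<^sup>* (actt (\<tau> e) (vx (tgt \<G> e) \<one>\<^bsub>P\<^esub>)) (actt (\<tau> e) ?x0)"
      using e v0 by (intro adjt_act_rtranclp adjt_tree) auto
    finally show ?thesis .
  qed
  have vertex: "adjt\<^sup>*\<^sup>* ?x0 (actt (\<iota> u a) ?x0)" if u: "u \<in> verts \<G>" "a \<in> carrier (vgrp \<G> u)" for u a
  proof -
    have "actt (\<iota> u a) (vx u \<one>\<^bsub>P\<^esub>) = vx u (\<one>\<^bsub>P\<^esub> \<otimes>\<^bsub>P\<^esub> \<iota> u a)"
      using u by (simp add: actt_vx)
    also have "\<dots> = vx u \<one>\<^bsub>P\<^esub>"
      using u by (intro vx_mult_B) (auto simp: B_def)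
    finally have fix_u: "actt (\<iota> u a) (vx u \<one>\<^bsub>P\<^esub>) = vx u \<one>\<^bsub>P\<^esub>" .
    have "adjt\<^sup>*\<^sup>* ?x0 (vx u \<one>\<^bsub>P\<^esub>)"
      using adjt_tree v0 u by simp
    also have "vx u \<one>\<^bsub>P\<^esub> = actt (\<iota> u a) (vx u \<one>\<^bsub>P\<^esub>)"
      by (simp add: fix_u)
    also have "adjt\<^sup>*\<^sup>* \<dots> (actt (\<iota> u a) ?x0)"
      using u v0 by (intro adjt_act_rtranclp adjt_tree) auto
    finally show ?thesis .
  qed
  have reach: "adjt\<^sup>*\<^sup>* ?x0 (actt g ?x0)" if "g \<in> carrier P" for g
    using that unfolding fundamental_group_def
  proof (induction rule: presented_group_induct)
    case one
    show ?case
      using v0 by (simp flip: fundamental_group_def)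
  next
    case (gen x b g)
    let ?s = "wclass X R [(x, b)]"
    have s: "?s \<in> carrier P" and g: "g \<in> carrier P"
      using gen(1,2) by (simp_all add: fundamental_group_def wclass_closed)
    have "adjt\<^sup>*\<^sup>* ?x0 (actt ?s ?x0)"
    proof (cases x)
      case (VElt u a)
      then have u: "u \<in> verts \<G>" "a \<in> carrier (vgrp \<G> u)"
        using gen(1) by auto
      interpret \<iota>: group_hom "vgrp \<G> u" P "\<iota> u"
        by (rule \<iota>_hom[OF u(1)])
      have "?s = \<iota> u (if b then a else inv\<^bsub>vgrp \<G> u\<^esub> a)"
        using VElt u inv_wclass[OF gen(1), of R True] by (cases b) (simp_all add: \<iota>_def[of u a] fundamental_group_def)
      then show ?thesis
        using vertex u by simp
    next
      case (Edge e)
      then have "?s = \<tau> (if b then e else opp \<G> e)"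
        using gen(1) inv_wclass[OF gen(1), of R True] by (cases b) (simp_all add: \<tau>_opp \<tau>_def[of e] fundamental_group_def)
      then show ?thesis
        using edge Edge gen(1) by simp
    qed
    also have "adjt\<^sup>*\<^sup>* (actt ?s ?x0) (actt ?s (actt g ?x0))"
      using gen(3) s by (intro adjt_act_rtranclp) (auto simp: fundamental_group_def)
    also have "actt ?s (actt g ?x0) = actt (?s \<otimes>\<^bsub>P\<^esub> g) ?x0"
      using s g v0 by (simp add: t.act_mult)
    finally show ?case
      by (simp add: fundamental_group_def)
  qed
  have from_x0: "adjt\<^sup>*\<^sup>* ?x0 z" if zV: "z \<in> Vt" for z
  proof -
    obtain v g where z: "z = vx v g" "v \<in> verts \<G>" "g \<in> carrier P"
      using zV by (auto simp: Vt_def)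
    have "adjt\<^sup>*\<^sup>* (actt g ?x0) (actt g (vx v \<one>\<^bsub>P\<^esub>))"
      using z v0 by (intro adjt_act_rtranclp adjt_tree) auto
    then have "adjt\<^sup>*\<^sup>* (actt g ?x0) z"
      using z by (simp add: actt_vx)
    then show ?thesis
      using reach[OF z(3)] by (meson rtranclp_trans)
  qed
  show ?thesis
    using from_x0[OF x] from_x0[OF y] adjt_rtranclp_sym by (meson rtranclp_trans)
qed

sublocale t: tree_act P Vt actt adjt
proof -
  obtain ht :: "'v \<times> ('v, 'e, 'g) gog_gen word set set \<Rightarrow> 'e \<Rightarrow> ('v, 'e, 'g) gog_gen word set \<Rightarrow> bool"
    where ht: "\<And>e g. e \<in> edges \<G> \<Longrightarrow> g \<in> carrier P \<Longrightarrow>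
      xr (ht (vx (src \<G> e) g)) (ht (vx (tgt \<G> e) (g \<otimes>\<^bsub>P\<^esub> \<tau> e))) = P.shift g (\<delta> e)"
    using ex_height by blast
  have ht_change: "(ht (vx (src \<G> e) g) f h \<noteq> ht (vx (tgt \<G> e) (g \<otimes>\<^bsub>P\<^esub> \<tau> e)) f h) = P.shift g (\<delta> e) f h"
    if "e \<in> edges \<G>" "g \<in> carrier P" for e g f h
    using ht[OF that] by (metis xr_def)
  have self: "P.shift g (\<delta> e) e g" if "e \<in> edges \<G>" "g \<in> carrier P" for e g
    using that subgroup.one_closed[OF subgroup_A[OF that(1)]] by (simp add: P.shift_def \<delta>_def)
  \<comment> \<open>A name in the translated \<open>\<delta>\<close> belongs to the same lifted
    edge, in one of its two orientations.\<close>
  have same_edge: "vx (src \<G> f) h = vx (src \<G> e) g \<and> vx (tgt \<G> f) (h \<otimes>\<^bsub>P\<^esub> \<tau> f) = vx (tgt \<G> e) (g \<otimes>\<^bsub>P\<^esub> \<tau> e)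
      \<or> vx (src \<G> f) h = vx (tgt \<G> e) (g \<otimes>\<^bsub>P\<^esub> \<tau> e) \<and> f = opp \<G> e"
    if e: "e \<in> edges \<G>" and g: "g \<in> carrier P" and f: "f \<in> edges \<G>" and h: "h \<in> carrier P"
      and sh: "P.shift g (\<delta> e) f h" for e g f h
  proof -
    have "f = e \<and> inv\<^bsub>P\<^esub> g \<otimes>\<^bsub>P\<^esub> h \<in> A e \<or> f = opp \<G> e \<and> inv\<^bsub>P\<^esub> \<tau> e \<otimes>\<^bsub>P\<^esub> (inv\<^bsub>P\<^esub> g \<otimes>\<^bsub>P\<^esub> h) \<in> A (opp \<G> e)"
      using sh by (simp add: P.shift_def \<delta>_def)
    then show ?thesis
    proof
      assume f_e: "f = e \<and> inv\<^bsub>P\<^esub> g \<otimes>\<^bsub>P\<^esub> h \<in> A e"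
      define a where "a = inv\<^bsub>P\<^esub> g \<otimes>\<^bsub>P\<^esub> h"
      have "h = g \<otimes>\<^bsub>P\<^esub> a"
        using g h by (simp add: a_def P.m_assoc[symmetric])
      then show ?thesis
        using vx_edge_A[OF e g, of a] f_e by (simp add: a_def)
    next
      assume f_e: "f = opp \<G> e \<and> inv\<^bsub>P\<^esub> \<tau> e \<otimes>\<^bsub>P\<^esub> (inv\<^bsub>P\<^esub> g \<otimes>\<^bsub>P\<^esub> h) \<in> A (opp \<G> e)"
      define a where "a = inv\<^bsub>P\<^esub> \<tau> e \<otimes>\<^bsub>P\<^esub> (inv\<^bsub>P\<^esub> g \<otimes>\<^bsub>P\<^esub> h)"
      have h_eq: "h = (g \<otimes>\<^bsub>P\<^esub> \<tau> e) \<otimes>\<^bsub>P\<^esub> a"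
        using e g h by (simp add: a_def P.m_assoc) (simp add: P.m_assoc[symmetric])
      have a_in: "a \<in> A (opp \<G> e)"
        using f_e by (simp add: a_def)
      have "vx (src \<G> f) h = vx (tgt \<G> e) (g \<otimes>\<^bsub>P\<^esub> \<tau> e)"
        using vx_edge_A(1)[of "opp \<G> e" "g \<otimes>\<^bsub>P\<^esub> \<tau> e" a] e g f_e a_in unfolding h_eq by simp
      then show ?thesis
        using f_e by blast
    qed
  qed
  show "tree_act P Vt actt adjt"
  proof unfold_locales
    fix x y assume "adjt x y"
    then obtain e g where e: "e \<in> edges \<G>" "g \<in> carrier P" "x = vx (src \<G> e) g" "y = vx (tgt \<G> e) (g \<otimes>\<^bsub>P\<^esub> \<tau> e)"
      by (auto simp: adjt_def)
    \<comment> \<open>The height at the name \<open>(e, g)\<close> changes only across this edge, so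
      its two values give the two sides of the cut.\<close>
    define Y where "Y = {z. ht z e g = ht x e g}"
    have ne: "ht x e g \<noteq> ht y e g"
      using ht_change[OF e(1,2), of e g] self[OF e(1,2)] e(3,4) by simp
    then have xy: "x \<in> Y" "y \<notin> Y"
      by (auto simp: Y_def)
    have "a = x \<and> b = y" if ab: "adjt a b" "a \<in> Y" "b \<notin> Y" for a b
    proof -
      obtain f h where f: "f \<in> edges \<G>" "h \<in> carrier P" "a = vx (src \<G> f) h" "b = vx (tgt \<G> f) (h \<otimes>\<^bsub>P\<^esub> \<tau> f)"
        using ab(1) by (auto simp: adjt_def)
      have "ht a e g \<noteq> ht b e g"
        using ab(2,3) by (auto simp: Y_def)
      then have "P.shift h (\<delta> f) e g"
        using ht_change[OF f(1,2), of e g] f(3,4) by simp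
      then have "x = a \<and> y = b \<or> x = b"
        using same_edge[OF f(1,2) e(1,2)] e f by blast
      then show ?thesis
        using ab(3) xy by blast
    qed
    then show "\<exists>Y. x \<in> Y \<and> y \<notin> Y \<and> (\<forall>a b. adjt a b \<longrightarrow> a \<in> Y \<longrightarrow> b \<notin> Y \<longrightarrow> a = x \<and> b = y)"
      using xy by blast
    show "x \<in> Vt \<and> y \<in> Vt"
      using adjt_Vt \<open>adjt x y\<close> by blast
    show "adjt y x"
      using adjt_sym \<open>adjt x y\<close> by blast
    show "adjt (actt h x) (actt h y)" if "h \<in> carrier P" for h
      using adjt_act[OF that] \<open>adjt x y\<close> by blast
    show "actt h y \<noteq> x" if h: "h \<in> carrier P" and hx: "actt h x = y" for h
    proof
      assume hy: "actt h y = x"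
      have hg: "h \<otimes>\<^bsub>P\<^esub> g \<in> carrier P"
        using h e(2) by simp
      have "actt h x = vx (src \<G> e) (h \<otimes>\<^bsub>P\<^esub> g)" "actt h y = vx (tgt \<G> e) (h \<otimes>\<^bsub>P\<^esub> g \<otimes>\<^bsub>P\<^esub> \<tau> e)"
        using e h by (simp_all add: actt_vx P.m_assoc)
      then have hxy: "y = vx (src \<G> e) (h \<otimes>\<^bsub>P\<^esub> g)" "x = vx (tgt \<G> e) (h \<otimes>\<^bsub>P\<^esub> g \<otimes>\<^bsub>P\<^esub> \<tau> e)"
        using hx hy by simp_all
      \<comment> \<open>The name \<open>(e, g)\<close> belongs to the translated edge as well. As
        \<open>e\<close> differs from its opposite, the orientations agree and the two ends would
        coincide.\<close>
      have "P.shift (h \<otimes>\<^bsub>P\<^esub> g) (\<delta> e) e g"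
        using ht_change[OF e(1) hg, of e g] ne hxy by simp
      then have "x = y"
        using same_edge[OF e(1) hg e(1,2)] e hxy by (metis edge_simps(7))
      then show False
        using ne by simp
    qed
  qed (use adjt_connected in blast)
qed

end

section \<open>Stabilizers in the Bass--Serre tree\<close>

context spanned_gog
begin

lemma fixer_vx:
  assumes v: "v \<in> verts \<G>" and g: "g \<in> carrier P"
  shows "t.fixer (vx v g) = (\<lambda>a. g \<otimes>\<^bsub>P\<^esub> \<iota> v a \<otimes>\<^bsub>P\<^esub> inv\<^bsub>P\<^esub> g) ` carrier (vgrp \<G> v)"
proof (intro equalityI subsetI)
  fix h assume h: "h \<in> t.fixer (vx v g)"
  then have hc: "h \<in> carrier P" and "vx v g = vx v (h \<otimes>\<^bsub>P\<^esub> g)"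
    using v g by (auto simp: t.fixer_def actt_vx)
  then have "inv\<^bsub>P\<^esub> g \<otimes>\<^bsub>P\<^esub> (h \<otimes>\<^bsub>P\<^esub> g) \<in> B v"
    using vx_eq_iff[OF v g] g by simp
  then obtain a where a: "a \<in> carrier (vgrp \<G> v)" "inv\<^bsub>P\<^esub> g \<otimes>\<^bsub>P\<^esub> (h \<otimes>\<^bsub>P\<^esub> g) = \<iota> v a"
    by (auto simp: B_def)
  have "h = g \<otimes>\<^bsub>P\<^esub> \<iota> v a \<otimes>\<^bsub>P\<^esub> inv\<^bsub>P\<^esub> g"
    unfolding a(2)[symmetric] using g hc by (simp add: P.m_assoc) (simp add: P.m_assoc[symmetric])
  then show "h \<in> (\<lambda>a. g \<otimes>\<^bsub>P\<^esub> \<iota> v a \<otimes>\<^bsub>P\<^esub> inv\<^bsub>P\<^esub> g) ` carrier (vgrp \<G> v)"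
    using a(1) by blast
next
  fix h assume "h \<in> (\<lambda>a. g \<otimes>\<^bsub>P\<^esub> \<iota> v a \<otimes>\<^bsub>P\<^esub> inv\<^bsub>P\<^esub> g) ` carrier (vgrp \<G> v)"
  then obtain a where a: "a \<in> carrier (vgrp \<G> v)" "h = g \<otimes>\<^bsub>P\<^esub> \<iota> v a \<otimes>\<^bsub>P\<^esub> inv\<^bsub>P\<^esub> g"
    by blast
  have "h \<otimes>\<^bsub>P\<^esub> g = g \<otimes>\<^bsub>P\<^esub> \<iota> v a"
    using v g a by (simp add: P.m_assoc)
  then have "vx v (h \<otimes>\<^bsub>P\<^esub> g) = vx v g"
    using vx_mult_B[OF v g, of "\<iota> v a"] a(1) by (simp add: B_def)
  then show "h \<in> t.fixer (vx v g)"
    using v g a by (simp add: t.fixer_def actt_vx)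
qed

lemma fixer_vx_iso:
  assumes v: "v \<in> verts \<G>" and g: "g \<in> carrier P"
  shows "vgrp \<G> v \<cong> P\<lparr>carrier := t.fixer (vx v g)\<rparr>"
proof -
  interpret \<iota>: group_hom "vgrp \<G> v" P "\<iota> v"
    by (rule \<iota>_hom[OF v])
  let ?k = "\<lambda>a. g \<otimes>\<^bsub>P\<^esub> \<iota> v a \<otimes>\<^bsub>P\<^esub> inv\<^bsub>P\<^esub> g"
  have "?k (a \<otimes>\<^bsub>vgrp \<G> v\<^esub> b) = ?k a \<otimes>\<^bsub>P\<^esub> ?k b" if "a \<in> carrier (vgrp \<G> v)" "b \<in> carrier (vgrp \<G> v)" for a b
    using that g by (simp add: P.m_assoc) (simp add: P.m_assoc[symmetric])
  then have "?k \<in> hom (vgrp \<G> v) (P\<lparr>carrier := t.fixer (vx v g)\<rparr>)"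
    unfolding fixer_vx[OF v g] by (auto simp: hom_def)
  moreover have "inj_on ?k (carrier (vgrp \<G> v))"
    using \<iota>_inj[OF v] g by (auto simp: inj_on_def)
  ultimately have "?k \<in> iso (vgrp \<G> v) (P\<lparr>carrier := t.fixer (vx v g)\<rparr>)"
    unfolding fixer_vx[OF v g] by (simp add: iso_def bij_betw_def)
  then show ?thesis
    by (rule is_isoI)
qed

end

locale spanned_gbs = spanned_gog \<G> T
  for \<G> :: "('v, 'e, 'g, 'h) gog" and T :: "'e set" +
  fixes n :: nat
  assumes vgrp_iso: "v \<in> verts \<G> \<Longrightarrow> vgrp \<G> v \<cong> Z_pow n"
    and egrp_iso: "e \<in> edges \<G> \<Longrightarrow> egrp \<G> e \<cong> Z_pow n"
    and finite_edges: "finite (edges \<G>)"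
begin

lemma fixer_iso_Z_pow:
  assumes "x \<in> Vt"
  shows "P\<lparr>carrier := t.fixer x\<rparr> \<cong> Z_pow n"
proof -
  obtain v g where x: "x = vx v g" "v \<in> verts \<G>" "g \<in> carrier P"
    using assms by (auto simp: Vt_def)
  have "P\<lparr>carrier := t.fixer x\<rparr> \<cong> vgrp \<G> v"
    using group.iso_sym[OF group_vgrp fixer_vx_iso] x by simp
  then show ?thesis
    using vgrp_iso[OF x(2)] by (rule iso_trans)
qed

text \<open>Here the equality of all ranks enters: in coordinates the inclusion of the edge group is
  a monomorphism from Z^n to Z^n, so its image contains all multiples of some \<open>d\<close>, and
  coordinates modulo \<open>d\<close> determine the neighbouring vertex.\<close>

lemma finite_edge_orbit:
  assumes e: "e \<in> edges \<G>" and g: "g \<in> carrier P"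
  shows "finite ((\<lambda>b. vx (tgt \<G> e) (g \<otimes>\<^bsub>P\<^esub> \<iota> (src \<G> e) b \<otimes>\<^bsub>P\<^esub> \<tau> e)) ` carrier (vgrp \<G> (src \<G> e)))"
proof -
  define u where "u = src \<G> e"
  have u: "u \<in> verts \<G>"
    using e by (simp add: u_def)
  interpret E: group "egrp \<G> e"
    using e by simp
  interpret U: group "vgrp \<G> u"
    using u by simp
  interpret \<iota>: group_hom "vgrp \<G> u" P "\<iota> u"
    by (rule \<iota>_hom[OF u])
  obtain \<xi> where \<xi>: "\<xi> \<in> iso (Z_pow n) (vgrp \<G> u)"
    using U.iso_sym[OF vgrp_iso[OF u]] by (auto simp: is_iso_def)
  obtain \<eta> where \<eta>: "\<eta> \<in> iso (Z_pow n) (egrp \<G> e)"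
    using E.iso_sym[OF egrp_iso[OF e]] by (auto simp: is_iso_def)
  let ?\<xi>' = "inv_into (carrier (Z_pow n)) \<xi>"
  have \<xi>': "?\<xi>' \<in> iso (vgrp \<G> u) (Z_pow n)"
    by (rule Z_pow.iso_set_sym[OF \<xi>])
  have "emb \<G> (opp \<G> e) \<in> mon (egrp \<G> e) (vgrp \<G> u)"
    using emb_opp_mon[OF e] by (simp add: u_def)
  then have "emb \<G> (opp \<G> e) \<circ> \<eta> \<in> mon (Z_pow n) (vgrp \<G> u)"
    using \<eta> by (intro mon_compose[of \<eta> _ "egrp \<G> e"]) (auto simp: iso_iff_mon_epi)
  then have "?\<xi>' \<circ> (emb \<G> (opp \<G> e) \<circ> \<eta>) \<in> mon (Z_pow n) (Z_pow n)"
    using \<xi>' by (intro mon_compose[of _ _ "vgrp \<G> u"]) (auto simp: iso_iff_mon_epi)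
  then obtain d :: int where d: "d > 0"
    and d_img: "\<And>x. x \<in> carrier (Z_pow n) \<Longrightarrow> (\<And>i. i < n \<Longrightarrow> d dvd x i) \<Longrightarrow>
      x \<in> (?\<xi>' \<circ> (emb \<G> (opp \<G> e) \<circ> \<eta>)) ` carrier (Z_pow n)"
    using Z_pow_mon_image_multiples by blast
  have \<xi>_closed: "\<xi> z \<in> carrier (vgrp \<G> u)" if "z \<in> carrier (Z_pow n)" for z
    using \<xi> that by (auto simp: iso_def hom_def)
  have \<xi>_mult: "\<xi> (z \<otimes>\<^bsub>Z_pow n\<^esub> w) = \<xi> z \<otimes>\<^bsub>vgrp \<G> u\<^esub> \<xi> w" if "z \<in> carrier (Z_pow n)" "w \<in> carrier (Z_pow n)" for z w
    using \<xi> that by (auto simp: iso_def hom_def)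
  let ?f = "\<lambda>z. vx (tgt \<G> e) (g \<otimes>\<^bsub>P\<^esub> \<iota> u (\<xi> z) \<otimes>\<^bsub>P\<^esub> \<tau> e)"
  have "finite (?f ` carrier (Z_pow n))"
  proof (rule finite_image_Z_pow[OF d])
    fix x y
    assume x: "x \<in> carrier (Z_pow n)" and y: "y \<in> carrier (Z_pow n)" and dvd: "\<And>i. i < n \<Longrightarrow> d dvd x i - y i"
    define w where "w = x \<otimes>\<^bsub>Z_pow n\<^esub> inv\<^bsub>Z_pow n\<^esub> y"
    have w: "w \<in> carrier (Z_pow n)" "x = y \<otimes>\<^bsub>Z_pow n\<^esub> w"
      using x y by (simp_all add: w_def Z_pow.m_lcomm)
    have "w \<in> (?\<xi>' \<circ> (emb \<G> (opp \<G> e) \<circ> \<eta>)) ` carrier (Z_pow n)"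
      using w(1) dvd y by (intro d_img) (auto simp: w_def)
    then obtain z where z: "z \<in> carrier (Z_pow n)" "w = ?\<xi>' (emb \<G> (opp \<G> e) (\<eta> z))"
      by auto
    have \<eta>z: "\<eta> z \<in> carrier (egrp \<G> e)"
      using \<eta> z(1) by (auto simp: iso_def hom_def)
    then have "emb \<G> (opp \<G> e) (\<eta> z) \<in> \<xi> ` carrier (Z_pow n)"
      using \<xi> emb_closed(2)[OF e \<eta>z] by (simp add: iso_def bij_betw_def u_def)
    then have \<xi>w: "\<xi> w = emb \<G> (opp \<G> e) (\<eta> z)"
      unfolding z(2) by (rule f_inv_into_f)
    define a where "a = \<iota> u (\<xi> w)"
    have a: "a \<in> A e"
      using \<eta>z by (auto simp: a_def \<xi>w A_def u_def)
    have "\<iota> u (\<xi> x) = \<iota> u (\<xi> y) \<otimes>\<^bsub>P\<^esub> a"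
      using w y \<xi>_closed by (simp add: w(2) \<xi>_mult a_def)
    then have "g \<otimes>\<^bsub>P\<^esub> \<iota> u (\<xi> x) \<otimes>\<^bsub>P\<^esub> \<tau> e = g \<otimes>\<^bsub>P\<^esub> \<iota> u (\<xi> y) \<otimes>\<^bsub>P\<^esub> a \<otimes>\<^bsub>P\<^esub> \<tau> e"
      using g e \<xi>_closed[OF y] subgroup.mem_carrier[OF subgroup_A[OF e] a] by (simp add: P.m_assoc)
    then show "?f x = ?f y"
      using vx_edge_A(2)[OF e _ a, of "g \<otimes>\<^bsub>P\<^esub> \<iota> u (\<xi> y)"] g \<xi>_closed[OF y] by simp
  qed
  moreover have "carrier (vgrp \<G> u) = \<xi> ` carrier (Z_pow n)"
    using \<xi> by (auto simp: iso_def bij_betw_def)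
  ultimately show ?thesis
    unfolding u_def[symmetric] by (simp add: image_image)
qed

text \<open>Commensurability of adjacent stabilizers propagates along a path.\<close>

lemma finite_fixer_orbit:
  assumes "x \<in> Vt" "y \<in> Vt"
  shows "finite ((\<lambda>h. actt h y) ` t.fixer x)"
  using t.connected[OF assms]
proof (induction rule: rtranclp_induct)
  case base
  have "(\<lambda>h. actt h x) ` t.fixer x \<subseteq> {x}"
    by (auto simp: t.fixer_def)
  then show ?case
    by (rule finite_subset) simp
next
  case (step a b)
  obtain e g where e: "e \<in> edges \<G>" "g \<in> carrier P" "a = vx (src \<G> e) g" "b = vx (tgt \<G> e) (g \<otimes>\<^bsub>P\<^esub> \<tau> e)"
    using step(2) by (auto simp: adjt_def)
  have "actt (g \<otimes>\<^bsub>P\<^esub> \<iota> (src \<G> e) c \<otimes>\<^bsub>P\<^esub> inv\<^bsub>P\<^esub> g) b = vx (tgt \<G> e) (g \<otimes>\<^bsub>P\<^esub> \<iota> (src \<G> e) c \<otimes>\<^bsub>P\<^esub> \<tau> e)"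
    if "c \<in> carrier (vgrp \<G> (src \<G> e))" for c
    using that e by (simp add: actt_vx P.m_assoc) (simp add: P.m_assoc[symmetric])
  then have "(\<lambda>h. actt h b) ` t.fixer a
      = (\<lambda>c. vx (tgt \<G> e) (g \<otimes>\<^bsub>P\<^esub> \<iota> (src \<G> e) c \<otimes>\<^bsub>P\<^esub> \<tau> e)) ` carrier (vgrp \<G> (src \<G> e))"
    using e by (simp add: fixer_vx image_image)
  then have "finite ((\<lambda>h. actt h b) ` t.fixer a)"
    using finite_edge_orbit[OF e(1,2)] by simp
  then show ?case
    using t.finite_fixer_orbit_trans[of x a b] assms(1) adjt_Vt[OF step(2)] step.IH by blast
qed

lemma commensurable_tree:
  "commensurable_tree_act P Vt actt adjt
    ((\<lambda>e. (vx (src \<G> e) \<one>\<^bsub>P\<^esub>, vx (tgt \<G> e) (\<tau> e))) ` edges \<G>) ((\<lambda>v. vx v \<one>\<^bsub>P\<^esub>) ` verts \<G>)"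
proof unfold_locales
  fix x g h assume x: "x \<in> Vt" and gh: "g \<in> t.fixer x" "h \<in> t.fixer x"
  have grp: "group (P\<lparr>carrier := t.fixer x\<rparr>)"
    by (rule P.subgroup_imp_group[OF t.subgroup_fixer[OF x]])
  have "comm_group (P\<lparr>carrier := t.fixer x\<rparr>)"
    using Z_pow.iso_imp_comm_group[OF group.iso_sym[OF grp fixer_iso_Z_pow[OF x]] group.is_monoid[OF grp]] .
  then show "g \<otimes>\<^bsub>P\<^esub> h = h \<otimes>\<^bsub>P\<^esub> g"
    using gh comm_monoid.m_comm[OF comm_group.axioms(1)] by fastforce
next
  show "Vt \<noteq> {}"
    using verts_nonempty vx_Vt[OF _ P.one_closed] by blast
  show "finite ((\<lambda>e. (vx (src \<G> e) \<one>\<^bsub>P\<^esub>, vx (tgt \<G> e) (\<tau> e))) ` edges \<G>)"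
    using finite_edges by simp
  show "finite ((\<lambda>v. vx v \<one>\<^bsub>P\<^esub>) ` verts \<G>)"
    using finite_verts by simp
  show "(\<lambda>v. vx v \<one>\<^bsub>P\<^esub>) ` verts \<G> \<subseteq> Vt"
    by auto
next
  fix a b assume "(a, b) \<in> (\<lambda>e. (vx (src \<G> e) \<one>\<^bsub>P\<^esub>, vx (tgt \<G> e) (\<tau> e))) ` edges \<G>"
  then obtain e where "e \<in> edges \<G>" "a = vx (src \<G> e) \<one>\<^bsub>P\<^esub>" "b = vx (tgt \<G> e) (\<one>\<^bsub>P\<^esub> \<otimes>\<^bsub>P\<^esub> \<tau> e)"
    by auto
  then show "adjt a b"
    unfolding adjt_def by blast
next
  fix x y assume "adjt x y"
  then obtain e g where e: "e \<in> edges \<G>" "g \<in> carrier P" "x = vx (src \<G> e) g" "y = vx (tgt \<G> e) (g \<otimes>\<^bsub>P\<^esub> \<tau> e)"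
    by (auto simp: adjt_def)
  then have "x = actt g (vx (src \<G> e) \<one>\<^bsub>P\<^esub>)" "y = actt g (vx (tgt \<G> e) (\<tau> e))"
    by (simp_all add: actt_vx)
  then show "\<exists>g\<in>carrier P. \<exists>(a, b)\<in>(\<lambda>e. (vx (src \<G> e) \<one>\<^bsub>P\<^esub>, vx (tgt \<G> e) (\<tau> e))) ` edges \<G>.
      x = actt g a \<and> y = actt g b"
    using e(1,2) by blast
next
  fix x assume "x \<in> Vt"
  then obtain v g where v: "x = vx v g" "v \<in> verts \<G>" "g \<in> carrier P"
    by (auto simp: Vt_def)
  then have "x = actt g (vx v \<one>\<^bsub>P\<^esub>)"
    by (simp add: actt_vx)
  then show "\<exists>g\<in>carrier P. \<exists>a\<in>(\<lambda>v. vx v \<one>\<^bsub>P\<^esub>) ` verts \<G>. x = actt g a"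
    using v by blast
qed (use finite_fixer_orbit in blast)

end

section \<open>Transfer from the fundamental group to an isomorphic group\<close>

lemma commensurable_tree_act_pullback:
  assumes act: "commensurable_tree_act P V act adj R W" and G: "group G" and \<theta>: "\<theta> \<in> iso G P"
  shows "commensurable_tree_act G V (\<lambda>g. act (\<theta> g)) adj R W"
proof -
  interpret P: commensurable_tree_act P V act adj R W
    by (rule act)
  interpret G: group G
    by (rule G)
  interpret \<theta>: group_hom G P \<theta>
    using \<theta> by unfold_locales (simp add: iso_def)
  have inj: "inj_on \<theta> (carrier G)" and surj: "\<theta> ` carrier G = carrier P"
    using \<theta> by (auto simp: iso_def bij_betw_def)
  interpret A: group_act G V "\<lambda>g. act (\<theta> g)"
    by unfold_locales (auto simp: P.act_mult)
  have fixer: "\<theta> g \<in> P.fixer x" if "g \<in> A.fixer x" for g x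
    using that by (auto simp: A.fixer_def P.fixer_def)
  show ?thesis
  proof unfold_locales
    fix g x y assume "g \<in> carrier G" "adj x y"
    then show "adj (act (\<theta> g) x) (act (\<theta> g) y)" "act (\<theta> g) x = y \<Longrightarrow> act (\<theta> g) y \<noteq> x"
      using P.act_adj P.no_inversion by auto
  next
    fix x g h assume x: "x \<in> V" and gh: "g \<in> A.fixer x" "h \<in> A.fixer x"
    then have "\<theta> g \<otimes>\<^bsub>P\<^esub> \<theta> h = \<theta> h \<otimes>\<^bsub>P\<^esub> \<theta> g"
      using P.stab_commute fixer by blast
    moreover have "g \<in> carrier G" "h \<in> carrier G"
      using gh by (auto simp: A.fixer_def)
    ultimately show "g \<otimes>\<^bsub>G\<^esub> h = h \<otimes>\<^bsub>G\<^esub> g"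
      using inj by (auto dest: inj_onD simp flip: \<theta>.hom_mult)
  next
    fix x y assume "x \<in> V" "y \<in> V"
    then have "finite ((\<lambda>g. act g y) ` P.fixer x)"
      by (rule P.finite_stab_orbit)
    moreover have "(\<lambda>g. act (\<theta> g) y) ` A.fixer x \<subseteq> (\<lambda>g. act g y) ` P.fixer x"
      using fixer by auto
    ultimately show "finite ((\<lambda>g. act (\<theta> g) y) ` A.fixer x)"
      by (rule rev_finite_subset)
  next
    fix x y assume "adj x y"
    then obtain p a b where p: "p \<in> carrier P" "(a, b) \<in> R" "x = act p a" "y = act p b"
      using P.R_cover by blast
    then obtain g where "g \<in> carrier G" "p = \<theta> g"
      using surj by blast
    then show "\<exists>g\<in>carrier G. \<exists>(a, b)\<in>R. x = act (\<theta> g) a \<and> y = act (\<theta> g) b"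
      using p by blast
  next
    fix x assume "x \<in> V"
    then obtain p a where p: "p \<in> carrier P" "a \<in> W" "x = act p a"
      using P.W_cover by blast
    then obtain g where "g \<in> carrier G" "p = \<theta> g"
      using surj by blast
    then show "\<exists>g\<in>carrier G. \<exists>a\<in>W. x = act (\<theta> g) a"
      using p by blast
  qed (fact P.adj_V P.adj_sym P.connected P.bridge P.V_nonempty P.finite_R P.R_edges P.finite_W P.W_V)+
qed

lemma countable_carrier_Z_pow: "countable (carrier (Z_pow n))"
proof (rule countable_image_inj_on)
  show "countable ((\<lambda>x. map x [0..<n]) ` carrier (Z_pow n))"
    by (rule countableI_type)
  show "inj_on (\<lambda>x. map x [0..<n]) (carrier (Z_pow n))"
    by (rule inj_onI, rule Z_pow_eqI) auto
qed

lemma residually_finite_gbs_group: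
  assumes gbs: "gbs_group n G" and rf: "residually_finite G"
  shows "(\<exists>\<phi>\<in>mon (Z_pow n) (Z_pow n). G \<cong> ascending_hnn (Z_pow n) \<phi>) \<or> virtually_Z_pow_by_free n G"
proof -
  obtain \<G> :: "(nat, nat, nat \<Rightarrow> int, nat \<Rightarrow> int) gog" and T where
    \<G>: "graph_of_groups \<G>" "finite (verts \<G>)" "finite (edges \<G>)"
      "\<forall>v\<in>verts \<G>. vgrp \<G> v \<cong> Z_pow n" "\<forall>e\<in>edges \<G>. egrp \<G> e \<cong> Z_pow n" "maximal_tree \<G> T"
    and G: "group G" and iso: "G \<cong> fundamental_group \<G> T"
    using gbs by (auto simp: gbs_group_def)
  have count: "countable (carrier (vgrp \<G> v))" if "v \<in> verts \<G>" for v
  proof -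
    obtain h where "h \<in> iso (vgrp \<G> v) (Z_pow n)"
      using \<G>(4) \<open>v \<in> verts \<G>\<close> by (auto simp: is_iso_def)
    then show ?thesis
      using countable_image_inj_on[of h "carrier (vgrp \<G> v)"] countable_carrier_Z_pow[of n]
      by (simp add: iso_def bij_betw_def)
  qed
  interpret spanned_gbs \<G> T n
    by unfold_locales (use \<G> count in blast)+
  obtain \<theta> where \<theta>: "\<theta> \<in> iso G P"
    using iso by (auto simp: is_iso_def)
  interpret G: group G
    by (rule G)
  interpret \<theta>: group_hom G P \<theta>
    using \<theta> by unfold_locales (simp add: iso_def)
  note act = commensurable_tree_act_pullback[OF commensurable_tree G \<theta>]
  have "G\<lparr>carrier := {g \<in> carrier G. actt (\<theta> g) x = x}\<rparr> \<cong> Z_pow n" if x: "x \<in> Vt" for x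
  proof -
    have "{g \<in> carrier G. actt (\<theta> g) x = x} = {g \<in> carrier G. \<theta> g \<in> t.fixer x}"
      by (auto simp: t.fixer_def)
    then have sub: "subgroup {g \<in> carrier G. actt (\<theta> g) x = x} G"
      using \<theta>.subgroup_vimage[OF t.subgroup_fixer[OF x]] by simp
    have "\<theta> ` {g \<in> carrier G. actt (\<theta> g) x = x} = t.fixer x"
    proof (intro equalityI subsetI)
      fix h assume h: "h \<in> t.fixer x"
      then obtain g where "g \<in> carrier G" "h = \<theta> g"
        using \<theta> by (auto simp: t.fixer_def iso_def bij_betw_def)
      then show "h \<in> \<theta> ` {g \<in> carrier G. actt (\<theta> g) x = x}"
        using h by (auto simp: t.fixer_def)
    qed (auto simp: t.fixer_def)
    then have "G\<lparr>carrier := {g \<in> carrier G. actt (\<theta> g) x = x}\<rparr> \<cong> P\<lparr>carrier := t.fixer x\<rparr>"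
      using is_isoI[OF iso_restrict[OF \<theta> G P.is_group sub]] by simp
    then show ?thesis
      using fixer_iso_Z_pow[OF x] by (rule iso_trans)
  qed
  then show ?thesis
    using residually_finite_tree_act[OF act _ rf] by blast
qed

theorem theorem3p1:
  fixes n :: nat and G :: "('a, 'b) monoid_scheme"
  assumes "n \<ge> 1" and "gbs_group n G"
  shows "residually_finite G \<longleftrightarrow>
    (\<exists>\<phi> \<in> mon (Z_pow n) (Z_pow n). G \<cong> ascending_hnn (Z_pow n) \<phi>) \<or>
    virtually_Z_pow_by_free n G"
proof
  assume "residually_finite G"
  then show "(\<exists>\<phi> \<in> mon (Z_pow n) (Z_pow n). G \<cong> ascending_hnn (Z_pow n) \<phi>) \<or> virtually_Z_pow_by_free n G"
    by (rule residually_finite_gbs_group[OF assms(2)])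
next
  have G: "group G"
    using assms(2) by (simp add: gbs_group_def)
  assume "(\<exists>\<phi> \<in> mon (Z_pow n) (Z_pow n). G \<cong> ascending_hnn (Z_pow n) \<phi>) \<or> virtually_Z_pow_by_free n G"
  then show "residually_finite G"
  proof
    assume "\<exists>\<phi> \<in> mon (Z_pow n) (Z_pow n). G \<cong> ascending_hnn (Z_pow n) \<phi>"
    then obtain \<phi> where \<phi>: "\<phi> \<in> mon (Z_pow n) (Z_pow n)" "G \<cong> ascending_hnn (Z_pow n) \<phi>"
      by blast
    then show ?thesis
      using residually_finite_iso[OF G _ \<phi>(2) residually_finite_ascending_hnn[OF \<phi>(1)]]
      by (simp add: ascending_hnn_eq group_presented_group)
  next
    assume "virtually_Z_pow_by_free n G"
    then show ?thesis
      by (rule residually_finite_virtually_Z_pow_by_free[OF G])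
  qed
qed

end
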